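(* Let $M\subseteq\mathbb{R}[X,Y]$ be a finitely generated quadratic module. Let $b\in\mathbb{R}[X,Y]$ be a polynomial of degree $d>0$ with $\Lambda-b,\ b-\lambda\in M$ for some real numbers $\lambda\le\Lambda$, and assume that the highest degree homogeneous part of $b$ factors as $\prod_{i=1}^d(r_iX+s_iY)$ with pairwise distinct points $(r_i:s_i)\in\mathbb{P}^1(\mathbb{R})$. Suppose that for all $r\in[\lambda,\Lambda]$ all the points at infinity of the curve $C_r$ defined by $b=r$ lie in the closure of $\mathcal{S}(M)\cap C_r(\mathbb{R})$. Then $$M^{\ddagger}=\overline{M}$$ holds. If in addition all the fibre modules $M+(b-r)$, $r\in[\lambda,\Lambda]$, have (SMP), then $M$ has the $\ddagger$-property.
   Context: Let $A=\mathbb{R}[X,Y]$. A quadratic module in $A$ is a set $M\subseteq A$ with $M+M\subseteq M$, $1\in M$ and $a^2m\in M$ for all $a\in A$, $m\in M$; it is finitely generated if $M=\{\sigma_0+\sigma_1f_1+\cdots+\sigma_sf_s\mid\sigma_i\text{ sums of squares in }A\}$ for some $f_1,\ldots,f_s\in A$. $\mathcal{S}(M)=\{x\in\mathbb{R}^2\mid f(x)\ge 0\ \forall f\in M\}$; $\mathrm{Pos}(Z)$ is the set of polynomials nonnegative on $Z\subseteq\mathbb{R}^2$. $M^{\ddagger}=\{f\in A\mid\exists q\in A\ \forall\varepsilon>0:\ f+\varepsilon q\in M\}$ (the sequential closure in the finest locally convex topology on $A$); $\overline{M}=M^{\vee\vee}=\{f\in A\mid L(f)\ge 0\text{ for all linear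 }L\colon A\to\mathbb{R}\text{ with }L(M)\subseteq\mathbb{R}_{\ge 0}\}$ (the closure in that topology). $M$ has (SMP) if $M^{\vee\vee}=\mathrm{Pos}(\mathcal{S}(M))$, and the $\ddagger$-property if $M^{\ddagger}=\mathrm{Pos}(\mathcal{S}(M))$. $(b-r)$ denotes the ideal of $A$ generated by $b-r$. $C_r$ is the affine plane curve defined by $b-r$, and $C_r(\mathbb{R})=\{x\in\mathbb{R}^2\mid b(x)=r\}$. Its points at infinity are the points on the line $Z=0$ of its projective closure in $\mathbb{P}^2$ (homogeneous coordinates $(X:Y:Z)$, $\mathbb{R}^2$ embedded by $(x,y)\mapsto(x:y:1)$), namely $(-s_1:r_1:0),\ldots,(-s_d:r_d:0)$. The closure is taken in $\mathbb{P}^2(\mathbb{R})$ with its usual topology. *)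

theory Defs
  imports "HOL-Analysis.Analysis" "HOL-Computational_Algebra.Polynomial"
begin

section \<open>The polynomial ring in two variables\<close>

text \<open>
  \<open>\<real>[X,Y]\<close> is represented as \<open>\<real>[X][Y]\<close>: the coefficient of \<open>X\<^sup>i Y\<^sup>j\<close> in \<open>p\<close> is
  \<open>coeff (coeff p j) i\<close>.
\<close>

type_synonym poly2 = "real poly poly"

definition const2 :: "real \<Rightarrow> poly2" where
  "const2 c = [:[:c:]:]"

definition varX :: poly2 where
  "varX = [:[:0, 1:]:]"

definition varY :: poly2 where
  "varY = [:0, 1:]"

definition eval2 :: "poly2 \<Rightarrow> real \<times> real \<Rightarrow> real" where
  "eval2 p z = poly (poly p [:snd z:]) (fst z)"

text \<open>The total degree; the zero polynomial gets degree 0.\<close>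

definition tdegree :: "poly2 \<Rightarrow> nat" where
  "tdegree p = Max (insert 0 {i + j | i j. coeff (coeff p j) i \<noteq> 0})"

definition hom_part :: "nat \<Rightarrow> poly2 \<Rightarrow> poly2" where
  "hom_part k p = (\<Sum>i\<le>k. const2 (coeff (coeff p (k - i)) i) * varX ^ i * varY ^ (k - i))"

lemma coeff2_const2_mult [simp]: "coeff (coeff (const2 c * p) j) i = c * coeff (coeff p j) i"
  by (simp add: const2_def)

lemma finite_tdegree_set: "finite {i + j | i j. coeff (coeff (p :: poly2) j) i \<noteq> 0}"
proof -
  define N where "N = Max ((\<lambda>j. degree (coeff p j)) ` {..degree p})"
  have "i + j \<le> N + degree p" if "coeff (coeff p j) i \<noteq> 0" for i j
  proof -
    from that have j: "j \<le> degree p"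
      using coeff_eq_0[of p j] by (metis coeff_0 not_le)
    have "i \<le> degree (coeff p j)"
      using that le_degree by blast
    also have "\<dots> \<le> N"
      unfolding N_def using j by (intro Max_ge) auto
    finally show ?thesis
      using j by simp
  qed
  then have "{i + j | i j. coeff (coeff p j) i \<noteq> 0} \<subseteq> {..N + degree p}"
    by auto
  then show ?thesis
    using finite_subset by blast
qed

section \<open>Quadratic modules\<close>

definition quadratic_module :: "'a::comm_ring_1 set \<Rightarrow> bool" where
  "quadratic_module M \<longleftrightarrow>
     (\<forall>m\<in>M. \<forall>n\<in>M. m + n \<in> M) \<and> 1 \<in> M \<and> (\<forall>a. \<forall>m\<in>M. a ^ 2 * m \<in> M)"

definition sums_of_squares :: "'a::comm_ring_1 set" where
  "sums_of_squares = {\<Sum>a\<leftarrow>as. a ^ 2 | as. True}"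

definition finitely_generated_qm :: "'a::comm_ring_1 set \<Rightarrow> bool" where
  "finitely_generated_qm M \<longleftrightarrow>
     (\<exists>(s::nat) f. M = {\<sigma> 0 + (\<Sum>i=1..s. \<sigma> i * f i) | \<sigma>. \<forall>i\<le>s. \<sigma> i \<in> sums_of_squares})"

definition nonneg_set :: "poly2 set \<Rightarrow> (real \<times> real) set" where
  "nonneg_set M = {z. \<forall>f\<in>M. eval2 f z \<ge> 0}"

definition Pos :: "(real \<times> real) set \<Rightarrow> poly2 set" where
  "Pos Z = {f. \<forall>z\<in>Z. eval2 f z \<ge> 0}"

definition seq_closure :: "poly2 set \<Rightarrow> poly2 set" where
  "seq_closure M = {f. \<exists>q. \<forall>\<epsilon>>0. f + const2 \<epsilon> * q \<in> M}"

text \<open>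
  \<open>real poly poly\<close> carries no \<open>real_vector\<close> instance, hence the scalar multiplication is
  passed explicitly.
\<close>

definition linear_functional :: "(poly2 \<Rightarrow> real) \<Rightarrow> bool" where
  "linear_functional L \<longleftrightarrow> Vector_Spaces.linear (\<lambda>c p. const2 c * p) (*) L"

lemma linear_functional_iff:
  "linear_functional L \<longleftrightarrow>
     (\<forall>p q. L (p + q) = L p + L q) \<and> (\<forall>c p. L (const2 c * p) = c * L p)"
proof -
  have "vector_space (\<lambda>c p. const2 c * p)"
    by unfold_locales
      (simp_all add: const2_def algebra_simps smult_add_right smult_add_left [symmetric] flip: one_pCons)
  moreover have "vector_space ((*) :: real \<Rightarrow> real \<Rightarrow> real)"
    by unfold_locales (simp_all add: algebra_simps)
  ultimately show ?thesis
    by (auto simp: linear_functional_def Vector_Spaces.linear_iff)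
qed

definition double_dual :: "poly2 set \<Rightarrow> poly2 set" where
  "double_dual M = {f. \<forall>L. linear_functional L \<and> (\<forall>m\<in>M. L m \<ge> 0) \<longrightarrow> L f \<ge> 0}"

definition SMP :: "poly2 set \<Rightarrow> bool" where
  "SMP M \<longleftrightarrow> double_dual M = Pos (nonneg_set M)"

definition ddagger_property :: "poly2 set \<Rightarrow> bool" where
  "ddagger_property M \<longleftrightarrow> seq_closure M = Pos (nonneg_set M)"

definition fibre_module :: "poly2 set \<Rightarrow> poly2 \<Rightarrow> poly2 set" where
  "fibre_module M g = {m + h * g | m h. m \<in> M}"

section \<open>Real projective spaces\<close>

text \<open>
  The points of the projective space of \<open>V\<close> are the one-dimensional subspaces of \<open>V\<close>. The
  projective line and plane are obtained for \<open>V = \<real>\<times>\<real>\<close> and \<open>V = \<real>\<times>\<real>\<times>\<real>\<close>.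
\<close>

definition proj_points :: "'a::real_vector set set" where
  "proj_points = {span {v} | v. v \<noteq> 0}"

definition proj_topology :: "'a::real_normed_vector set topology" where
  "proj_topology = topology (\<lambda>U. U \<subseteq> proj_points \<and> open {v. v \<noteq> 0 \<and> span {v} \<in> U})"

lemma openin_proj_topology:
  "openin proj_topology U \<longleftrightarrow> U \<subseteq> proj_points \<and> open {v. v \<noteq> 0 \<and> span {v} \<in> U}"
proof -
  have inter: "{v. v \<noteq> 0 \<and> span {v} \<in> S \<inter> T} =
      {v. v \<noteq> 0 \<and> span {v} \<in> S} \<inter> {v. v \<noteq> 0 \<and> span {v} \<in> T}" for S T :: "'a set set"
    by auto
  have union: "{v. v \<noteq> 0 \<and> span {v} \<in> \<Union>K} = (\<Union>S\<in>K. {v. v \<noteq> 0 \<and> span {v} \<in> S})"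
    for K :: "'a set set set"
    by auto
  have "istopology (\<lambda>U. U \<subseteq> proj_points \<and> open {v::'a. v \<noteq> 0 \<and> span {v} \<in> U})"
    unfolding istopology_def union by (auto simp only: inter intro!: open_Int open_UN)
  then show ?thesis
    by (simp add: proj_topology_def topology_inverse')
qed

lemma topspace_proj_topology:
  "topspace (proj_topology :: 'a::real_normed_vector set topology) = proj_points"
proof -
  have "{v::'a. v \<noteq> 0 \<and> span {v} \<in> proj_points} = - {0}"
    by (auto simp: proj_points_def)
  then have "openin proj_topology (proj_points :: 'a set set)"
    by (simp add: openin_proj_topology open_Compl)
  then show ?thesis
    unfolding topspace_def by (auto simp: openin_proj_topology)
qed

lemma quotient_map_proj_topology:
  "quotient_map (top_of_set (- {0})) proj_topology (\<lambda>v::'a::real_normed_vector. span {v})"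
proof -
  have "openin (top_of_set (- {0})) {v \<in> - {0}. span {v} \<in> U} \<longleftrightarrow>
      open {v::'a. v \<noteq> 0 \<and> span {v} \<in> U}" for U
    by (subst openin_open_eq) (auto simp: open_Compl)
  then show ?thesis
    unfolding quotient_map_def topspace_proj_topology openin_proj_topology
    by (auto simp: proj_points_def)
qed

definition proj2 :: "real \<Rightarrow> real \<Rightarrow> real \<Rightarrow> (real \<times> real \<times> real) set" where
  "proj2 x y z = span {(x, y, z)}"

definition affine_embedding :: "real \<times> real \<Rightarrow> (real \<times> real \<times> real) set" where
  "affine_embedding z = proj2 (fst z) (snd z) 1"

section \<open>Plane curves and their points at infinity\<close>

definition real_curve :: "poly2 \<Rightarrow> (real \<times> real) set" where
  "real_curve p = {z. eval2 p z = 0}"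

text \<open>
  The value at \<open>(x, y, z)\<close> of the homogenization \<open>Z\<^sup>d p(X/Z, Y/Z)\<close>, where \<open>d\<close> is the total degree
  of \<open>p\<close>.
\<close>

definition homogenization :: "poly2 \<Rightarrow> real \<Rightarrow> real \<Rightarrow> real \<Rightarrow> real" where
  "homogenization p x y z = (\<Sum>k\<le>tdegree p. eval2 (hom_part k p) (x, y) * z ^ (tdegree p - k))"

text \<open>
  The real points of the projective closure of the curve \<open>p = 0\<close>. This is the closure of the curve as
  a scheme; the set \<^term>\<open>real_curve p\<close> need not be dense in it.
\<close>

definition projective_curve :: "poly2 \<Rightarrow> (real \<times> real \<times> real) set set" where
  "projective_curve p =
     {proj2 x y z | x y z. (x, y, z) \<noteq> (0, 0, 0) \<and> homogenization p x y z = 0}"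

definition points_at_infinity :: "poly2 \<Rightarrow> (real \<times> real \<times> real) set set" where
  "points_at_infinity p = projective_curve p \<inter> {proj2 x y 0 | x y. (x, y) \<noteq> (0, 0)}"

end

theory Submission
  imports Defs "HOL-Computational_Algebra.Formal_Laurent_Series"
begin

text \<open>
  Let \<open>C\<^sub>t\<close> be the curve \<open>b = t\<close>. The inclusion of \<open>seq_closure M\<close> in the double dual is clear, and both
  claims reduce to one: if \<open>f\<close> lies in the double dual of the fibre module \<open>M + (b - t)\<close> for all \<open>t\<close> in
  \<open>[lam, Lam]\<close>, then \<open>f\<close> lies in \<open>seq_closure M\<close>. The double dual of \<open>M\<close> is contained in those of the fibre
  modules, and if these have (SMP), then so is every polynomial that is nonnegative on \<open>S(M)\<close>. The claim
  follows from two facts.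

  The first fact is that all fibre modules are closed and stable, with bounds that do not depend on
  \<open>t\<close>. The leading form of \<open>b\<close> is a product of distinct real linear forms, so each point at infinity
  of \<open>C\<^sub>t\<close> is simple and the curve has there one branch, along which polynomials have Laurent
  expansions (\<open>branch_exists\<close>). A polynomial whose pole orders on all branches are at most \<open>k\<close> is
  congruent modulo \<open>b - t\<close> to one of degree at most \<open>k\<close> (\<open>reduce_degree\<close>). Consider a representation
  \<open>c = \<Sum> \<sigma>\<^sub>j g\<^sub>j + h (b - t)\<close>. On the points of \<open>S(M)\<close> on \<open>C\<^sub>t\<close> all terms \<open>\<sigma>\<^sub>j g\<^sub>j\<close> are nonnegative and so
  dominated by \<open>c\<close>. These points approach every point at infinity, and hence no cancellation of
  poles takes place: the pole orders of the squares in \<open>\<sigma>\<^sub>j\<close> are bounded on all branches on which \<open>g\<^sub>j\<close>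
  does not vanish (\<open>dominated_pole_le\<close>). This uses that the order of a zero of \<open>g\<^sub>j\<close> at infinity is
  bounded independently of \<open>t\<close>. If \<open>g\<^sub>j\<close> vanishes on some component of \<open>C\<^sub>t\<close>, then the squares may be
  changed there, which again permits a bounded degree (\<open>separating_polynomial\<close>,
  \<open>bounded_representative\<close>). So the degrees are bounded (\<open>stable_representation\<close>), and with
  compactness the module is closed in each finite-dimensional space of polynomials
  (\<open>cone_closed\<close>). By a Hahn-Banach argument it equals its double dual
  (\<open>double_dual_subset_closed_cone\<close>).

  Therefore \<open>f = m\<^sub>t + h\<^sub>t (b - t)\<close> with \<open>m\<^sub>t\<close> in \<open>M\<close> and a degree of \<open>h\<^sub>t\<close> bounded independently of \<open>t\<close>. The
  second fact is that such representations can be glued (\<open>glue_fibre_representations\<close>). Finitely many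
  values of \<open>t\<close> suffice for a given precision. Taking the sum of the representations with a partition of
  unity into squares of polynomials in \<open>b\<close>, one obtains an element of \<open>M\<close> up to terms \<open>\<delta>(b) u\<close> with
  finitely many fixed monomials \<open>u\<close> and polynomials \<open>\<delta>\<close> that are small on \<open>[lam, Lam]\<close>. Writing \<open>u\<close> as a
  difference of two squares, these terms are absorbed by \<open>\<epsilon> q\<close> for a fixed \<open>q\<close>, because \<open>\<epsilon> \<plusminus> \<delta>(b)\<close> is
  in \<open>M\<close>. Up to a small error, twice the Bernstein polynomials of even index are such a partition of unity
  (\<open>sum_bern_even\<close>).
\<close>

unbundle fps_syntax and no vec_syntax

section \<open>Substitution into bivariate polynomials\<close>

definition ring_map :: "('a::comm_ring_1 \<Rightarrow> 'b::comm_ring_1) \<Rightarrow> bool" where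
  "ring_map h \<longleftrightarrow> h 1 = 1 \<and> (\<forall>x y. h (x + y) = h x + h y) \<and> (\<forall>x y. h (x * y) = h x * h y)"

lemma ring_mapD:
  assumes "ring_map h"
  shows "h 0 = 0" "h 1 = 1" "h (x + y) = h x + h y" "h (x * y) = h x * h y"
    "h (- x) = - h x" "h (x - y) = h x - h y" "h (x ^ n) = h x ^ n"
    "h (sum f A) = (\<Sum>a\<in>A. h (f a))" "h (prod f A) = (\<Prod>a\<in>A. h (f a))"
proof -
  have add: "h (x + y) = h x + h y" and mult: "h (x * y) = h x * h y" for x y
    using assms by (auto simp: ring_map_def)
  show one: "h 1 = 1"
    using assms by (simp add: ring_map_def)
  show zero: "h 0 = 0"
    using add[of 0 0] by simp
  show um: "h (- x) = - h x" for x
    using add[of x "- x"] zero by (simp add: eq_neg_iff_add_eq_0 add.commute)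
  show "h (x - y) = h x - h y"
    using add[of x "- y"] um by simp
  show "h (x ^ n) = h x ^ n"
    by (induction n) (simp_all add: one mult)
  show "h (sum f A) = (\<Sum>a\<in>A. h (f a))"
    by (induction A rule: infinite_finite_induct) (simp_all add: zero add)
  show "h (prod f A) = (\<Prod>a\<in>A. h (f a))"
    by (induction A rule: infinite_finite_induct) (simp_all add: one mult)
qed (use assms in \<open>auto simp: ring_map_def\<close>)

lemma ring_map_poly:
  assumes "ring_map h"
  shows "ring_map (\<lambda>p. poly (map_poly h p) x)"
proof -
  note h = ring_mapD[OF assms]
  have map_pCons: "map_poly h (pCons a p) = pCons (h a) (map_poly h p)" for a p
    by (rule poly_eqI) (simp add: coeff_map_poly h coeff_pCons split: nat.splits)
  have map_add: "map_poly h (p + q) = map_poly h p + map_poly h q" for p q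
    by (rule poly_eqI) (simp add: coeff_map_poly h)
  have map_smult: "map_poly h (smult a p) = smult (h a) (map_poly h p)" for a p
    by (rule poly_eqI) (simp add: coeff_map_poly h)
  have map_mult: "map_poly h (p * q) = map_poly h p * map_poly h q" for p q
  proof (induction p)
    case 0
    then show ?case by simp
  next
    case (pCons a p)
    then show ?case by (simp add: mult_pCons_left map_pCons map_add map_smult h)
  qed
  have "map_poly h 1 = 1"
    by (simp add: h)
  then show ?thesis
    by (simp add: ring_map_def map_add map_mult)
qed

definition subst2 :: "(real \<Rightarrow> 'k::comm_ring_1) \<Rightarrow> 'k \<Rightarrow> 'k \<Rightarrow> poly2 \<Rightarrow> 'k" where
  "subst2 h x y p = poly (map_poly (\<lambda>c. poly (map_poly h c) x) p) y"

lemma ring_map_subst2: "ring_map h \<Longrightarrow> ring_map (subst2 h x y)"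
  unfolding subst2_def by (intro ring_map_poly)

lemma subst2_gens [simp]:
  assumes "ring_map h"
  shows "subst2 h x y (const2 c) = h c" "subst2 h x y varX = x" "subst2 h x y varY = y"
proof -
  note h = ring_mapD[OF assms]
  have m: "map_poly h [:a:] = [:h a:]" "map_poly h [:a, b:] = [:h a, h b:]" for a b
    by (rule poly_eqI, simp add: coeff_map_poly h coeff_pCons split: nat.splits)+
  show "subst2 h x y (const2 c) = h c" "subst2 h x y varX = x" "subst2 h x y varY = y"
    by (simp_all add: subst2_def const2_def varX_def varY_def map_poly_pCons m h)
qed

text \<open>
  The generators \<open>const2 c\<close>, \<open>varX\<close>, \<open>varY\<close> determine everything about \<open>\<real>[X,Y]\<close> that is
  compatible with the ring operations; most statements about substitutions are reduced to them.
\<close>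

lemma poly2_induct [case_names const X Y add mult]:
  fixes p :: poly2
  assumes const: "\<And>c. P (const2 c)" and X: "P varX" and Y: "P varY"
    and add: "\<And>p q. P p \<Longrightarrow> P q \<Longrightarrow> P (p + q)" and mult: "\<And>p q. P p \<Longrightarrow> P q \<Longrightarrow> P (p * q)"
  shows "P p"
proof -
  have one: "P [:a:]" for a :: "real poly"
  proof (induction a)
    case 0
    then show ?case using const[of 0] by (simp add: const2_def)
  next
    case (pCons c a)
    have "[:pCons c a:] = const2 c + varX * [:a:]"
      by (simp add: const2_def varX_def)
    then show ?case
      using add[OF const mult[OF X pCons.IH]] by metis
  qed
  show ?thesis
  proof (induction p)
    case 0
    then show ?case using one[of 0] by simp
  next
    case (pCons a p)
    have "pCons a p = [:a:] + varY * p"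
      by (simp add: varY_def)
    then show ?case
      using add[OF one mult[OF Y pCons.IH]] by metis
  qed
qed

lemma ring_map_id [simp]: "ring_map (\<lambda>c. c)"
  by (simp add: ring_map_def)

lemma ring_map_const2 [simp]: "ring_map const2"
  by (simp add: ring_map_def const2_def pCons_one)

lemmas const2_simps = ring_mapD[OF ring_map_const2]

lemma ring_map_eval2: "ring_map (\<lambda>p. eval2 p z)"
  by (simp add: eval2_def ring_map_def)

lemmas eval2_simps [simp] = ring_mapD[OF ring_map_eval2]

lemma eval2_gens [simp]:
  "eval2 (const2 c) z = c" "eval2 varX z = fst z" "eval2 varY z = snd z"
  by (simp_all add: eval2_def const2_def varX_def varY_def)

lemma ring_map_eqI:
  assumes "ring_map f" "ring_map g" "\<And>c. f (const2 c) = g (const2 c)"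
    "f varX = g varX" "f varY = g varY"
  shows "f p = g p"
  by (induction p rule: poly2_induct) (simp_all add: assms ring_mapD[OF assms(1)] ring_mapD[OF assms(2)])

lemma eval2_eq_subst2: "eval2 p (x, y) = subst2 (\<lambda>c. c) x y p"
  by (rule ring_map_eqI[OF ring_map_eval2 ring_map_subst2]) simp_all

lemma ring_map_comp: "ring_map f \<Longrightarrow> ring_map g \<Longrightarrow> ring_map (\<lambda>x. f (g x))"
  by (simp add: ring_map_def)

lemma ring_map_subst2_comp:
  assumes "ring_map f" "ring_map h"
  shows "f (subst2 h x y p) = subst2 (\<lambda>c. f (h c)) (f x) (f y) p"
proof -
  have "ring_map (\<lambda>c. f (h c))"
    using assms ring_map_comp by blast
  note fh = this
  show ?thesis
    using ring_map_eqI[OF ring_map_comp[OF assms(1) ring_map_subst2[OF assms(2)]] ring_map_subst2[OF fh]]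
    by (simp add: assms fh)
qed

text \<open>
  This is applied to congruence modulo an element and to being an asymptotic expansion of a sequence.
\<close>

lemma subst2_rel:
  fixes R :: "'a::comm_ring_1 \<Rightarrow> 'b::comm_ring_1 \<Rightarrow> bool"
  assumes "ring_map h" "ring_map h'" "\<And>c. R (h c) (h' c)" "R x x'" "R y y'"
    "\<And>a a' b b'. R a a' \<Longrightarrow> R b b' \<Longrightarrow> R (a + b) (a' + b')"
    "\<And>a a' b b'. R a a' \<Longrightarrow> R b b' \<Longrightarrow> R (a * b) (a' * b')"
  shows "R (subst2 h x y p) (subst2 h' x' y' p)"
  by (induction p rule: poly2_induct)
    (simp_all add: assms ring_mapD[OF ring_map_subst2[OF assms(1)]] ring_mapD[OF ring_map_subst2[OF assms(2)]])

lemma subst2_diff_dvd: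
  assumes "ring_map h" "e dvd x - x'" "e dvd y - y'"
  shows "e dvd subst2 h x y p - subst2 h x' y' p"
proof (rule subst2_rel[where R = "\<lambda>a b. e dvd a - b"])
  fix a a' b b' :: 'a
  assume *: "e dvd a - a'" "e dvd b - b'"
  have "a + b - (a' + b') = (a - a') + (b - b')"
    by simp
  with * show "e dvd a + b - (a' + b')" by (metis dvd_add)
  have "a * b - a' * b' = (a - a') * b + a' * (b - b')"
    by (simp add: algebra_simps)
  with * show "e dvd a * b - a' * b'" by (metis dvd_add dvd_mult dvd_mult2)
qed (use assms in auto)

section \<open>Total degree\<close>

abbreviation coeff2 :: "poly2 \<Rightarrow> nat \<Rightarrow> nat \<Rightarrow> real" where
  "coeff2 p i j \<equiv> coeff (coeff p j) i"

text \<open>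
  Strict bounds \<open>deg_lt n\<close> make sense also for \<open>n = 0\<close>, where they single out the zero polynomial.
  This replaces the convention of degree \<open>-\<infinity>\<close>.
\<close>

definition deg_lt :: "nat \<Rightarrow> poly2 \<Rightarrow> bool" where
  "deg_lt n p \<longleftrightarrow> (\<forall>i j. n \<le> i + j \<longrightarrow> coeff2 p i j = 0)"

abbreviation deg_le :: "nat \<Rightarrow> poly2 \<Rightarrow> bool" where
  "deg_le n \<equiv> deg_lt (Suc n)"

lemma poly2_eqI: "(\<And>i j. coeff2 p i j = coeff2 q i j) \<Longrightarrow> p = q"
  by (intro poly_eqI)

lemma deg_lt_0 [simp]: "deg_lt 0 p \<longleftrightarrow> p = 0"
  by (auto simp: deg_lt_def intro: poly2_eqI)

lemma deg_lt_zero [simp]: "deg_lt n 0"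
  by (simp add: deg_lt_def)

lemma deg_lt_mono: "deg_lt m p \<Longrightarrow> m \<le> n \<Longrightarrow> deg_lt n p"
  by (auto simp: deg_lt_def)

lemma deg_lt_add: "deg_lt n p \<Longrightarrow> deg_lt n q \<Longrightarrow> deg_lt n (p + q)"
  by (simp add: deg_lt_def)

lemma deg_lt_diff: "deg_lt n p \<Longrightarrow> deg_lt n q \<Longrightarrow> deg_lt n (p - q)"
  by (simp add: deg_lt_def)

lemma deg_lt_sum: "(\<And>a. a \<in> A \<Longrightarrow> deg_lt n (f a)) \<Longrightarrow> deg_lt n (sum f A)"
  by (induction A rule: infinite_finite_induct) (simp_all add: deg_lt_add)

lemma deg_lt_const2_mult: "deg_lt n p \<Longrightarrow> deg_lt n (const2 c * p)"
  by (simp add: deg_lt_def)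

lemma coeff2_mult:
  "coeff2 (p * q) i j = (\<Sum>l\<le>j. \<Sum>k\<le>i. coeff2 p k l * coeff2 q (i - k) (j - l))"
  by (simp add: coeff_mult coeff_sum)

lemma deg_lt_mult:
  assumes "deg_le m p" "deg_lt n q"
  shows "deg_lt (m + n) (p * q)"
  unfolding deg_lt_def
proof (intro allI impI)
  fix i j
  assume ij: "m + n \<le> i + j"
  have "coeff2 p k l * coeff2 q (i - k) (j - l) = 0" if "l \<le> j" "k \<le> i" for k l
  proof (cases "Suc m \<le> k + l")
    case True
    then show ?thesis using assms(1) by (simp add: deg_lt_def)
  next
    case False
    then have "n \<le> (i - k) + (j - l)"
      using ij that by linarith
    then show ?thesis using assms(2) by (simp add: deg_lt_def)
  qed
  then show "coeff2 (p * q) i j = 0"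
    unfolding coeff2_mult by (intro sum.neutral ballI) simp
qed

lemma deg_le_mult: "deg_le m p \<Longrightarrow> deg_le n q \<Longrightarrow> deg_le (m + n) (p * q)"
  using deg_lt_mult[of m p "Suc n" q] by simp

lemma deg_le_const2: "deg_le 0 (const2 c)"
  by (auto simp: deg_lt_def const2_def coeff_pCons split: nat.splits)

lemma deg_le_one: "deg_le 0 1"
  using deg_le_const2[of 1] by (simp add: const2_simps)

lemma deg_le_varX: "deg_le 1 varX"
  by (auto simp: deg_lt_def varX_def coeff_pCons split: nat.splits)

lemma deg_le_varY: "deg_le 1 varY"
  by (auto simp: deg_lt_def varY_def coeff_pCons split: nat.splits simp flip: one_pCons)

lemma deg_le_power: "deg_le n p \<Longrightarrow> deg_le (k * n) (p ^ k)"
  by (induction k) (simp_all add: deg_le_one deg_le_mult)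

lemma deg_le_prod: "finite A \<Longrightarrow> (\<And>a. a \<in> A \<Longrightarrow> deg_le 1 (f a)) \<Longrightarrow> deg_le (card A) (prod f A)"
proof (induction A rule: finite_induct)
  case (insert x F)
  have "deg_le (1 + card F) (f x * prod f F)"
    using insert by (intro deg_le_mult) auto
  then show ?case using insert by simp
qed (simp add: deg_le_one)

lemma coeff2_monomial:
  "coeff2 (const2 c * varX ^ k * varY ^ l) i j = (if i = k \<and> j = l then c else 0)"
proof -
  have X: "varX ^ k = [:monom 1 k:]"
    by (induction k) (simp_all add: varX_def monom_Suc one_pCons monom_0)
  have Y: "varY ^ l = monom 1 l" for l
    by (induction l) (simp_all add: varY_def monom_Suc monom_0 flip: one_pCons)
  have "const2 c * varX ^ k * varY ^ l = monom (monom c k) l"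
    unfolding X Y const2_def by (simp add: smult_monom)
  then show ?thesis by simp
qed

lemma deg_le_linear: "deg_le 1 (const2 a * varX + const2 c * varY)"
  by (intro deg_lt_add deg_lt_const2_mult deg_le_varX deg_le_varY)

lemma coeff2_hom_part: "coeff2 (hom_part k p) i j = (if i + j = k then coeff2 p i j else 0)"
proof -
  have "coeff2 (hom_part k p) i j =
      (\<Sum>m\<le>k. if i = m \<and> j = k - m then coeff2 p m (k - m) else 0)"
    by (simp add: hom_part_def coeff_sum coeff2_monomial)
  also have "\<dots> = (\<Sum>m\<le>k. if m = i then (if i + j = k then coeff2 p i j else 0) else 0)"
    by (rule sum.cong) auto
  finally show ?thesis by auto
qed

lemma deg_lt_minus_hom_part: "deg_le n p \<Longrightarrow> deg_lt n (p - hom_part n p)"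
  by (auto simp: deg_lt_def coeff2_hom_part)

lemma hom_part_deg_lt: "deg_lt n p \<Longrightarrow> hom_part n p = 0"
  by (intro poly2_eqI) (auto simp: deg_lt_def coeff2_hom_part)

lemma sum_hom_part:
  assumes "deg_le n p"
  shows "p = (\<Sum>k\<le>n. hom_part k p)"
proof (rule poly2_eqI)
  fix i j
  have "coeff2 (\<Sum>k\<le>n. hom_part k p) i j = (if i + j \<le> n then coeff2 p i j else 0)"
    by (simp add: coeff_sum coeff2_hom_part)
  then show "coeff2 p i j = coeff2 (\<Sum>k\<le>n. hom_part k p) i j"
    using assms by (auto simp: deg_lt_def)
qed

lemma hom_part_add: "hom_part k (p + q) = hom_part k p + hom_part k q"
  by (intro poly2_eqI) (simp add: coeff2_hom_part)

lemma deg_le_tdegree: "deg_le (tdegree p) p"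
  unfolding deg_lt_def
proof (intro allI impI)
  fix i j
  assume "Suc (tdegree p) \<le> i + j"
  show "coeff2 p i j = 0"
  proof (rule ccontr)
    assume "coeff2 p i j \<noteq> 0"
    then have "i + j \<le> tdegree p"
      unfolding tdegree_def using finite_tdegree_set[of p] by (intro Max_ge) auto
    with \<open>Suc (tdegree p) \<le> i + j\<close> show False by simp
  qed
qed

lemma tdegree_le: "deg_le n p \<Longrightarrow> tdegree p \<le> n"
  unfolding tdegree_def using finite_tdegree_set[of p]
  by (subst Max_le_iff) (auto simp: deg_lt_def not_less_eq_eq[symmetric])

lemma subst2_hom_part_scale:
  assumes "ring_map h"
  shows "subst2 h (t * x) (t * y) (hom_part k p) = t ^ k * subst2 h x y (hom_part k p)"
proof -
  note s = ring_mapD[OF ring_map_subst2[OF assms]]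
  have "h c * (t * x) ^ i * (t * y) ^ (k - i) = t ^ k * (h c * x ^ i * y ^ (k - i))" if "i \<le> k" for c i
  proof -
    have "t ^ k = t ^ i * t ^ (k - i)"
      using that by (simp flip: power_add)
    then show ?thesis
      by (simp add: power_mult_distrib algebra_simps)
  qed
  then show ?thesis
    by (simp add: hom_part_def s assms sum_distrib_left cong: sum.cong_simp)
qed

text \<open>The binary form \<open>Y\<^sup>n f(X/Y)\<close> of degree \<open>n\<close>.\<close>

definition form_of :: "nat \<Rightarrow> real poly \<Rightarrow> poly2" where
  "form_of n f = (\<Sum>i\<le>n. const2 (coeff f i) * varX ^ i * varY ^ (n - i))"

lemma coeff2_form_of: "coeff2 (form_of n f) i j = (if i + j = n then coeff f i else 0)"
proof -
  have "coeff2 (form_of n f) i j = (\<Sum>m\<le>n. if i = m \<and> j = n - m then coeff f m else 0)"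
    by (simp add: form_of_def coeff_sum coeff2_monomial)
  also have "\<dots> = (\<Sum>m\<le>n. if m = i then (if i + j = n then coeff f i else 0) else 0)"
    by (rule sum.cong) auto
  finally show ?thesis by auto
qed

lemma deg_le_form_of: "deg_le n (form_of n f)"
  by (simp add: deg_lt_def coeff2_form_of)

lemma hom_part_eq_form_of: "\<exists>f. degree f \<le> n \<and> hom_part n p = form_of n f"
proof -
  define f where "f = (\<Sum>i\<le>n. monom (coeff2 p i (n - i)) i)"
  have c: "coeff f i = (if i \<le> n then coeff2 p i (n - i) else 0)" for i
    by (simp add: f_def coeff_sum)
  then have "degree f \<le> n"
    by (intro degree_le) auto
  moreover have "hom_part n p = form_of n f"
    by (intro poly2_eqI) (auto simp: coeff2_hom_part coeff2_form_of c)
  ultimately show ?thesis by blast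
qed

lemma coeff2_var_mult:
  "coeff2 (varX * p) i j = (if i = 0 then 0 else coeff2 p (i - 1) j)"
  "coeff2 (varY * p) i j = (if j = 0 then 0 else coeff2 p i (j - 1))"
  by (simp_all add: varX_def varY_def coeff_pCons split: nat.splits)

lemma form_of_linear_mult:
  assumes "degree g \<le> n"
  shows "form_of (Suc n) ([:s, r:] * g) = (const2 r * varX + const2 s * varY) * form_of n g"
proof (rule poly2_eqI)
  fix i j
  have "(const2 r * varX + const2 s * varY) * form_of n g =
      const2 r * (varX * form_of n g) + const2 s * (varY * form_of n g)"
    by (simp add: algebra_simps)
  moreover have "coeff g i = 0" if "n < i"
    using assms that by (simp add: coeff_eq_0)
  ultimately show "coeff2 (form_of (Suc n) ([:s, r:] * g)) i j =
      coeff2 ((const2 r * varX + const2 s * varY) * form_of n g) i j"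
    by (cases i; cases j) (auto simp: coeff2_form_of coeff2_var_mult coeff_pCons)
qed

text \<open>
  The dehomogenization \<open>f\<close> has the root \<open>-s / r\<close>. If \<open>r = 0\<close>, then it has a drop in degree instead.
\<close>

lemma form_of_linear_factor:
  assumes "degree f \<le> n" "f \<noteq> 0" "(r, s) \<noteq> (0, 0)" "eval2 (form_of n f) (- s, r) = 0"
  obtains m g where "n = Suc m" "degree g \<le> m" "g \<noteq> 0" "f = [:s, r:] * g"
proof (cases "r = 0")
  case True
  with assms have s: "s \<noteq> 0" by simp
  have "coeff f i * (- s) ^ i * 0 ^ (n - i) = (if i = n then coeff f n * (- s) ^ n else 0)" if "i \<le> n" for i
    using that by (auto simp: power_0_left)
  then have "(\<Sum>i\<le>n. coeff f i * (- s) ^ i * 0 ^ (n - i)) = (\<Sum>i\<le>n. (if i = n then coeff f n * (- s) ^ n else 0))"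
    by (intro sum.cong) auto
  then have n: "coeff f n = 0"
    using assms(4) True s by (simp add: form_of_def)
  with assms(1,2) have "degree f < n"
    by (metis leading_coeff_0_iff order_le_imp_less_or_eq)
  then obtain m where m: "n = Suc m" "degree f \<le> m"
    by (cases n) auto
  have "f = [:s, r:] * smult (inverse s) f"
    using True s by simp
  then show ?thesis
    using that[of m "smult (inverse s) f"] m s assms(2) by simp
next
  case False
  have "coeff f i * (- s) ^ i * r ^ (n - i) = r ^ n * (coeff f i * (- s / r) ^ i)" if "i \<le> n" for i
    unfolding power_divide power_diff[OF False that] by simp
  then have "(\<Sum>i\<le>n. coeff f i * (- s) ^ i * r ^ (n - i)) = (\<Sum>i\<le>n. r ^ n * (coeff f i * (- s / r) ^ i))"
    by (intro sum.cong refl) blast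
  then have "eval2 (form_of n f) (- s, r) = r ^ n * (\<Sum>i\<le>n. coeff f i * (- s / r) ^ i)"
    by (simp add: form_of_def sum_distrib_left)
  also have "(\<Sum>i\<le>n. coeff f i * (- s / r) ^ i) = poly f (- s / r)"
    unfolding poly_altdef using assms(1)
    by (intro sum.mono_neutral_right) (auto simp: coeff_eq_0)
  finally have "poly f (- s / r) = 0"
    using assms(4) False by simp
  then obtain g where g: "f = [:s / r, 1:] * g"
    by (metis poly_eq_0_iff_dvd dvdE minus_divide_left minus_minus)
  have g0: "g \<noteq> 0" using g assms(2) by auto
  have "degree f = degree ([:s / r, 1:]) + degree g"
    unfolding g using g0 by (intro degree_mult_eq) auto
  then have dg: "degree f = Suc (degree g)" by simp
  then obtain m where m: "n = Suc m" "degree g \<le> m"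
    using assms(1) by (cases n) auto
  have "f = [:s, r:] * smult (inverse r) g"
    using False g by (simp add: smult_add_right field_simps)
  then show ?thesis
    using that[of m "smult (inverse r) g"] m False g0 by simp
qed

lemma linear_eval_zero_imp_parallel:
  fixes a c r s :: real
  assumes "r * (- c) + s * a = 0" "(a, c) \<noteq> (0, 0)" "(r, s) \<noteq> (0, 0)"
  shows "span {(a, c)} = span {(r, s)}"
proof -
  have "\<exists>k. k \<noteq> 0 \<and> (r, s) = k *\<^sub>R (a, c)"
  proof (cases "a = 0")
    case True
    then have "c \<noteq> 0" "r = 0" "s \<noteq> 0"
      using assms by auto
    then show ?thesis
      using True by (intro exI[of _ "s / c"]) simp
  next
    case False
    then have "s = r * c / a"
      using assms(1) by (simp add: eq_divide_eq)
    moreover from this assms(3) have "r \<noteq> 0"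
      by auto
    ultimately show ?thesis
      using False by (intro exI[of _ "r / a"]) simp
  qed
  then obtain k where k: "k \<noteq> 0" "(r, s) = k *\<^sub>R (a, c)" by blast
  have "u *\<^sub>R (a, c) \<in> range (\<lambda>v. v *\<^sub>R (k *\<^sub>R (a, c)))" for u
    using k(1) by (intro image_eqI[of _ _ "u / k"]) simp_all
  moreover have "u *\<^sub>R (k *\<^sub>R (a, c)) \<in> range (\<lambda>v. v *\<^sub>R (a, c))" for u
    by (intro image_eqI[of _ _ "u * k"]) simp_all
  ultimately show ?thesis
    unfolding k(2) span_singleton by blast
qed

lemma form_of_linear_factors:
  fixes r s :: "'i \<Rightarrow> real"
  assumes "finite I" "degree f \<le> n" "f \<noteq> 0" "\<And>i. i \<in> I \<Longrightarrow> (r i, s i) \<noteq> (0, 0)"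
    "inj_on (\<lambda>i. span {(r i, s i)}) I" "\<And>i. i \<in> I \<Longrightarrow> eval2 (form_of n f) (- s i, r i) = 0"
  shows "\<exists>m g. n = m + card I \<and>
    form_of n f = (\<Prod>i\<in>I. const2 (r i) * varX + const2 (s i) * varY) * form_of m g"
  using assms
proof (induction I arbitrary: n f rule: finite_induct)
  case empty
  then show ?case by auto
next
  case (insert j I)
  obtain m g where g: "n = Suc m" "degree g \<le> m" "g \<noteq> 0" "f = [:s j, r j:] * g"
    using form_of_linear_factor[OF insert.prems(1,2) insert.prems(3)[OF insertI1] insert.prems(5)[OF insertI1]]
    by blast
  have fg: "form_of n f = (const2 (r j) * varX + const2 (s j) * varY) * form_of m g"
    unfolding g using g(2) by (rule form_of_linear_mult)
  have "eval2 (form_of m g) (- s i, r i) = 0" if i: "i \<in> I" for i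
  proof -
    have "eval2 (form_of n f) (- s i, r i) = 0"
      using insert.prems(5) i by blast
    then have "(r j * (- s i) + s j * r i) * eval2 (form_of m g) (- s i, r i) = 0"
      by (simp add: fg)
    moreover have "r j * (- s i) + s j * r i \<noteq> 0"
    proof
      assume "r j * (- s i) + s j * r i = 0"
      then have "span {(r i, s i)} = span {(r j, s j)}"
        using insert.prems(3) i by (intro linear_eval_zero_imp_parallel) auto
      then show False
        using inj_onD[OF insert.prems(4), of i j] insert.hyps(2) i by blast
    qed
    ultimately show ?thesis by simp
  qed
  moreover have "inj_on (\<lambda>i. span {(r i, s i)}) I"
    using insert.prems(4) by (rule inj_on_subset) blast
  ultimately obtain m' g' where "m = m' + card I"
      "form_of m g = (\<Prod>i\<in>I. const2 (r i) * varX + const2 (s i) * varY) * form_of m' g'"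
    using insert.IH[OF g(2,3)] insert.prems(3) by blast
  then show ?case
    using insert.hyps fg g(1) by (intro exI[of _ m'] exI[of _ g']) (simp add: mult.assoc)
qed

section \<open>Branches of a plane curve at a simple point at infinity\<close>

lemma fps_X_power_dvd_iff: "fps_X ^ n dvd (f :: real fps) \<longleftrightarrow> (\<forall>k<n. f $ k = 0)"
proof
  assume "fps_X ^ n dvd f"
  then obtain g where "f = fps_X ^ n * g" by (elim dvdE)
  then show "\<forall>k<n. f $ k = 0"
    by (simp add: fps_X_power_mult_nth)
next
  assume "\<forall>k<n. f $ k = 0"
  then have "f = fps_X ^ n * fps_shift n f"
    by (intro fps_ext) (simp add: fps_X_power_mult_nth)
  then show "fps_X ^ n dvd f" by (rule dvdI)
qed

lemma ring_map_fps_const [simp]: "ring_map (fps_const :: real \<Rightarrow> real fps)"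
  by (simp add: ring_map_def)

lemma ring_map_fls_const [simp]: "ring_map (fls_const :: real \<Rightarrow> real fls)"
  by (simp add: ring_map_def fls_plus_const)

lemma ring_map_fps_to_fls: "ring_map (fps_to_fls :: real fps \<Rightarrow> real fls)"
  by (simp add: ring_map_def fls_times_fps_to_fls)

text \<open>
  The formal implicit function theorem at a point where the linear term in \<open>Y\<close> does not vanish.
  Solving that term for \<open>Y\<close> gives a fixed point equation, and each iteration determines one more
  coefficient.
\<close>

lemma formal_implicit_function:
  fixes G1 G2 :: poly2
  assumes "\<alpha> \<noteq> 0"
  obtains W :: "real fps" where "W $ 0 = 0"
    "subst2 fps_const fps_X W (varX * G1 + varY * (const2 \<alpha> + varY * G2)) = 0"
proof -
  let ?S = "\<lambda>W. subst2 fps_const fps_X (W :: real fps)"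
  note s = ring_mapD[OF ring_map_subst2[OF ring_map_fps_const]]
  define T where "T W = fps_const (- inverse \<alpha>) * (fps_X * ?S W G1 + W * (W * ?S W G2))" for W
  have contract: "fps_X ^ Suc n dvd T W - T V"
    if "fps_X dvd W" "fps_X dvd V" "fps_X ^ n dvd W - V" for n W V
  proof -
    have "fps_X ^ n dvd ?S W G - ?S V G" for G
      using that by (intro subst2_diff_dvd) auto
    then have G: "fps_X * fps_X ^ n dvd fps_X * (?S W G1 - ?S V G1)"
      "fps_X * fps_X ^ n dvd W * (W * (?S W G2 - ?S V G2))"
      using that(1) by (intro mult_dvd_mono dvd_refl dvd_mult; simp)+
    have "fps_X * fps_X ^ n dvd (W + V) * ((W - V) * ?S V G2)"
      using that by (intro mult_dvd_mono dvd_mult2 dvd_add) auto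
    moreover have "T W - T V = fps_const (- inverse \<alpha>) * (fps_X * (?S W G1 - ?S V G1) +
        W * (W * (?S W G2 - ?S V G2)) + (W + V) * ((W - V) * ?S V G2))"
      by (simp add: T_def algebra_simps)
    ultimately show ?thesis
      using G by (simp only: power_Suc dvd_add dvd_mult)
  qed
  define U where "U n = (T ^^ n) 0" for n
  have U_Suc: "U (Suc n) = T (U n)" for n
    by (simp add: U_def)
  have TX: "fps_X dvd T W" if "fps_X dvd W" for W
    unfolding T_def using that by (simp only: dvd_add dvd_mult dvd_mult2 dvd_refl)
  have UX: "fps_X dvd U n" for n
    by (induction n) (simp_all add: U_Suc TX, simp add: U_def)
  have Cauchy: "fps_X ^ Suc n dvd U (Suc n) - U n" for n
  proof (induction n)
    case 0
    then show ?case using UX[of 0] UX[of 1] by (simp add: dvd_diff)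
  next
    case (Suc n)
    then show ?case using contract[OF UX UX Suc] by (simp only: U_Suc)
  qed
  have step: "U (Suc m) $ k = U m $ k" if "k \<le> m" for k m
  proof -
    have "(U (Suc m) - U m) $ k = 0"
      using fps_X_power_dvd_iff[THEN iffD1, OF Cauchy[of m]] that le_imp_less_Suc by blast
    then show ?thesis by simp
  qed
  have stable: "U m $ k = U k $ k" if "k \<le> m" for k m
    using that by (induction m rule: dec_induct) (simp_all only: step)
  define W where "W = Abs_fps (\<lambda>k. U k $ k)"
  have close: "fps_X ^ Suc n dvd W - U n" for n
    unfolding fps_X_power_dvd_iff
  proof (intro allI impI)
    fix k
    assume "k < Suc n"
    then have "U n $ k = U k $ k"
      by (intro stable) simp
    then show "(W - U n) $ k = 0"
      by (simp add: W_def)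
  qed
  have W0: "W $ 0 = 0"
    by (simp add: W_def U_def)
  then have WX: "fps_X dvd W"
    using fps_X_power_dvd_iff[of 1 W] by simp
  have "(W - T W) $ n = 0" for n
  proof -
    have "fps_X ^ Suc n dvd (W - U (Suc n)) + (T (U n) - T W)"
    proof (rule dvd_add)
      show "fps_X ^ Suc n dvd W - U (Suc n)"
        using close[of "Suc n"] by (rule power_le_dvd) simp
      have "fps_X ^ Suc (Suc n) dvd T W - T (U n)"
        using contract[OF WX UX close] .
      then have "fps_X ^ Suc (Suc n) dvd T (U n) - T W"
        by (metis dvd_minus_iff minus_diff_eq)
      then show "fps_X ^ Suc n dvd T (U n) - T W"
        by (rule power_le_dvd) simp
    qed
    then have "fps_X ^ Suc n dvd W - T W"
      by (simp add: U_Suc)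
    then show ?thesis
      by (simp only: fps_X_power_dvd_iff)
  qed
  then have "W - T W = 0"
    by (intro fps_ext) simp
  then have "fps_const \<alpha> * W = fps_const \<alpha> * T W"
    by simp
  also have "\<dots> = - (fps_X * ?S W G1 + W * (W * ?S W G2))"
  proof -
    have "fps_const \<alpha> * fps_const (- inverse \<alpha>) = - 1"
      using assms by (simp flip: fps_const_neg)
    then show ?thesis
      unfolding T_def by (simp only: mult.assoc[symmetric] mult_minus1)
  qed
  finally have "?S W (varX * G1 + varY * (const2 \<alpha> + varY * G2)) = 0"
    by (simp add: s algebra_simps)
  with W0 show ?thesis using that by blast
qed

text \<open>
  In the following definitions \<open>\<tau>\<close> is a null sequence of parameter values and \<open>g\<close> a sequence of
  real numbers. The formal series \<open>F\<close>, which may diverge, is an asymptotic expansion of \<open>g\<close> in \<open>\<tau>\<close> if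
  \<open>approx \<tau> N F g\<close> holds for all \<open>N\<close>.
\<close>

definition big_o :: "(nat \<Rightarrow> real) \<Rightarrow> nat \<Rightarrow> (nat \<Rightarrow> real) \<Rightarrow> bool" where
  "big_o \<tau> N g \<longleftrightarrow> (\<exists>K. \<forall>n. \<bar>g n\<bar> \<le> K * \<bar>\<tau> n\<bar> ^ N)"

definition approx :: "(nat \<Rightarrow> real) \<Rightarrow> nat \<Rightarrow> real fps \<Rightarrow> (nat \<Rightarrow> real) \<Rightarrow> bool" where
  "approx \<tau> N F g \<longleftrightarrow>
     (\<exists>p. fps_X ^ N dvd F - fps_of_poly p \<and> big_o \<tau> N (\<lambda>n. g n - poly p (\<tau> n)))"

lemma big_oE:
  assumes "big_o \<tau> N g"
  obtains K where "K \<ge> 0" "\<And>n. \<bar>g n\<bar> \<le> K * \<bar>\<tau> n\<bar> ^ N"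
proof -
  from assms obtain K where K: "\<And>n. \<bar>g n\<bar> \<le> K * \<bar>\<tau> n\<bar> ^ N"
    by (auto simp: big_o_def)
  have "\<bar>g n\<bar> \<le> \<bar>K\<bar> * \<bar>\<tau> n\<bar> ^ N" for n
    by (rule order_trans[OF K]) (simp add: mult_right_mono)
  then show ?thesis using that[of "\<bar>K\<bar>"] by auto
qed

lemma big_o_add:
  assumes "big_o \<tau> N f" "big_o \<tau> N g"
  shows "big_o \<tau> N (\<lambda>n. f n + g n)"
proof -
  from assms obtain K L where K: "\<And>n. \<bar>f n\<bar> \<le> K * \<bar>\<tau> n\<bar> ^ N" "\<And>n. \<bar>g n\<bar> \<le> L * \<bar>\<tau> n\<bar> ^ N"
    by (auto simp: big_o_def)
  have "\<bar>f n + g n\<bar> \<le> (K + L) * \<bar>\<tau> n\<bar> ^ N" for n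
    using K(1)[of n] K(2)[of n] by (simp add: algebra_simps)
  then show ?thesis by (auto simp: big_o_def)
qed

lemma big_o_mult:
  assumes "big_o \<tau> N f" "big_o \<tau> M g"
  shows "big_o \<tau> (N + M) (\<lambda>n. f n * g n)"
proof -
  from assms obtain K L where K: "K \<ge> 0" "\<And>n. \<bar>f n\<bar> \<le> K * \<bar>\<tau> n\<bar> ^ N" "\<And>n. \<bar>g n\<bar> \<le> L * \<bar>\<tau> n\<bar> ^ M"
    by (elim big_oE) blast
  have "\<bar>f n * g n\<bar> \<le> (K * L) * \<bar>\<tau> n\<bar> ^ (N + M)" for n
    using mult_mono[OF K(2)[of n] K(3)[of n]] K(1) by (simp add: abs_mult power_add algebra_simps)
  then show ?thesis by (auto simp: big_o_def)
qed

lemma big_o_mono: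
  assumes "big_o \<tau> M g" "N \<le> M" "\<And>n. \<bar>\<tau> n\<bar> \<le> 1"
  shows "big_o \<tau> N g"
proof -
  from assms(1) obtain K where K: "K \<ge> 0" "\<And>n. \<bar>g n\<bar> \<le> K * \<bar>\<tau> n\<bar> ^ M"
    by (elim big_oE) blast
  have "\<bar>g n\<bar> \<le> K * \<bar>\<tau> n\<bar> ^ N" for n
    using K(2)[of n] by (rule order_trans) (intro mult_left_mono power_decreasing K(1) assms; simp)
  then show ?thesis by (auto simp: big_o_def)
qed

lemma big_o_poly:
  assumes "fps_X ^ N dvd fps_of_poly p" "\<And>n. \<bar>\<tau> n\<bar> \<le> 1"
  shows "big_o \<tau> N (\<lambda>n. poly p (\<tau> n))"
proof -
  have "\<bar>poly p (\<tau> n)\<bar> \<le> (\<Sum>i\<le>degree p. \<bar>coeff p i\<bar>) * \<bar>\<tau> n\<bar> ^ N" for n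
  proof -
    have "\<bar>poly p (\<tau> n)\<bar> \<le> (\<Sum>i\<le>degree p. \<bar>coeff p i * \<tau> n ^ i\<bar>)"
      unfolding poly_altdef by (rule sum_abs)
    also have "\<dots> \<le> (\<Sum>i\<le>degree p. \<bar>coeff p i\<bar> * \<bar>\<tau> n\<bar> ^ N)"
    proof (rule sum_mono)
      fix i
      show "\<bar>coeff p i * \<tau> n ^ i\<bar> \<le> \<bar>coeff p i\<bar> * \<bar>\<tau> n\<bar> ^ N"
      proof (cases "i < N")
        case True
        then have "coeff p i = 0"
          using assms(1) by (simp add: fps_X_power_dvd_iff)
        then show ?thesis by simp
      next
        case False
        then show ?thesis
          unfolding abs_mult power_abs by (intro mult_left_mono power_decreasing assms) auto
      qed
    qed
    finally show ?thesis by (simp add: sum_distrib_right)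
  qed
  then show ?thesis by (auto simp: big_o_def)
qed

lemma big_o_approx:
  assumes "approx \<tau> N F g" "fps_X ^ N dvd F" "\<And>n. \<bar>\<tau> n\<bar> \<le> 1"
  shows "big_o \<tau> N g"
proof -
  from assms(1) obtain p where p: "fps_X ^ N dvd F - fps_of_poly p" "big_o \<tau> N (\<lambda>n. g n - poly p (\<tau> n))"
    by (auto simp: approx_def)
  have "fps_X ^ N dvd F - (F - fps_of_poly p)"
    using assms(2) p(1) by (rule dvd_diff)
  then have "big_o \<tau> N (\<lambda>n. poly p (\<tau> n))"
    by (intro big_o_poly assms(3)) simp
  from big_o_add[OF p(2) this] show ?thesis by simp
qed

lemma approx_big_o:
  assumes "fps_X ^ N dvd F" "big_o \<tau> N g"
  shows "approx \<tau> N F g"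
  using assms by (auto simp: approx_def intro!: exI[of _ 0])

lemma approx_mono:
  assumes "approx \<tau> M F g" "N \<le> M" "\<And>n. \<bar>\<tau> n\<bar> \<le> 1"
  shows "approx \<tau> N F g"
  using assms unfolding approx_def by (meson power_le_dvd big_o_mono)

lemma approx_const: "approx \<tau> N (fps_const c) (\<lambda>n. c)"
  unfolding approx_def big_o_def
  by (rule exI[of _ "[:c:]"]) (auto simp: fps_of_poly_const intro!: exI[of _ 0])

lemma approx_X: "approx \<tau> N fps_X \<tau>"
  unfolding approx_def big_o_def
  by (rule exI[of _ "[:0, 1:]"]) (auto intro!: exI[of _ 0])

lemma approx_add:
  assumes "approx \<tau> N F f" "approx \<tau> N G g"
  shows "approx \<tau> N (F + G) (\<lambda>n. f n + g n)"
proof -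
  from assms obtain p q where p: "fps_X ^ N dvd F - fps_of_poly p" "big_o \<tau> N (\<lambda>n. f n - poly p (\<tau> n))"
    and q: "fps_X ^ N dvd G - fps_of_poly q" "big_o \<tau> N (\<lambda>n. g n - poly q (\<tau> n))"
    by (auto simp: approx_def)
  have "fps_X ^ N dvd (F - fps_of_poly p) + (G - fps_of_poly q)"
    using p(1) q(1) by (rule dvd_add)
  moreover note big_o_add[OF p(2) q(2)]
  ultimately show ?thesis
    unfolding approx_def by (intro exI[of _ "p + q"]) (simp add: fps_of_poly_add algebra_simps)
qed

text \<open>
  Multiplying two expansions that both start at order \<open>k\<close> improves the precision by \<open>k\<close>. For
  \<open>k = 0\<close> this is the compatibility with products, for \<open>k = 1\<close> it drives the induction below.
\<close>

lemma approx_mult_gain: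
  assumes f: "approx \<tau> N F f" "fps_X ^ k dvd F" and g: "approx \<tau> N G g" "fps_X ^ k dvd G"
    and k: "k \<le> N" and \<tau>: "\<And>n. \<bar>\<tau> n\<bar> \<le> 1"
  shows "approx \<tau> (N + k) (F * G) (\<lambda>n. f n * g n)"
proof -
  from f g obtain p q where p: "fps_X ^ N dvd F - fps_of_poly p" "big_o \<tau> N (\<lambda>n. f n - poly p (\<tau> n))"
    and q: "fps_X ^ N dvd G - fps_of_poly q" "big_o \<tau> N (\<lambda>n. g n - poly q (\<tau> n))"
    by (auto simp: approx_def)
  have fk: "big_o \<tau> k g"
    using approx_mono[OF g(1) k \<tau>] g(2) \<tau> by (rule big_o_approx)
  have "fps_X ^ k dvd F - (F - fps_of_poly p)"
    using f(2) power_le_dvd[OF p(1) k] by (rule dvd_diff)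
  then have pk: "fps_X ^ k dvd fps_of_poly p"
    by simp
  have "fps_X ^ (N + k) dvd (F - fps_of_poly p) * G + (G - fps_of_poly q) * fps_of_poly p"
    unfolding power_add using p(1) q(1) g(2) pk by (intro dvd_add mult_dvd_mono)
  moreover have "big_o \<tau> (N + k) (\<lambda>n. (f n - poly p (\<tau> n)) * g n + (g n - poly q (\<tau> n)) * poly p (\<tau> n))"
    by (intro big_o_add big_o_mult p(2) q(2) fk big_o_poly pk \<tau>)
  ultimately show ?thesis
    unfolding approx_def by (intro exI[of _ "p * q"]) (simp add: fps_of_poly_mult algebra_simps)
qed

lemma approx_mult:
  assumes "approx \<tau> N F f" "approx \<tau> N G g" "\<And>n. \<bar>\<tau> n\<bar> \<le> 1"
  shows "approx \<tau> N (F * G) (\<lambda>n. f n * g n)"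
  using approx_mult_gain[of \<tau> N F f 0 G g] assms by simp

lemma approx_X_mult:
  assumes "approx \<tau> N F f"
  shows "approx \<tau> (Suc N) (fps_X * F) (\<lambda>n. \<tau> n * f n)"
proof -
  from assms obtain p where p: "fps_X ^ N dvd F - fps_of_poly p" "big_o \<tau> N (\<lambda>n. f n - poly p (\<tau> n))"
    by (auto simp: approx_def)
  have "fps_X ^ Suc N dvd fps_X * (F - fps_of_poly p)"
    using p(1) by (simp add: mult_dvd_mono)
  moreover have "big_o \<tau> (1 + N) (\<lambda>n. \<tau> n * (f n - poly p (\<tau> n)))"
    using p(2) by (intro big_o_mult) (auto simp: big_o_def intro: exI[of _ 1])
  ultimately show ?thesis
    unfolding approx_def
    by (intro exI[of _ "[:0, 1:] * p"]) (simp add: fps_of_poly_mult fps_of_poly_pCons algebra_simps)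
qed

lemma approx_subst2:
  assumes "approx \<tau> N F x" "approx \<tau> N G y" "\<And>n. \<bar>\<tau> n\<bar> \<le> 1"
  shows "approx \<tau> N (subst2 fps_const F G p) (\<lambda>n. eval2 p (x n, y n))"
  by (induction p rule: poly2_induct)
    (simp_all add: assms approx_const approx_add approx_mult ring_mapD[OF ring_map_subst2[OF ring_map_fps_const]])

text \<open>
  The coefficients of order less than \<open>k\<close> of the approximating polynomial vanish. So after division by
  \<open>\<tau>\<^sup>k\<close> its coefficient of order \<open>k\<close> remains in the limit.
\<close>

lemma approx_tendsto:
  assumes "approx \<tau> (Suc k) F g" "fps_X ^ k dvd F" "\<tau> \<longlonglongrightarrow> 0" "\<And>n. \<tau> n \<noteq> 0"
  shows "(\<lambda>n. g n / \<tau> n ^ k) \<longlonglongrightarrow> F $ k"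
proof -
  from assms(1) obtain p K where p: "fps_X ^ Suc k dvd F - fps_of_poly p"
    and K: "\<And>n. \<bar>g n - poly p (\<tau> n)\<bar> \<le> K * \<bar>\<tau> n\<bar> ^ Suc k"
    by (auto simp: approx_def big_o_def)
  have c: "coeff p j = F $ j" if "j \<le> k" for j
    using p that unfolding fps_X_power_dvd_iff by simp
  have "p = monom 1 k * poly_shift k p"
  proof (rule poly_eqI)
    fix j
    have "F $ j = 0" if "j < k"
      using assms(2) that by (simp add: fps_X_power_dvd_iff)
    then show "coeff p j = coeff (monom 1 k * poly_shift k p) j"
      using c[of j] by (cases "j < k") (simp_all add: coeff_monom_mult coeff_poly_shift)
  qed
  then have "poly p x = x ^ k * poly (poly_shift k p) x" for x
    by (metis poly_mult poly_monom mult_1)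
  then have pk: "poly p (\<tau> n) / \<tau> n ^ k = poly (poly_shift k p) (\<tau> n)" for n
    using assms(4)[of n] by simp
  have "(\<lambda>n. g n / \<tau> n ^ k - poly (poly_shift k p) (\<tau> n)) \<longlonglongrightarrow> 0"
  proof (rule Lim_null_comparison)
    show "\<forall>\<^sub>F n in sequentially. norm (g n / \<tau> n ^ k - poly (poly_shift k p) (\<tau> n)) \<le> K * \<bar>\<tau> n\<bar>"
    proof (intro always_eventually allI)
      fix n
      have "norm (g n / \<tau> n ^ k - poly (poly_shift k p) (\<tau> n)) = \<bar>g n - poly p (\<tau> n)\<bar> / \<bar>\<tau> n\<bar> ^ k"
        unfolding pk[symmetric] by (simp add: diff_divide_distrib[symmetric] abs_divide power_abs)
      also have "\<dots> \<le> K * \<bar>\<tau> n\<bar> ^ Suc k / \<bar>\<tau> n\<bar> ^ k"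
        by (intro divide_right_mono K) simp
      finally show "norm (g n / \<tau> n ^ k - poly (poly_shift k p) (\<tau> n)) \<le> K * \<bar>\<tau> n\<bar>"
        using assms(4)[of n] by simp
    qed
    show "(\<lambda>n. K * \<bar>\<tau> n\<bar>) \<longlonglongrightarrow> 0"
      using tendsto_mult_right_zero[OF tendsto_rabs_zero[OF assms(3)]] by simp
  qed
  moreover have "(\<lambda>n. poly (poly_shift k p) (\<tau> n)) \<longlonglongrightarrow> poly (poly_shift k p) 0"
    using assms(3) by (intro tendsto_intros)
  ultimately have "(\<lambda>n. (g n / \<tau> n ^ k - poly (poly_shift k p) (\<tau> n)) + poly (poly_shift k p) (\<tau> n))
      \<longlonglongrightarrow> 0 + poly (poly_shift k p) 0"
    by (rule tendsto_add)
  moreover have "poly (poly_shift k p) 0 = F $ k"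
    using c[of k] by (simp add: poly_0_coeff_0 coeff_poly_shift)
  ultimately show ?thesis by simp
qed

lemma big_o_1I:
  assumes "\<forall>\<^sub>F n in sequentially. \<bar>w n\<bar> \<le> C * \<bar>\<tau> n\<bar>" "\<And>n. \<tau> n \<noteq> 0"
  shows "big_o \<tau> 1 w"
proof -
  have "\<forall>\<^sub>F n in sequentially. norm (w n / \<tau> n) \<le> C"
    using assms(1) by eventually_elim (simp add: abs_divide divide_le_eq assms(2))
  then have "Bseq (\<lambda>n. w n / \<tau> n)"
    unfolding Bfun_def by (intro exI[of _ "max 1 C"]) (auto elim: eventually_mono)
  then obtain K where "\<And>n. norm (w n / \<tau> n) \<le> K"
    by (rule BseqE) blast
  then have "\<bar>w n\<bar> \<le> K * \<bar>\<tau> n\<bar> ^ 1" for n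
    using assms(2)[of n] by (metis abs_divide divide_le_eq power_one_right real_norm_def zero_less_abs_iff)
  then show ?thesis by (auto simp: big_o_def)
qed

text \<open>
  Real solutions of the implicit equation close to the origin are expanded by the formal solution:
  the fixed point equation which determines the series also improves the precision of any
  approximation by one order.
\<close>

lemma implicit_solution_approx:
  fixes G1 G2 :: poly2 and W :: "real fps" and \<alpha> :: real
  defines "G \<equiv> varX * G1 + varY * (const2 \<alpha> + varY * G2)"
  assumes "\<alpha> \<noteq> 0" "W $ 0 = 0" "subst2 fps_const fps_X W G = 0"
    and \<tau>: "\<tau> \<longlonglongrightarrow> 0" "\<And>n. \<tau> n \<noteq> 0" "\<And>n. \<bar>\<tau> n\<bar> \<le> 1" and w: "w \<longlonglongrightarrow> 0"
    and zero: "\<And>n. eval2 G (\<tau> n, w n) = 0"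
  shows "approx \<tau> N W w"
proof -
  note s = ring_mapD[OF ring_map_subst2[OF ring_map_fps_const]]
  define A where "A = subst2 fps_const fps_X W G1"
  define B where "B = subst2 fps_const fps_X W G2"
  define a where "a n = eval2 G1 (\<tau> n, w n)" for n
  define e where "e n = eval2 G2 (\<tau> n, w n)" for n
  have fixW: "W = fps_const (- inverse \<alpha>) * (fps_X * A + W * (W * B))"
  proof -
    have "fps_X * A + W * (W * B) = - (fps_const \<alpha> * W)"
      using assms(4) unfolding G_def
      by (simp add: s A_def B_def algebra_simps eq_neg_iff_add_eq_0)
    then have "fps_const (- inverse \<alpha>) * (fps_X * A + W * (W * B)) =
        (fps_const (- inverse \<alpha>) * fps_const (- \<alpha>)) * W"
      by (simp flip: fps_const_neg add: mult.assoc)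
    also have "fps_const (- inverse \<alpha>) * fps_const (- \<alpha>) = 1"
      using assms(2) by simp
    finally show ?thesis by simp
  qed
  have fixw: "w n = - inverse \<alpha> * (\<tau> n * a n + w n * (w n * e n))" for n
  proof -
    have "\<tau> n * a n + w n * (w n * e n) = - (\<alpha> * w n)"
      using zero[of n] by (simp add: G_def a_def e_def algebra_simps eq_neg_iff_add_eq_0)
    then show ?thesis using assms(2) by simp
  qed
  have lim: "(\<lambda>n. eval2 p (\<tau> n, w n)) \<longlonglongrightarrow> eval2 p (0, 0)" for p
    by (induction p rule: poly2_induct) (auto intro!: tendsto_intros \<tau> w)
  have "big_o \<tau> 1 w"
  proof -
    have "Bseq (\<lambda>n. inverse \<alpha> * a n)"
      using lim[of "const2 (inverse \<alpha>) * G1"] by (auto simp: a_def intro!: convergent_imp_Bseq convergentI)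
    then obtain C where C: "\<And>n. norm (inverse \<alpha> * a n) \<le> C"
      by (rule BseqE) blast
    have "(\<lambda>n. inverse \<alpha> * (w n * e n)) \<longlonglongrightarrow> 0"
      using lim[of "const2 (inverse \<alpha>) * (varY * G2)"] by (simp add: e_def)
    then have "\<forall>\<^sub>F n in sequentially. \<bar>inverse \<alpha> * (w n * e n)\<bar> < 1 / 2"
      by (drule_tac tendstoD[of _ _ _ "1/2"]) (simp_all add: dist_norm)
    then have "\<forall>\<^sub>F n in sequentially. \<bar>w n\<bar> \<le> (2 * C) * \<bar>\<tau> n\<bar>"
    proof eventually_elim
      case (elim n)
      have "w n = - (\<tau> n * (inverse \<alpha> * a n) + w n * (inverse \<alpha> * (w n * e n)))"
        by (subst fixw) (simp add: algebra_simps)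
      then have "\<bar>w n\<bar> \<le> \<bar>\<tau> n * (inverse \<alpha> * a n)\<bar> + \<bar>w n * (inverse \<alpha> * (w n * e n))\<bar>"
        by (metis abs_minus_cancel abs_triangle_ineq)
      also have "\<dots> \<le> \<bar>\<tau> n\<bar> * C + \<bar>w n\<bar> * (1 / 2)"
        unfolding abs_mult[of "\<tau> n"] abs_mult[of "w n"] using C[of n] elim
        by (intro add_mono mult_left_mono) auto
      finally show ?case by (simp add: algebra_simps)
    qed
    then show ?thesis using \<tau>(2) by (rule big_o_1I)
  qed
  moreover have WX: "fps_X ^ 1 dvd W"
    unfolding fps_X_power_dvd_iff using assms(3) by simp
  ultimately have base: "approx \<tau> 1 W w"
    by (intro approx_big_o)
  have "approx \<tau> (Suc N) W w" for N
  proof (induction N)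
    case 0
    then show ?case using base by simp
  next
    case (Suc N)
    have sub: "approx \<tau> (Suc N) A a" "approx \<tau> (Suc N) B e"
      unfolding A_def B_def a_def e_def by (intro approx_subst2 approx_X Suc \<tau>)+
    have "approx \<tau> (Suc N + 1) (W * (W * B)) (\<lambda>n. w n * (w n * e n))"
      using WX by (intro approx_mult_gain approx_mult Suc sub \<tau> dvd_mult2) auto
    then have "approx \<tau> (Suc (Suc N)) (W * (W * B)) (\<lambda>n. w n * (w n * e n))"
      by simp
    from approx_mult[OF approx_const approx_add[OF approx_X_mult[OF sub(1)] this] \<tau>(3), of "- inverse \<alpha>"]
    show ?case
      unfolding fixW[symmetric] fixw[symmetric] .
  qed
  from approx_mono[OF this[of N] _ \<tau>(3)] show ?thesis
    by simp
qed

text \<open>Multiplication by a power of the parameter clears the pole, which leaves a power series.\<close>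

definition laurent_approx :: "(nat \<Rightarrow> real) \<Rightarrow> real fls \<Rightarrow> (nat \<Rightarrow> real) \<Rightarrow> bool" where
  "laurent_approx \<tau> f g \<longleftrightarrow>
     (\<exists>m F. fls_X ^ m * f = fps_to_fls F \<and> (\<forall>N. approx \<tau> N F (\<lambda>n. \<tau> n ^ m * g n)))"

lemma fps_X_power_to_fls: "fps_to_fls (fps_X ^ n :: real fps) = fls_X ^ n"
  by (simp add: fps_to_fls_power)

lemma approx_X_power:
  assumes "\<And>n. \<bar>\<tau> n\<bar> \<le> 1"
  shows "approx \<tau> N (fps_X ^ k) (\<lambda>n. \<tau> n ^ k)"
proof (induction k)
  case 0
  then show ?case using approx_const[of \<tau> N 1] by simp
next
  case (Suc k)
  then show ?case using approx_mult[OF approx_X Suc assms] by simp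
qed

lemma laurent_approx_fps:
  assumes "\<And>N. approx \<tau> N F g"
  shows "laurent_approx \<tau> (fps_to_fls F) g"
  unfolding laurent_approx_def using assms by (intro exI[of _ 0] exI[of _ F]) simp

lemma laurent_approx_const: "laurent_approx \<tau> (fls_const c) (\<lambda>n. c)"
  using laurent_approx_fps[OF approx_const, of \<tau> c] by simp

lemma laurent_approx_X_inv:
  assumes "\<And>n. \<tau> n \<noteq> 0"
  shows "laurent_approx \<tau> fls_X_inv (\<lambda>n. 1 / \<tau> n)"
  unfolding laurent_approx_def
proof (intro exI[of _ 1] conjI allI)
  show "fls_X ^ 1 * fls_X_inv = fps_to_fls (1 :: real fps)"
    by (simp add: fls_X_times_conv_shift)
  show "approx \<tau> N 1 (\<lambda>n. \<tau> n ^ 1 * (1 / \<tau> n))" for N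
    using approx_const[of \<tau> N 1] assms by simp
qed

lemma laurent_approx_add:
  assumes "laurent_approx \<tau> f x" "laurent_approx \<tau> g y" and \<tau>: "\<And>n. \<bar>\<tau> n\<bar> \<le> 1"
  shows "laurent_approx \<tau> (f + g) (\<lambda>n. x n + y n)"
proof -
  from assms obtain k F l G where F: "fls_X ^ k * f = fps_to_fls F" "\<And>N. approx \<tau> N F (\<lambda>n. \<tau> n ^ k * x n)"
    and G: "fls_X ^ l * g = fps_to_fls G" "\<And>N. approx \<tau> N G (\<lambda>n. \<tau> n ^ l * y n)"
    by (auto simp: laurent_approx_def)
  have "fls_X ^ (k + l) * (f + g) = fls_X ^ l * (fls_X ^ k * f) + fls_X ^ k * (fls_X ^ l * g)"
    by (simp add: power_add algebra_simps)
  also have "\<dots> = fps_to_fls (fps_X ^ l * F + fps_X ^ k * G)"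
    unfolding F G by (simp add: fls_times_fps_to_fls fps_X_power_to_fls)
  finally have "fls_X ^ (k + l) * (f + g) = \<dots>" .
  moreover have "approx \<tau> N (fps_X ^ l * F + fps_X ^ k * G) (\<lambda>n. \<tau> n ^ (k + l) * (x n + y n))" for N
  proof -
    have "approx \<tau> N (fps_X ^ l * F + fps_X ^ k * G)
        (\<lambda>n. \<tau> n ^ l * (\<tau> n ^ k * x n) + \<tau> n ^ k * (\<tau> n ^ l * y n))"
      by (intro approx_add approx_mult approx_X_power F G \<tau>)
    then show ?thesis by (simp add: power_add algebra_simps)
  qed
  ultimately show ?thesis
    unfolding laurent_approx_def by blast
qed

lemma laurent_approx_mult:
  assumes "laurent_approx \<tau> f x" "laurent_approx \<tau> g y" and \<tau>: "\<And>n. \<bar>\<tau> n\<bar> \<le> 1"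
  shows "laurent_approx \<tau> (f * g) (\<lambda>n. x n * y n)"
proof -
  from assms obtain k F l G where F: "fls_X ^ k * f = fps_to_fls F" "\<And>N. approx \<tau> N F (\<lambda>n. \<tau> n ^ k * x n)"
    and G: "fls_X ^ l * g = fps_to_fls G" "\<And>N. approx \<tau> N G (\<lambda>n. \<tau> n ^ l * y n)"
    by (auto simp: laurent_approx_def)
  have "fls_X ^ (k + l) * (f * g) = (fls_X ^ k * f) * (fls_X ^ l * g)"
    by (simp add: power_add algebra_simps)
  also have "\<dots> = fps_to_fls (F * G)"
    unfolding F G by (simp add: fls_times_fps_to_fls)
  finally have "fls_X ^ (k + l) * (f * g) = \<dots>" .
  moreover have "approx \<tau> N (F * G) (\<lambda>n. \<tau> n ^ (k + l) * (x n * y n))" for N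
  proof -
    have "approx \<tau> N (F * G) (\<lambda>n. (\<tau> n ^ k * x n) * (\<tau> n ^ l * y n))"
      by (intro approx_mult F G \<tau>)
    then show ?thesis by (simp add: power_add algebra_simps)
  qed
  ultimately show ?thesis
    unfolding laurent_approx_def by blast
qed

lemma laurent_approx_subst2:
  assumes "laurent_approx \<tau> f x" "laurent_approx \<tau> g y" "\<And>n. \<bar>\<tau> n\<bar> \<le> 1"
  shows "laurent_approx \<tau> (subst2 fls_const f g p) (\<lambda>n. eval2 p (x n, y n))"
  by (induction p rule: poly2_induct)
    (simp_all add: assms laurent_approx_const laurent_approx_add laurent_approx_mult
      ring_mapD[OF ring_map_subst2[OF ring_map_fls_const]])

lemma laurent_approx_tendsto:
  assumes "laurent_approx \<tau> f g" "f \<noteq> 0" "\<tau> \<longlonglongrightarrow> 0" "\<And>n. \<tau> n \<noteq> 0"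
  obtains c where "c \<noteq> 0" "(\<lambda>n. g n * \<tau> n powi (- fls_subdegree f)) \<longlonglongrightarrow> c"
proof -
  from assms(1) obtain m F where F: "fls_X ^ m * f = fps_to_fls F" "\<And>N. approx \<tau> N F (\<lambda>n. \<tau> n ^ m * g n)"
    by (auto simp: laurent_approx_def)
  have F0: "F \<noteq> 0"
  proof
    assume "F = 0"
    then have "fls_X ^ m * f = 0" using F(1) by simp
    then show False using assms(2) by simp
  qed
  define k where "k = subdegree F"
  have k: "int k = int m + fls_subdegree f"
    using arg_cong[OF F(1), of fls_subdegree] assms(2) by (simp add: k_def fls_subdegree_fls_to_fps)
  have "(\<lambda>n. (\<tau> n ^ m * g n) / \<tau> n ^ k) \<longlonglongrightarrow> F $ k"
    by (intro approx_tendsto F assms) (auto simp: fps_X_power_dvd_iff k_def)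
  moreover have "(\<tau> n ^ m * g n) / \<tau> n ^ k = g n * \<tau> n powi (- fls_subdegree f)" for n
  proof -
    have "- fls_subdegree f = int m - int k" using k by simp
    then show ?thesis
      using assms(4)[of n] by (simp add: power_int_diff)
  qed
  moreover have "F $ k \<noteq> 0"
    using F0 by (simp add: k_def)
  ultimately show ?thesis using that by simp
qed

lemma laurent_approx_bounded:
  assumes "laurent_approx \<tau> f g" "fls_X ^ N * f = fps_to_fls F0"
    "\<And>n. \<tau> n \<noteq> 0" "\<And>n. \<bar>\<tau> n\<bar> \<le> 1"
  obtains K where "\<And>n. \<bar>g n\<bar> * \<bar>\<tau> n\<bar> ^ N \<le> K"
proof -
  from assms(1) obtain m F where F: "fls_X ^ m * f = fps_to_fls F" "\<And>N. approx \<tau> N F (\<lambda>n. \<tau> n ^ m * g n)"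
    by (auto simp: laurent_approx_def)
  have "fps_to_fls (fps_X ^ N * F) = fps_to_fls (fps_X ^ m * F0)"
    by (simp only: fls_times_fps_to_fls fps_X_power_to_fls F(1)[symmetric] assms(2)[symmetric] mult.left_commute)
  then have eq: "fps_X ^ N * F = fps_X ^ m * F0"
    by simp
  have "approx \<tau> m (fps_X ^ N * F) (\<lambda>n. \<tau> n ^ N * (\<tau> n ^ m * g n))"
    by (intro approx_mult approx_X_power F assms(4))
  then have "big_o \<tau> m (\<lambda>n. \<tau> n ^ N * (\<tau> n ^ m * g n))"
    unfolding eq by (rule big_o_approx) (simp_all add: assms(4))
  then obtain K where "\<And>n. \<bar>\<tau> n ^ N * (\<tau> n ^ m * g n)\<bar> \<le> K * \<bar>\<tau> n\<bar> ^ m"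
    by (auto simp: big_o_def)
  then have "\<bar>\<tau> n\<bar> ^ m * (\<bar>g n\<bar> * \<bar>\<tau> n\<bar> ^ N) \<le> \<bar>\<tau> n\<bar> ^ m * K" for n
    by (simp add: abs_mult power_abs mult_ac)
  then have "\<bar>g n\<bar> * \<bar>\<tau> n\<bar> ^ N \<le> K" for n
    using assms(3)[of n] by (meson mult_left_le_imp_le zero_less_abs_iff zero_less_power)
  then show ?thesis using that by blast
qed

lemma linear_prod_expand:
  assumes "finite J"
  shows "\<exists>Q. (\<Prod>j\<in>J. const2 (c j) + const2 (e j) * varY) = const2 (\<Prod>j\<in>J. c j) + varY * Q"
  using assms
proof (induction J rule: finite_induct)
  case empty
  then show ?case by (intro exI[of _ 0]) (simp add: const2_simps)
next
  case (insert j J)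
  then obtain Q where Q: "(\<Prod>j\<in>J. const2 (c j) + const2 (e j) * varY) = const2 (\<Prod>j\<in>J. c j) + varY * Q"
    by blast
  then have "(\<Prod>j\<in>insert j J. const2 (c j) + const2 (e j) * varY) =
      const2 (\<Prod>j\<in>insert j J. c j) +
      varY * (const2 (e j) * (const2 (\<Prod>j\<in>J. c j) + varY * Q) + const2 (c j) * Q)"
    using insert.hyps by (simp add: const2_simps algebra_simps)
  then show ?case by blast
qed

text \<open>
  The homogeneous equation of the curve \<open>b = c\<close> in the coordinates \<open>(\<tau>, w)\<close> around the point at
  infinity \<open>(-s : r : 0)\<close>, where \<open>x = (- s + r w) / \<tau>\<close> and \<open>y = (r + s w) / \<tau>\<close>.
\<close>

definition chart_part :: "real \<Rightarrow> real \<Rightarrow> poly2 \<Rightarrow> nat \<Rightarrow> poly2" where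
  "chart_part r s b k =
     subst2 const2 (const2 (- s) + const2 r * varY) (const2 r + const2 s * varY) (hom_part k b)"

definition chart_rest :: "real \<Rightarrow> real \<Rightarrow> poly2 \<Rightarrow> nat \<Rightarrow> real \<Rightarrow> poly2" where
  "chart_rest r s b d c =
     (\<Sum>k<d. chart_part r s b k * varX ^ (d - 1 - k)) - const2 c * varX ^ (d - 1)"

lemma subst2_chart:
  assumes h: "ring_map h" and b: "deg_le d b" and d: "d > 0" and T: "T * \<tau> = 1"
  shows "subst2 h \<tau> w (varX * chart_rest r s b d c + chart_part r s b d) =
    \<tau> ^ d * (subst2 h (T * (h (- s) + h r * w)) (T * (h r + h s * w)) b - h c)"
proof -
  note sh = ring_mapD[OF ring_map_subst2[OF h]]
  have "subst2 h \<tau> w (chart_part r s b k) =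
      subst2 (\<lambda>c. subst2 h \<tau> w (const2 c)) (subst2 h \<tau> w (const2 (- s) + const2 r * varY))
        (subst2 h \<tau> w (const2 r + const2 s * varY)) (hom_part k b)" for k
    unfolding chart_part_def by (intro ring_map_subst2_comp ring_map_subst2 h ring_map_const2)
  then have part: "subst2 h \<tau> w (chart_part r s b k) =
      subst2 h (h (- s) + h r * w) (h r + h s * w) (hom_part k b)" for k
    by (simp add: h sh)
  have scale: "\<tau> ^ d * subst2 h (T * x) (T * y) (hom_part k b) = \<tau> ^ (d - k) * subst2 h x y (hom_part k b)"
    if "k \<le> d" for k x y
  proof -
    have "\<tau> ^ d * T ^ k = \<tau> ^ (d - k) * (T * \<tau>) ^ k"
      using that unfolding power_mult_distrib by (simp flip: power_add add: mult_ac)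
    then show ?thesis
      unfolding subst2_hom_part_scale[OF h] by (simp add: T flip: mult.assoc)
  qed
  have "varX * chart_rest r s b d c = (\<Sum>k<d. chart_part r s b k * varX ^ (d - k)) - const2 c * varX ^ d"
  proof -
    have "varX * (p * varX ^ (d - 1 - k)) = p * varX ^ (d - k)" if "k < d" for p :: poly2 and k
    proof -
      have "d - k = Suc (d - 1 - k)" using that by simp
      then show ?thesis by simp
    qed
    moreover have "varX ^ d = varX * varX ^ (d - 1)"
      using d by (simp add: power_eq_if)
    moreover from calculation have "(\<Sum>k<d. varX * (chart_part r s b k * varX ^ (d - 1 - k))) =
        (\<Sum>k<d. chart_part r s b k * varX ^ (d - k))"
      by (intro sum.cong) auto
    ultimately show ?thesis
      unfolding chart_rest_def right_diff_distrib sum_distrib_left by (simp add: mult_ac)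
  qed
  then have "varX * chart_rest r s b d c + chart_part r s b d =
      (\<Sum>k\<le>d. chart_part r s b k * varX ^ (d - k)) - const2 c * varX ^ d"
    by (simp add: lessThan_Suc_atMost[symmetric])
  then have "subst2 h \<tau> w (varX * chart_rest r s b d c + chart_part r s b d) =
      (\<Sum>k\<le>d. \<tau> ^ d * subst2 h (T * (h (- s) + h r * w)) (T * (h r + h s * w)) (hom_part k b)) - h c * \<tau> ^ d"
    by (simp add: sh h part scale mult.commute)
  also have "\<dots> = \<tau> ^ d * (subst2 h (T * (h (- s) + h r * w)) (T * (h r + h s * w)) (\<Sum>k\<le>d. hom_part k b) - h c)"
    by (simp add: sh sum_distrib_left algebra_simps)
  finally show ?thesis
    using sum_hom_part[OF b] by simp
qed

text \<open>
  The leading form of \<open>b\<close> becomes \<open>const2 \<alpha> * varY\<close> up to terms of higher order in \<open>varY\<close>, because exactly one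
  of its linear factors vanishes at the point. This is the hypothesis of the implicit function theorem.
\<close>

lemma chart_part_top:
  fixes r s :: "'i \<Rightarrow> real"
  assumes top: "hom_part d b = (\<Prod>j\<in>I. const2 (r j) * varX + const2 (s j) * varY)"
    and I: "finite I" "i \<in> I" and nz: "\<And>j. j \<in> I \<Longrightarrow> (r j, s j) \<noteq> (0, 0)"
    and inj: "inj_on (\<lambda>j. span {(r j, s j)}) I"
  obtains \<alpha> Q where "\<alpha> \<noteq> 0" "chart_part (r i) (s i) b d = varY * (const2 \<alpha> + varY * Q)"
proof -
  let ?c = "\<lambda>j. r j * (- s i) + s j * r i" and ?e = "\<lambda>j. r j * r i + s j * s i"
  have "chart_part (r i) (s i) b d = (\<Prod>j\<in>I. const2 (?c j) + const2 (?e j) * varY)"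
    by (simp add: chart_part_def top ring_mapD[OF ring_map_subst2[OF ring_map_const2]] const2_simps algebra_simps)
  also have "\<dots> = (const2 (?c i) + const2 (?e i) * varY) * (\<Prod>j\<in>I - {i}. const2 (?c j) + const2 (?e j) * varY)"
    using I by (simp add: prod.remove)
  also obtain Q where "(\<Prod>j\<in>I - {i}. const2 (?c j) + const2 (?e j) * varY) = const2 (\<Prod>j\<in>I - {i}. ?c j) + varY * Q"
    using linear_prod_expand[of "I - {i}" ?c ?e] I by blast
  also have "(const2 (?c i) + const2 (?e i) * varY) * (const2 (\<Prod>j\<in>I - {i}. ?c j) + varY * Q) =
      varY * (const2 (?e i * (\<Prod>j\<in>I - {i}. ?c j)) + varY * (const2 (?e i) * Q))"
    by (simp add: const2_simps algebra_simps)
  finally have eq: "chart_part (r i) (s i) b d = \<dots>" .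
  have "?c j \<noteq> 0" if "j \<in> I - {i}" for j
  proof
    assume "?c j = 0"
    then have "span {(r i, s i)} = span {(r j, s j)}"
      using nz that I by (intro linear_eval_zero_imp_parallel) auto
    then show False
      using inj_onD[OF inj, of i j] that I by blast
  qed
  then have "(\<Prod>j\<in>I - {i}. ?c j) \<noteq> 0"
    using I by (subst prod_zero_iff) auto
  moreover have "?e i \<noteq> 0"
    using nz[OF I(2)] by (simp add: sum_squares_eq_zero_iff)
  ultimately show ?thesis
    using that[OF _ eq] by simp
qed

text \<open>
  The coordinates of a point with respect to the orthogonal basis \<open>(-s, r)\<close>, \<open>(r, s)\<close>.
\<close>

definition along :: "real \<Rightarrow> real \<Rightarrow> real \<times> real \<Rightarrow> real" where
  "along r s z = (- s * fst z + r * snd z) / (r\<^sup>2 + s\<^sup>2)"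

definition across :: "real \<Rightarrow> real \<Rightarrow> real \<times> real \<Rightarrow> real" where
  "across r s z = (r * fst z + s * snd z) / (r\<^sup>2 + s\<^sup>2)"

lemma along_across:
  assumes "(r, s) \<noteq> (0, 0)"
  shows "z = (- s * along r s z + r * across r s z, r * along r s z + s * across r s z)"
proof -
  define D where "D = r\<^sup>2 + s\<^sup>2"
  have D: "D \<noteq> 0"
    using assms by (simp add: D_def sum_power2_eq_zero_iff)
  have "- s * (- s * x + r * y) + r * (r * x + s * y) = D * x"
    "r * (- s * x + r * y) + s * (r * x + s * y) = D * y" for x y
    by (simp_all add: D_def power2_eq_square algebra_simps)
  then show ?thesis
    using D by (cases z) (simp add: along_def across_def D_def[symmetric] add_divide_distrib[symmetric] diff_divide_distrib[symmetric])
qed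

definition tends_to_infinity_along :: "real \<Rightarrow> real \<Rightarrow> (nat \<Rightarrow> real \<times> real) \<Rightarrow> bool" where
  "tends_to_infinity_along r s z \<longleftrightarrow>
     (\<forall>n. \<bar>along r s (z n)\<bar> \<ge> 1) \<and> (\<lambda>n. 1 / along r s (z n)) \<longlonglongrightarrow> 0 \<and>
     (\<lambda>n. across r s (z n) / along r s (z n)) \<longlonglongrightarrow> 0"

text \<open>
  The completion of the coordinate ring of the curve at a simple point at infinity is a ring of power
  series in one variable. So there is an expansion homomorphism \<open>\<phi>\<close> into the Laurent series whose
  pole order is bounded by the degree, with the value of the leading form at the point as the
  extreme coefficient. It describes the growth of polynomials along all real sequences on the curve
  tending to the point.
\<close>

lemma branch_exists:
  fixes r s :: "'i \<Rightarrow> real"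
  assumes d: "d > 0" and b: "deg_le d b"
    and top: "hom_part d b = (\<Prod>j\<in>I. const2 (r j) * varX + const2 (s j) * varY)"
    and I: "finite I" "i \<in> I" and nz: "\<And>j. j \<in> I \<Longrightarrow> (r j, s j) \<noteq> (0, 0)"
    and inj: "inj_on (\<lambda>j. span {(r j, s j)}) I"
  obtains \<phi> :: "poly2 \<Rightarrow> real fls" where "ring_map \<phi>" "\<And>a. \<phi> (const2 a) = fls_const a"
    "\<phi> b = fls_const c"
    "\<And>n a. deg_le n a \<Longrightarrow>
       \<exists>F. fls_X ^ n * \<phi> a = fps_to_fls F \<and> F $ 0 = eval2 (hom_part n a) (- s i, r i)"
    "\<And>z a. tends_to_infinity_along (r i) (s i) z \<Longrightarrow> (\<And>n. eval2 b (z n) = c) \<Longrightarrow>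
       laurent_approx (\<lambda>n. 1 / along (r i) (s i) (z n)) (\<phi> a) (\<lambda>n. eval2 a (z n))"
proof -
  define R where "R = r i"
  define S where "S = s i"
  obtain \<alpha> Q where \<alpha>: "\<alpha> \<noteq> 0" and part: "chart_part R S b d = varY * (const2 \<alpha> + varY * Q)"
    unfolding R_def S_def using chart_part_top[OF top I nz inj] by blast
  define G where "G = varX * chart_rest R S b d c + varY * (const2 \<alpha> + varY * Q)"
  obtain W where W: "W $ 0 = 0" "subst2 fps_const fps_X W G = 0"
    using formal_implicit_function[OF \<alpha>, of "chart_rest R S b d c" Q] unfolding G_def by blast
  define w where "w = fps_to_fls W"
  define x where "x = fls_X_inv * (fls_const (- S) + fls_const R * w)"
  define y where "y = fls_X_inv * (fls_const R + fls_const S * w)"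
  define \<phi> where "\<phi> = subst2 fls_const x y"
  have X: "fls_X_inv * fls_X = (1 :: real fls)"
    by (simp add: fls_X_inv_times_conv_shift)
  have "subst2 fls_const fls_X w G = fps_to_fls (subst2 fps_const fps_X W G)"
    unfolding w_def by (subst ring_map_subst2_comp[OF ring_map_fps_to_fls]) simp_all
  then have "fls_X ^ d * (\<phi> b - fls_const c) = 0"
    using subst2_chart[OF ring_map_fls_const b d X, of w R S c] W(2)
    by (simp add: G_def part \<phi>_def x_def y_def)
  then have phib: "\<phi> b = fls_const c"
    by simp
  have lead: "\<exists>F. fls_X ^ n * \<phi> a = fps_to_fls F \<and> F $ 0 = eval2 (hom_part n a) (- S, R)"
    if "deg_le n a" for n a
  proof -
    let ?P = "\<lambda>k. subst2 fps_const (fps_const (- S) + fps_const R * W) (fps_const R + fps_const S * W) (hom_part k a)"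
    define F where "F = (\<Sum>k\<le>n. fps_X ^ (n - k) * ?P k)"
    have k: "fls_X ^ n * \<phi> (hom_part k a) = fps_to_fls (fps_X ^ (n - k) * ?P k)" if "k \<le> n" for k
    proof -
      have "\<phi> (hom_part k a) = fls_X_inv ^ k *
          subst2 fls_const (fls_const (- S) + fls_const R * w) (fls_const R + fls_const S * w) (hom_part k a)"
        unfolding \<phi>_def x_def y_def by (rule subst2_hom_part_scale) simp
      also have "subst2 fls_const (fls_const (- S) + fls_const R * w) (fls_const R + fls_const S * w) (hom_part k a) =
          fps_to_fls (?P k)"
        by (subst ring_map_subst2_comp[OF ring_map_fps_to_fls]) (simp_all add: w_def fls_times_fps_to_fls)
      finally have "fls_X ^ n * \<phi> (hom_part k a) = fls_X ^ (n - k) * (fls_X_inv * fls_X) ^ k * fps_to_fls (?P k)"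
        using that by (simp add: power_mult_distrib mult_ac flip: power_add)
      then show ?thesis
        by (simp add: X fls_times_fps_to_fls fps_X_power_to_fls)
    qed
    have "fls_X ^ n * \<phi> a = (\<Sum>k\<le>n. fls_X ^ n * \<phi> (hom_part k a))"
      by (subst sum_hom_part[OF that])
        (simp add: \<phi>_def ring_mapD[OF ring_map_subst2[OF ring_map_fls_const]] sum_distrib_left)
    also have "\<dots> = fps_to_fls F"
      unfolding F_def by (simp add: k ring_mapD[OF ring_map_fps_to_fls])
    finally have "fls_X ^ n * \<phi> a = fps_to_fls F" .
    moreover have "F $ 0 = eval2 (hom_part n a) (- S, R)"
    proof -
      have "ring_map (\<lambda>f :: real fps. f $ 0)"
        by (simp add: ring_map_def)
      then have "?P k $ 0 = eval2 (hom_part k a) (- S, R)" for k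
        unfolding eval2_eq_subst2 by (subst ring_map_subst2_comp) (simp_all add: W(1))
      then have "F $ 0 = (\<Sum>k\<le>n. if k = n then eval2 (hom_part n a) (- S, R) else 0)"
        unfolding F_def fps_sum_nth by (intro sum.cong) (auto simp: power_0_left)
      then show ?thesis by simp
    qed
    ultimately show ?thesis by blast
  qed
  have real: "laurent_approx (\<lambda>n. 1 / along R S (z n)) (\<phi> a) (\<lambda>n. eval2 a (z n))"
    if z: "tends_to_infinity_along R S z" "\<And>n. eval2 b (z n) = c" for z a
  proof -
    define \<tau> where "\<tau> = (\<lambda>n. 1 / along R S (z n))"
    define v where "v = (\<lambda>n. across R S (z n) / along R S (z n))"
    have t1: "\<bar>along R S (z n)\<bar> \<ge> 1" for n
      using z(1) by (simp add: tends_to_infinity_along_def)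
    then have t0: "along R S (z n) \<noteq> 0" for n
      by (metis abs_zero not_one_le_zero)
    have \<tau>: "\<tau> \<longlonglongrightarrow> 0" "v \<longlonglongrightarrow> 0" "\<And>n. \<tau> n \<noteq> 0" "\<And>n. \<bar>\<tau> n\<bar> \<le> 1"
      using z(1) t1 t0 by (auto simp: tends_to_infinity_along_def \<tau>_def v_def)
    have zn: "z n = (1 / \<tau> n * (- S + R * v n), 1 / \<tau> n * (R + S * v n))" for n
      using along_across[of R S "z n"] nz[OF I(2)] t0[of n]
      by (simp add: \<tau>_def v_def R_def S_def algebra_simps)
    have "eval2 G (\<tau> n, v n) = 0" for n
    proof -
      have "1 / \<tau> n * \<tau> n = 1"
        using \<tau>(3)[of n] by simp
      from subst2_chart[OF ring_map_id b d this, of "v n" R S c]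
      show ?thesis
        using z(2)[of n] unfolding zn by (simp add: eval2_eq_subst2 G_def part)
    qed
    then have W_approx: "approx \<tau> N W v" for N
      using implicit_solution_approx[OF \<alpha> W(1)] W(2) \<tau> unfolding G_def by blast
    have w_approx: "laurent_approx \<tau> w v"
      unfolding w_def using W_approx by (rule laurent_approx_fps)
    have "laurent_approx \<tau> x (\<lambda>n. 1 / \<tau> n * (- S + R * v n))"
      "laurent_approx \<tau> y (\<lambda>n. 1 / \<tau> n * (R + S * v n))"
      unfolding x_def y_def
      by (intro laurent_approx_mult laurent_approx_add laurent_approx_const laurent_approx_X_inv w_approx \<tau>)+
    then have "laurent_approx \<tau> (\<phi> a) (\<lambda>n. eval2 a (1 / \<tau> n * (- S + R * v n), 1 / \<tau> n * (R + S * v n)))"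
      unfolding \<phi>_def by (intro laurent_approx_subst2 \<tau>)
    then have "laurent_approx \<tau> (\<phi> a) (\<lambda>n. eval2 a (z n))"
      by (simp only: zn[symmetric])
    then show ?thesis
      by (simp only: \<tau>_def)
  qed
  show ?thesis
  proof (rule that)
    show "ring_map \<phi>" "\<And>a. \<phi> (const2 a) = fls_const a"
      unfolding \<phi>_def by (simp_all add: ring_map_subst2)
  qed (use phib lead real in \<open>auto simp: R_def S_def\<close>)
qed

section \<open>The filtration by pole orders\<close>

definition pole_le :: "int \<Rightarrow> real fls \<Rightarrow> bool" where
  "pole_le n f \<longleftrightarrow> (\<forall>k < - n. f $$ k = 0)"

lemma pole_le_0 [simp]: "pole_le n 0"
  by (simp add: pole_le_def)

lemma pole_le_subdegree: "f \<noteq> 0 \<Longrightarrow> pole_le n f \<longleftrightarrow> - n \<le> fls_subdegree f"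
  unfolding pole_le_def by (metis fls_eq0_below_subdegree fls_subdegree_geI less_le_trans)

lemma pole_le_mono: "pole_le m f \<Longrightarrow> m \<le> n \<Longrightarrow> pole_le n f"
  by (simp add: pole_le_def)

lemma pole_le_add: "pole_le n f \<Longrightarrow> pole_le n g \<Longrightarrow> pole_le n (f + g)"
  by (simp add: pole_le_def)

lemma pole_le_diff: "pole_le n f \<Longrightarrow> pole_le n g \<Longrightarrow> pole_le n (f - g)"
  by (simp add: pole_le_def)

lemma pole_le_pred: "pole_le n f \<Longrightarrow> f $$ (- n) = 0 \<Longrightarrow> pole_le (n - 1) f"
proof (unfold pole_le_def, intro allI impI)
  fix k
  assume *: "\<forall>k < - n. f $$ k = 0" "f $$ (- n) = 0" "k < - (n - 1)"
  from *(3) have "k = - n \<or> k < - n" by linarith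
  with * show "f $$ k = 0" by auto
qed

lemma pole_le_mult:
  assumes "pole_le m f" "pole_le n g"
  shows "pole_le (m + n) (f * g)" "(f * g) $$ (- (m + n)) = f $$ (- m) * g $$ (- n)"
proof -
  have "pole_le (m + n) (f * g) \<and> (f * g) $$ (- (m + n)) = f $$ (- m) * g $$ (- n)"
  proof (cases "f = 0 \<or> g = 0")
    case False
    then have sub: "- m \<le> fls_subdegree f" "- n \<le> fls_subdegree g"
      using assms by (simp_all add: pole_le_subdegree)
    show ?thesis
    proof (cases "fls_subdegree f = - m \<and> fls_subdegree g = - n")
      case True
      have "pole_le (m + n) (f * g)"
        using False True by (subst pole_le_subdegree) simp_all
      moreover have "(f * g) $$ (- m + - n) = f $$ (- m) * g $$ (- n)"
        using fls_times_base[of f g] True by simp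
      ultimately show ?thesis by simp
    next
      case False': False
      then have gt: "- (m + n) < fls_subdegree f + fls_subdegree g"
        using sub by linarith
      then have "pole_le (m + n) (f * g)" "(f * g) $$ (- (m + n)) = 0"
        using False by (simp_all add: pole_le_subdegree fls_times_nth_eq0)
      moreover have "f $$ (- m) = 0 \<or> g $$ (- n) = 0"
        using False' sub by force
      ultimately show ?thesis by auto
    qed
  qed auto
  then show "pole_le (m + n) (f * g)" "(f * g) $$ (- (m + n)) = f $$ (- m) * g $$ (- n)"
    by blast+
qed

lemma pole_le_top_nth:
  assumes "fls_X ^ n * f = fps_to_fls F"
  shows "pole_le (int n) f" "f $$ (- int n) = F $ 0"
proof -
  have "f $$ k = (if k + int n < 0 then 0 else F $ nat (k + int n))" for k
    using arg_cong[OF assms, of "\<lambda>f. f $$ (k + int n)"] by (simp add: fls_X_power_times_conv_shift)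
  then show "pole_le (int n) f" "f $$ (- int n) = F $ 0"
    by (simp_all add: pole_le_def)
qed

text \<open>An equation with a nonzero coefficient is used to eliminate one unknown.\<close>

lemma homogeneous_system_nontrivial:
  fixes a :: "'e \<Rightarrow> 'u \<Rightarrow> real"
  assumes "finite E" "finite U" "card E < card U"
  shows "\<exists>c. (\<exists>u\<in>U. c u \<noteq> 0) \<and> (\<forall>e\<in>E. (\<Sum>u\<in>U. c u * a e u) = 0)"
  using assms
proof (induction E arbitrary: U a rule: finite_induct)
  case empty
  then obtain u where "u \<in> U" by fastforce
  then show ?case by (intro exI[of _ "\<lambda>_. 1"]) auto
next
  case (insert e E)
  show ?case
  proof (cases "\<forall>u\<in>U. a e u = 0")
    case True
    obtain c where "\<exists>u\<in>U. c u \<noteq> 0" "\<forall>e\<in>E. (\<Sum>u\<in>U. c u * a e u) = 0"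
      using insert.IH[of U a] insert.prems insert.hyps by auto
    then show ?thesis
      using True by (intro exI[of _ c]) auto
  next
    case False
    then obtain v where v: "v \<in> U" "a e v \<noteq> 0" by blast
    define a' where "a' e' u = a e' u - a e' v * a e u / a e v" for e' u
    have "card E < card (U - {v})"
      using insert v(1) by simp
    then obtain c where c: "\<exists>u\<in>U - {v}. c u \<noteq> 0" "\<forall>e'\<in>E. (\<Sum>u\<in>U - {v}. c u * a' e' u) = 0"
      using insert.IH[of "U - {v}" a'] insert.prems by auto
    define t where "t = - (\<Sum>u\<in>U - {v}. c u * a e u) / a e v"
    have split: "(\<Sum>u\<in>U. (c(v := t)) u * a e' u) = t * a e' v + (\<Sum>u\<in>U - {v}. c u * a e' u)" for e'
      using v(1) insert.prems(1) by (subst sum.remove[of _ v]) auto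
    have "(\<Sum>u\<in>U. (c(v := t)) u * a e' u) = 0" if "e' \<in> insert e E" for e'
    proof (cases "e' = e")
      case True
      then show ?thesis unfolding split using v(2) by (simp add: t_def)
    next
      case False
      then have "(\<Sum>u\<in>U - {v}. c u * a' e' u) = 0"
        using c(2) that by blast
      also have "(\<Sum>u\<in>U - {v}. c u * a' e' u) =
          (\<Sum>u\<in>U - {v}. c u * a e' u) - a e' v / a e v * (\<Sum>u\<in>U - {v}. c u * a e u)"
        by (simp add: a'_def sum_distrib_left sum_subtractf[symmetric] algebra_simps)
      finally show ?thesis
        unfolding split by (simp add: t_def algebra_simps)
    qed
    moreover have "\<exists>u\<in>U. (c(v := t)) u \<noteq> 0"
      using c(1) by auto
    ultimately show ?thesis by blast
  qed
qed

text \<open>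
  A polynomial with only simple points at infinity, all of them real, together with the expansion
  homomorphisms at these points. All bounds obtained below depend on \<open>d\<close> only, not on \<open>p\<close>. This is
  what makes them uniform in the family of the curves \<open>b = t\<close>.
\<close>

locale branches =
  fixes d :: nat and p :: poly2 and r s :: "nat \<Rightarrow> real" and \<phi> :: "nat \<Rightarrow> poly2 \<Rightarrow> real fls"
  assumes d: "d > 0" and deg_p: "deg_le d p"
    and top: "hom_part d p = (\<Prod>j=1..d. const2 (r j) * varX + const2 (s j) * varY)"
    and nz: "\<And>j. j \<in> {1..d} \<Longrightarrow> (r j, s j) \<noteq> (0, 0)"
    and inj: "inj_on (\<lambda>j. span {(r j, s j)}) {1..d}"
    and hom: "\<And>i. i \<in> {1..d} \<Longrightarrow> ring_map (\<phi> i)"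
    and phi_const: "\<And>i a. i \<in> {1..d} \<Longrightarrow> \<phi> i (const2 a) = fls_const a"
    and phi_p: "\<And>i. i \<in> {1..d} \<Longrightarrow> \<phi> i p = 0"
    and lead: "\<And>i n a. i \<in> {1..d} \<Longrightarrow> deg_le n a \<Longrightarrow>
       \<exists>F. fls_X ^ n * \<phi> i a = fps_to_fls F \<and> F $ 0 = eval2 (hom_part n a) (- s i, r i)"
begin

lemmas phi_simps = ring_mapD[OF hom]

lemma phi_pole_le: "i \<in> {1..d} \<Longrightarrow> deg_le n a \<Longrightarrow> pole_le (int n) (\<phi> i a)"
  using lead pole_le_top_nth by blast

lemma phi_top_coeff:
  "i \<in> {1..d} \<Longrightarrow> deg_le n a \<Longrightarrow> \<phi> i a $$ (- int n) = eval2 (hom_part n a) (- s i, r i)"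
  using lead pole_le_top_nth by metis

text \<open>
  If the pole orders of \<open>a\<close> at all points at infinity are smaller than the degree \<open>n\<close> of \<open>a\<close>, then the
  leading form of \<open>a\<close> vanishes at these points, so it is a multiple of that of \<open>p\<close> and can be
  cancelled. Hence modulo \<open>p\<close> the degree is the maximal pole order.
\<close>

lemma cancel_leading_form:
  assumes a: "deg_le n a" and zero: "\<And>i. i \<in> {1..d} \<Longrightarrow> \<phi> i a $$ (- int n) = 0"
  shows "\<exists>h. deg_le n h \<and> deg_lt n (a - h * p)"
proof -
  obtain f where f: "degree f \<le> n" "hom_part n a = form_of n f"
    using hom_part_eq_form_of by blast
  show ?thesis
  proof (cases "f = 0")
    case True
    then have "hom_part n a = 0"
      by (simp add: f form_of_def const2_simps)
    then show ?thesis
      using deg_lt_minus_hom_part[OF a] by (intro exI[of _ 0]) simp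
  next
    case False
    have "eval2 (form_of n f) (- s i, r i) = 0" if "i \<in> {1..d}" for i
      using zero[OF that] phi_top_coeff[OF that a] by (simp add: f(2))
    from form_of_linear_factors[OF finite_atLeastAtMost f(1) False nz inj this]
    obtain m g where g: "n = m + card {1..d}" "form_of n f = hom_part d p * form_of m g"
      unfolding top by blast
    have "a - form_of m g * p = (a - hom_part n a) - form_of m g * (p - hom_part d p)"
      by (simp add: f(2) g(2) algebra_simps)
    moreover have "deg_lt (m + d) (form_of m g * (p - hom_part d p))"
      using deg_lt_mult[OF deg_le_form_of deg_lt_minus_hom_part[OF deg_p]] .
    ultimately have "deg_lt n (a - form_of m g * p)"
      using deg_lt_minus_hom_part[OF a] g(1) by (simp only: card_atLeastAtMost diff_Suc_1 deg_lt_diff)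
    moreover have "deg_le n (form_of m g)"
      using deg_le_form_of[of m g] by (rule deg_lt_mono) (simp add: g(1))
    ultimately show ?thesis by blast
  qed
qed

lemma reduce_degree:
  assumes "deg_lt n a" "\<And>i. i \<in> {1..d} \<Longrightarrow> pole_le (int k - 1) (\<phi> i a)"
  shows "\<exists>h. deg_lt n h \<and> deg_lt k (a - h * p)"
  using assms
proof (induction n arbitrary: a)
  case 0
  then show ?case by (intro exI[of _ 0]) simp
next
  case (Suc n)
  show ?case
  proof (cases "n < k")
    case True
    then show ?thesis
      using deg_lt_mono[OF Suc.prems(1), of k] by (intro exI[of _ 0]) simp
  next
    case False
    then have "\<phi> i a $$ (- int n) = 0" if "i \<in> {1..d}" for i
      using Suc.prems(2)[OF that] by (simp add: pole_le_def)
    then obtain h where h: "deg_le n h" "deg_lt n (a - h * p)"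
      using cancel_leading_form[OF Suc.prems(1)] by blast
    have "\<phi> i (a - h * p) = \<phi> i a" if "i \<in> {1..d}" for i
      using that by (simp add: phi_simps phi_p)
    then obtain h' where h': "deg_lt n h'" "deg_lt k (a - h * p - h' * p)"
      using Suc.IH[OF h(2)] Suc.prems(2) by metis
    have "deg_lt (Suc n) (h + h')"
      using h(1) deg_lt_mono[OF h'(1), of "Suc n"] by (simp add: deg_lt_add)
    moreover have "a - (h + h') * p = a - h * p - h' * p"
      by (simp add: algebra_simps)
    ultimately show ?thesis
      using h'(2) by metis
  qed
qed

lemma multiple_if_zero_on_branches:
  assumes "deg_lt n a" "\<And>i. i \<in> {1..d} \<Longrightarrow> \<phi> i a = 0"
  obtains h where "deg_lt n h" "a = h * p"
  using reduce_degree[OF assms(1), of 0] assms(2) by auto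

text \<open>
  Lagrange interpolation on the points at infinity: the product of all linear factors of the leading form
  of \<open>p\<close> except the one belonging to a point vanishes at all other points. A linear form that does not
  vanish at the point fills up the degree.
\<close>

lemma interpolate_top_coeffs:
  assumes "d \<le> n"
  shows "\<exists>h. deg_le n h \<and> (\<forall>i\<in>{1..d}. \<phi> i h $$ (- int n) = y i)"
proof -
  let ?l = "\<lambda>j. const2 (r j) * varX + const2 (s j) * varY"
  let ?m = "\<lambda>i. const2 (- s i) * varX + const2 (r i) * varY"
  define q where "q i = (\<Prod>j\<in>{1..d} - {i}. ?l j) * ?m i ^ (n - (d - 1))" for i
  have hom1: "hom_part 1 (const2 a * varX + const2 c * varY) = const2 a * varX + const2 c * varY" for a c
  proof (rule poly2_eqI)
    fix i j
    show "coeff2 (hom_part 1 (const2 a * varX + const2 c * varY)) i j = coeff2 (const2 a * varX + const2 c * varY) i j"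
      using coeff2_monomial[of a 1 0 j i] coeff2_monomial[of c 0 1 j i] by (auto simp: coeff2_hom_part)
  qed
  have lin: "pole_le 1 (\<phi> k (const2 a * varX + const2 c * varY))"
    "\<phi> k (const2 a * varX + const2 c * varY) $$ (-1) = a * (- s k) + c * r k" if "k \<in> {1..d}" for k a c
    using phi_pole_le[OF that deg_le_linear] phi_top_coeff[OF that deg_le_linear] by (simp_all add: hom1[simplified])
  have prod: "pole_le (int (card J)) (\<Prod>j\<in>J. \<phi> k (?l j)) \<and>
      (\<Prod>j\<in>J. \<phi> k (?l j)) $$ (- int (card J)) = (\<Prod>j\<in>J. r j * (- s k) + s j * r k)"
    if "finite J" "k \<in> {1..d}" for J k
    using that(1)
  proof (induction J rule: finite_induct)
    case empty
    then show ?case by (simp add: pole_le_def)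
  next
    case (insert j J)
    then show ?case
      using pole_le_mult[OF lin(1)[OF that(2), of "r j" "s j"] conjunct1[OF insert.IH]] lin(2)[OF that(2), of "r j" "s j"]
      by simp
  qed
  have pow: "pole_le (int e) (\<phi> k (?m i) ^ e) \<and> (\<phi> k (?m i) ^ e) $$ (- int e) = (- s i * (- s k) + r i * r k) ^ e"
    if "k \<in> {1..d}" for i k e
  proof (induction e)
    case 0
    then show ?case by (simp add: pole_le_def)
  next
    case (Suc e)
    then show ?case
      using pole_le_mult[OF lin(1)[OF that, of "- s i" "r i"] conjunct1[OF Suc]] lin(2)[OF that, of "- s i" "r i"]
      by (simp add: add.commute)
  qed
  define v where "v k i = (\<Prod>j\<in>{1..d} - {i}. r j * (- s k) + s j * r k) * (- s i * (- s k) + r i * r k) ^ (n - (d - 1))" for k i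
  have n: "card ({1..d} - {i}) + (n - (d - 1)) = n" if "i \<in> {1..d}" for i
    using that assms d by simp
  have deg_q: "deg_le n (q i)" if "i \<in> {1..d}" for i
  proof -
    have "deg_le (card ({1..d} - {i}) + (n - (d - 1)) * 1) (q i)"
      unfolding q_def
      by (intro deg_le_mult deg_le_prod deg_le_power deg_le_linear finite_Diff finite_atLeastAtMost)
    then show ?thesis
      by (simp only: mult_1_right n[OF that])
  qed
  have val: "\<phi> k (q i) $$ (- int n) = v k i" if "i \<in> {1..d}" "k \<in> {1..d}" for i k
  proof -
    let ?P = "\<Prod>j\<in>{1..d} - {i}. \<phi> k (?l j)" and ?Q = "\<phi> k (?m i) ^ (n - (d - 1))"
    have q: "\<phi> k (q i) = ?P * ?Q"
      by (simp only: q_def phi_simps[OF that(2)])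
    have sum: "int n = int (card ({1..d} - {i})) + int (n - (d - 1))"
      using n[OF that(1)] by linarith
    have "finite ({1..d} - {i})"
      by simp
    note P = prod[OF this that(2)] and Q = pow[OF that(2), of "n - (d - 1)" i]
    show ?thesis
      unfolding q sum pole_le_mult(2)[OF conjunct1[OF P] conjunct1[OF Q]] v_def
      by (simp only: P Q)
  qed
  have off: "v k i = 0" if "i \<in> {1..d}" "k \<in> {1..d}" "i \<noteq> k" for i k
  proof -
    have "(\<Prod>j\<in>{1..d} - {i}. r j * (- s k) + s j * r k) = 0"
      using that by (intro prod_zero) (auto intro: bexI[of _ k])
    then show ?thesis by (simp add: v_def)
  qed
  have diag: "v k k \<noteq> 0" if "k \<in> {1..d}" for k
  proof -
    have "r j * (- s k) + s j * r k \<noteq> 0" if j: "j \<in> {1..d} - {k}" for j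
    proof
      assume "r j * (- s k) + s j * r k = 0"
      then have "span {(r k, s k)} = span {(r j, s j)}"
        using nz \<open>k \<in> {1..d}\<close> j by (intro linear_eval_zero_imp_parallel) auto
      then show False
        using inj_onD[OF inj, of k j] j \<open>k \<in> {1..d}\<close> by blast
    qed
    then have "(\<Prod>j\<in>{1..d} - {k}. r j * (- s k) + s j * r k) \<noteq> 0"
      by (subst prod_zero_iff) auto
    moreover have "- s k * (- s k) + r k * r k \<noteq> 0"
      using nz[OF that] by auto
    ultimately show ?thesis
      unfolding v_def by (intro no_zero_divisors power_not_zero)
  qed
  define h where "h = (\<Sum>i\<in>{1..d}. const2 (y i / v i i) * q i)"
  have "\<phi> k h $$ (- int n) = y k" if k: "k \<in> {1..d}" for k
  proof -
    have "\<phi> k h $$ (- int n) = (\<Sum>i\<in>{1..d}. y i / v i i * v k i)"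
      using k by (simp add: h_def phi_simps phi_const fls_nth_sum val del: atLeastAtMost_iff)
    also have "\<dots> = (\<Sum>i\<in>{1..d}. if i = k then y k else 0)"
      using off[OF _ k] diag[OF k] by (intro sum.cong) auto
    finally show ?thesis using k by simp
  qed
  moreover have "deg_le n h"
    unfolding h_def by (intro deg_lt_sum deg_lt_const2_mult deg_q)
  ultimately show ?thesis by blast
qed

text \<open>
  If \<open>deg_le m f\<close>, then \<open>f\<close> satisfies modulo \<open>p\<close> an algebraic equation over \<open>\<real>[X\<^sup>2 + Y\<^sup>2]\<close> of
  bounded degree, as the number of monomials in \<open>X\<^sup>2 + Y\<^sup>2\<close> and \<open>f\<close> grows faster than the number of
  conditions for being divisible by \<open>p\<close>. After cancelling a power of \<open>f\<close>, the left hand side becomes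
  a polynomial \<open>G\<close> that vanishes exactly on those branches on which \<open>f\<close> does not vanish. The constant
  term of the equation bounds the order of the zero of \<open>f\<close> at infinity. The form \<open>X\<^sup>2 + Y\<^sup>2\<close> is used as
  it has a pole of order exactly two at every real point at infinity.
\<close>

definition separation_bound :: "nat \<Rightarrow> nat" where
  "separation_bound m = 4 * d\<^sup>2 * m + 2 * d * m"

lemma separating_polynomial:
  assumes f: "deg_le m f"
  obtains G e where "deg_le (separation_bound m) G" "e \<le> separation_bound m"
    "\<And>i. i \<in> {1..d} \<Longrightarrow> \<phi> i f \<noteq> 0 \<Longrightarrow>
       \<phi> i G = 0 \<and> fls_subdegree (\<phi> i f) \<le> int (separation_bound m)"
    "\<And>i. i \<in> {1..d} \<Longrightarrow> \<phi> i f = 0 \<Longrightarrow> pole_le (int e) (\<phi> i G) \<and> \<phi> i G $$ (- int e) \<noteq> 0"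
proof -
  define A where "A = 2 * d\<^sup>2 * m"
  define B where "B = 2 * d"
  define N where "N = 2 * A + B * m"
  have N: "N = separation_bound m"
    by (simp add: N_def A_def B_def separation_bound_def)
  define l where "l = varX * varX + varY * varY"
  have l: "deg_le 2 l"
    unfolding l_def using deg_le_mult[OF deg_le_varX deg_le_varX] deg_le_mult[OF deg_le_varY deg_le_varY]
    by (simp add: deg_lt_add numeral_2_eq_2)
  have hom_l: "hom_part 2 l = l"
  proof (rule poly2_eqI)
    fix i j
    have "varX * varX = const2 1 * varX ^ 2 * varY ^ 0" "varY * varY = const2 1 * varX ^ 0 * varY ^ 2"
      by (simp_all add: const2_simps power2_eq_square)
    then show "coeff2 (hom_part 2 l) i j = coeff2 l i j"
      unfolding coeff2_hom_part l_def by (simp only: coeff_add coeff2_monomial) auto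
  qed
  have pole_l: "\<phi> i l \<noteq> 0 \<and> fls_subdegree (\<phi> i l) = - 2" if i: "i \<in> {1..d}" for i
  proof -
    have "\<phi> i l $$ (- int 2) = s i * s i + r i * r i"
      by (subst phi_top_coeff[OF i l], subst hom_l) (simp add: l_def)
    then have "\<phi> i l $$ (- 2) \<noteq> 0"
      using nz[OF i] by auto
    moreover have "pole_le 2 (\<phi> i l)"
      using phi_pole_le[OF i l] by simp
    ultimately show ?thesis
      by (auto simp: pole_le_def intro!: fls_subdegree_eqI)
  qed
  define mon where "mon u = l ^ fst u * f ^ snd u" for u :: "nat \<times> nat"
  have mon: "deg_le N (mon u)" if "u \<in> {..A} \<times> {..B}" for u
  proof -
    have "fst u * 2 + snd u * m \<le> N"
      unfolding N_def using that by (intro add_mono mult_le_mono1) auto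
    then show ?thesis
      unfolding mon_def
      by (intro deg_lt_mono[OF deg_le_mult[OF deg_le_power[OF l] deg_le_power[OF f]]]) simp
  qed
  \<comment> \<open>A combination of the monomials is a multiple of \<open>p\<close> if its expansions have no coefficients of pole order
    \<open>0, \<dots>, N\<close>. The choice of \<open>A\<close> and \<open>B\<close> makes the monomials outnumber these conditions.\<close>
  have "card ({1..d} \<times> {..N}) < card ({..A} \<times> {..B})"
  proof -
    have "d * (2 * A + B * m + 1) < (A + 1) * (B + 1)"
      by (simp add: B_def A_def algebra_simps power2_eq_square)
    then show ?thesis by (simp add: N_def)
  qed
  from homogeneous_system_nontrivial[OF _ _ this, of "\<lambda>e u. \<phi> (fst e) (mon u) $$ (- int (snd e))"]
  obtain c where c0: "\<exists>u\<in>{..A} \<times> {..B}. c u \<noteq> 0"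
    and c: "\<forall>e\<in>{1..d} \<times> {..N}. (\<Sum>u\<in>{..A} \<times> {..B}. c u * \<phi> (fst e) (mon u) $$ (- int (snd e))) = 0"
    by blast
  define g where "g = (\<Sum>u\<in>{..A} \<times> {..B}. const2 (c u) * mon u)"
  have g: "deg_le N g"
    unfolding g_def by (intro deg_lt_sum deg_lt_const2_mult mon)
  have "pole_le (int 0 - 1) (\<phi> i g)" if i: "i \<in> {1..d}" for i
    unfolding pole_le_def
  proof (intro allI impI)
    fix k :: int
    assume k: "k < - (int 0 - 1)"
    show "\<phi> i g $$ k = 0"
    proof (cases "k < - int N")
      case True
      then show ?thesis using phi_pole_le[OF i g] by (simp add: pole_le_def)
    next
      case False
      then have "k = - int (nat (- k))" "nat (- k) \<le> N"
        using k by auto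
      then have "(\<Sum>u\<in>{..A} \<times> {..B}. c u * \<phi> i (mon u) $$ k) = 0"
        using bspec[OF c, of "(i, nat (- k))"] i by simp
      then show ?thesis
        by (simp only: g_def phi_simps[OF i] phi_const[OF i] fls_nth_sum fls_mult_const_nth)
    qed
  qed
  then obtain h where "g = h * p"
    using reduce_degree[OF g, of 0] by auto
  then have phi_g: "\<phi> i g = 0" if "i \<in> {1..d}" for i
    using that by (simp add: phi_simps phi_p)
  define k0 where "k0 = (LEAST k. \<exists>a\<le>A. c (a, k) \<noteq> 0)"
  have ex: "\<exists>k\<le>B. \<exists>a\<le>A. c (a, k) \<noteq> 0"
    using c0 by auto
  then obtain k where k: "k \<le> B" "\<exists>a\<le>A. c (a, k) \<noteq> 0"
    by blast
  have k0: "\<exists>a\<le>A. c (a, k0) \<noteq> 0"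
    unfolding k0_def using k(2) by (rule LeastI)
  have "k0 \<le> k"
    unfolding k0_def using k(2) by (rule Least_le)
  then have k0B: "k0 \<le> B"
    using k(1) by simp
  have below: "c (a, k) = 0" if "a \<le> A" "k < k0" for a k
    using not_less_Least[OF that(2)[unfolded k0_def]] that(1) by blast
  define q where "q k = (\<Sum>a\<le>A. const2 (c (a, k)) * l ^ a)" for k
  define R where "R = (\<Sum>k\<in>{k0<..B}. q k * f ^ (k - k0 - 1))"
  define G where "G = q k0 + f * R"
  have deg_term: "deg_le N (q k * f ^ j)" if "j \<le> B" for k j
  proof -
    have "deg_le N (l ^ a * f ^ j)" if "a \<le> A" for a
      using mon[of "(a, j)"] that \<open>j \<le> B\<close> by (simp add: mon_def)
    then show ?thesis
      unfolding q_def sum_distrib_right mult.assoc by (intro deg_lt_sum deg_lt_const2_mult) auto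
  qed
  have G_eq: "G = (\<Sum>k\<in>{k0..B}. q k * f ^ (k - k0))"
  proof -
    have "f * (q k * f ^ (k - k0 - 1)) = q k * f ^ (k - k0)" if "k \<in> {k0<..B}" for k
    proof -
      have "k - k0 = Suc (k - k0 - 1)" using that by auto
      then show ?thesis by (metis mult.left_commute power_Suc)
    qed
    then have "f * R = (\<Sum>k\<in>{k0<..B}. q k * f ^ (k - k0))"
      unfolding R_def sum_distrib_left by (intro sum.cong) auto
    then show ?thesis
      unfolding G_def using k0B by (simp add: sum.head)
  qed
  have degG: "deg_le N G"
    unfolding G_eq by (intro deg_lt_sum deg_term) auto
  have degR: "deg_le N R"
    unfolding R_def by (intro deg_lt_sum deg_term) auto
  have "g = f ^ k0 * G"
  proof -
    have "g = (\<Sum>a\<le>A. \<Sum>k\<le>B. const2 (c (a, k)) * (l ^ a * f ^ k))"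
      by (simp add: g_def sum.cartesian_product mon_def case_prod_beta)
    also have "\<dots> = (\<Sum>k\<le>B. q k * f ^ k)"
      by (subst sum.swap) (simp add: q_def sum_distrib_right mult.assoc)
    also have "\<dots> = (\<Sum>k\<in>{k0..B}. q k * f ^ k)"
      by (rule sum.mono_neutral_right) (auto simp: q_def below const2_simps)
    also have "\<dots> = f ^ k0 * G"
      unfolding G_eq sum_distrib_left
      by (intro sum.cong) (auto simp: mult.left_commute[of "f ^ k0"] simp flip: power_add)
    finally show ?thesis .
  qed
  then have phi_G: "\<phi> i G = 0" if "i \<in> {1..d}" "\<phi> i f \<noteq> 0" for i
    using phi_g[OF that(1)] that by (simp add: phi_simps)
  define e0 where "e0 = Max {a. a \<le> A \<and> c (a, k0) \<noteq> 0}"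
  have fin: "finite {a. a \<le> A \<and> c (a, k0) \<noteq> 0}"
    by simp
  have e0: "e0 \<le> A" "c (e0, k0) \<noteq> 0"
    using Max_in[OF fin] k0 by (auto simp: e0_def)
  have above: "c (a, k0) = 0" if "a \<le> A" "e0 < a" for a
  proof (rule ccontr)
    assume "c (a, k0) \<noteq> 0"
    then have "a \<le> e0"
      unfolding e0_def using fin that(1) by (intro Max_ge) simp_all
    then show False using that(2) by simp
  qed
  have pole_q: "pole_le (int (2 * e0)) (\<phi> i (q k0)) \<and> \<phi> i (q k0) $$ (- int (2 * e0)) \<noteq> 0"
    if i: "i \<in> {1..d}" for i
  proof -
    define L where "L = \<phi> i l"
    have L: "L \<noteq> 0" "fls_subdegree L = - 2"
      using pole_l[OF i] by (simp_all add: L_def)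
    have La: "fls_subdegree (L ^ a) = - (2 * int a)" for a
      using L by (simp add: fls_subdegree_pow)
    have "\<phi> i (q k0) = (\<Sum>a\<le>A. fls_const (c (a, k0)) * L ^ a)"
      using i by (simp add: q_def phi_simps phi_const L_def)
    then have nth: "\<phi> i (q k0) $$ k = (\<Sum>a\<le>A. c (a, k0) * L ^ a $$ k)" for k
      by (simp add: fls_nth_sum)
    have zero: "c (a, k0) * L ^ a $$ k = 0" if "a \<le> A" "a \<noteq> e0" "k \<le> - int (2 * e0)" for a k
    proof (cases "a < e0")
      case True
      then have "k < fls_subdegree (L ^ a)"
        using that by (simp add: La)
      then show ?thesis by simp
    next
      case False
      then show ?thesis using above[of a] that by simp
    qed
    have "\<phi> i (q k0) $$ k = c (e0, k0) * L ^ e0 $$ k" if "k \<le> - int (2 * e0)" for k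
    proof -
      have "\<phi> i (q k0) $$ k = (\<Sum>a\<le>A. if a = e0 then c (e0, k0) * L ^ e0 $$ k else 0)"
        unfolding nth using zero that by (intro sum.cong) auto
      then show ?thesis using e0 by simp
    qed
    moreover have "L ^ e0 $$ (- int (2 * e0)) \<noteq> 0"
      using nth_fls_subdegree_nonzero[of "L ^ e0"] L by (simp add: La)
    moreover have "L ^ e0 $$ k = 0" if "k < - int (2 * e0)" for k
      using that by (intro fls_eq0_below_subdegree) (simp add: La)
    ultimately show ?thesis
      using e0 by (simp add: pole_le_def)
  qed
  show ?thesis
  proof (rule that[of G "2 * e0"])
    show "deg_le (separation_bound m) G"
      using degG by (simp add: N)
    show "2 * e0 \<le> separation_bound m"
      using e0(1) by (simp add: N[symmetric] N_def)
    show "\<phi> i G = 0 \<and> fls_subdegree (\<phi> i f) \<le> int (separation_bound m)" if i: "i \<in> {1..d}" and nf: "\<phi> i f \<noteq> 0" for i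
    proof
      show "\<phi> i G = 0" using phi_G[OF i nf] .
      then have eq: "\<phi> i f * \<phi> i R = - \<phi> i (q k0)"
        using i by (simp add: G_def phi_simps add_eq_0_iff)
      have nq: "\<phi> i (q k0) \<noteq> 0"
        using pole_q[OF i] by auto
      then have nR: "\<phi> i R \<noteq> 0"
        using eq by auto
      have "fls_subdegree (\<phi> i f) + fls_subdegree (\<phi> i R) = fls_subdegree (\<phi> i (q k0))"
        using arg_cong[OF eq, of fls_subdegree] nf nR by simp
      moreover have "fls_subdegree (\<phi> i (q k0)) \<le> - int (2 * e0)"
        using pole_q[OF i] by (intro fls_subdegree_leI) simp
      moreover have "- int N \<le> fls_subdegree (\<phi> i R)"
        using phi_pole_le[OF i degR] nR by (simp add: pole_le_subdegree)
      ultimately show "fls_subdegree (\<phi> i f) \<le> int (separation_bound m)"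
        by (simp add: N)
    qed
    show "pole_le (int (2 * e0)) (\<phi> i G) \<and> \<phi> i G $$ (- int (2 * e0)) \<noteq> 0"
      if i: "i \<in> {1..d}" and zf: "\<phi> i f = 0" for i
      using pole_q[OF i] zf i by (simp add: G_def phi_simps)
  qed
qed

text \<open>
  On the branches where \<open>f\<close> vanishes, \<open>G\<close> has a pole of controlled order, and it vanishes on the
  others. So multiples of \<open>G\<close> serve to lower the pole orders of \<open>a\<close> on the former branches without
  changing \<open>a\<close> on the latter.
\<close>

lemma bounded_representative:
  assumes f: "deg_le m f" and k: "separation_bound m + d \<le> k"
    and a: "deg_le n a" and pole: "\<And>i. i \<in> {1..d} \<Longrightarrow> \<phi> i f \<noteq> 0 \<Longrightarrow> pole_le (int k) (\<phi> i a)"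
  shows "\<exists>a'. deg_le k a' \<and> (\<forall>i\<in>{1..d}. \<phi> i f \<noteq> 0 \<longrightarrow> \<phi> i a' = \<phi> i a)"
proof -
  obtain G e where G: "deg_le (separation_bound m) G" and e: "e \<le> separation_bound m"
    and G0: "\<And>i. i \<in> {1..d} \<Longrightarrow> \<phi> i f \<noteq> 0 \<Longrightarrow> \<phi> i G = 0"
    and Ge: "\<And>i. i \<in> {1..d} \<Longrightarrow> \<phi> i f = 0 \<Longrightarrow> pole_le (int e) (\<phi> i G) \<and> \<phi> i G $$ (- int e) \<noteq> 0"
    using separating_polynomial[OF f] by metis
  show ?thesis
    using a pole
  proof (induction n arbitrary: a)
    case 0
    then show ?case by (intro exI[of _ a]) (auto intro: deg_lt_mono)
  next
    case (Suc n)
    show ?case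
    proof (cases "Suc n \<le> k")
      case True
      then show ?thesis
        using Suc.prems(1) by (intro exI[of _ a]) (auto intro: deg_lt_mono)
    next
      case False
      define N where "N = Suc n"
      have N: "N - e \<ge> d" "e \<le> N"
        using False k e by (auto simp: N_def)
      obtain h where h: "deg_le (N - e) h"
        "\<And>i. i \<in> {1..d} \<Longrightarrow> \<phi> i h $$ (- int (N - e)) = \<phi> i a $$ (- int N) / \<phi> i G $$ (- int e)"
        using interpolate_top_coeffs[OF N(1), of "\<lambda>i. \<phi> i a $$ (- int N) / \<phi> i G $$ (- int e)"] by blast
      define a1 where "a1 = a - h * G"
      have same: "\<phi> i a1 = \<phi> i a" if "i \<in> {1..d}" "\<phi> i f \<noteq> 0" for i
        using that G0[OF that] by (simp add: a1_def phi_simps)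
      have "pole_le (int N - 1) (\<phi> i a1)" if i: "i \<in> {1..d}" for i
      proof (cases "\<phi> i f = 0")
        case True
        have sum: "int N = int (N - e) + int e"
          using N by simp
        note hG = pole_le_mult[OF phi_pole_le[OF i h(1)] conjunct1[OF Ge[OF i True]]]
        have "pole_le (int N) (\<phi> i h * \<phi> i G)"
          unfolding sum by (rule hG(1))
        moreover have "(\<phi> i h * \<phi> i G) $$ (- int N) = \<phi> i a $$ (- int N)"
        proof -
          have "(\<phi> i h * \<phi> i G) $$ (- int N) = \<phi> i h $$ (- int (N - e)) * \<phi> i G $$ (- int e)"
            unfolding sum by (rule hG(2))
          then show ?thesis
            using h(2)[OF i] Ge[OF i True] by simp
        qed
        moreover have "pole_le (int N) (\<phi> i a)"
          using phi_pole_le[OF i Suc.prems(1)] by (simp add: N_def)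
        ultimately show ?thesis
          using i by (intro pole_le_pred) (simp_all add: a1_def phi_simps pole_le_diff)
      next
        case nf: False
        then have "pole_le (int k) (\<phi> i a1)"
          using Suc.prems(2)[OF i nf] same[OF i nf] by simp
        then show ?thesis
          by (rule pole_le_mono) (use False in \<open>simp add: N_def\<close>)
      qed
      moreover have "deg_le (max N (N - e + separation_bound m)) a1"
        unfolding a1_def
        by (intro deg_lt_diff deg_lt_mono[OF Suc.prems(1)] deg_lt_mono[OF deg_le_mult[OF h(1) G]]) (auto simp: N_def)
      ultimately obtain h' where h': "deg_lt N (a1 - h' * p)"
        using reduce_degree by blast
      have same': "\<phi> i (a1 - h' * p) = \<phi> i a" if "i \<in> {1..d}" "\<phi> i f \<noteq> 0" for i
        using same[OF that] that by (simp add: phi_simps phi_p)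
      have "deg_le n (a1 - h' * p)"
        using h' by (simp add: N_def)
      then obtain a' where "deg_le k a'" "\<forall>i\<in>{1..d}. \<phi> i f \<noteq> 0 \<longrightarrow> \<phi> i a' = \<phi> i (a1 - h' * p)"
        using Suc.IH[of "a1 - h' * p"] Suc.prems(2) same' by metis
      then show ?thesis
        using same' by auto
    qed
  qed
qed

end

section \<open>Compactness in spaces of polynomials of bounded degree\<close>

definition exponents :: "nat \<Rightarrow> (nat \<times> nat) set" where
  "exponents N = {u. fst u + snd u \<le> N}"

definition mono2 :: "nat \<times> nat \<Rightarrow> poly2" where
  "mono2 u = varX ^ fst u * varY ^ snd u"

definition poly_of :: "nat \<Rightarrow> (nat \<times> nat \<Rightarrow> real) \<Rightarrow> poly2" where
  "poly_of N c = (\<Sum>u\<in>exponents N. const2 (c u) * mono2 u)"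

abbreviation coeff_at :: "poly2 \<Rightarrow> nat \<times> nat \<Rightarrow> real" where
  "coeff_at a u \<equiv> coeff2 a (fst u) (snd u)"

lemma finite_exponents [simp]: "finite (exponents N)"
  by (rule finite_subset[of _ "{..N} \<times> {..N}"]) (auto simp: exponents_def)

lemma coeff2_poly_of: "coeff2 (poly_of N c) i j = (if i + j \<le> N then c (i, j) else 0)"
proof -
  have "coeff2 (poly_of N c) i j = (\<Sum>u\<in>exponents N. if u = (i, j) then c (i, j) else 0)"
    unfolding poly_of_def mono2_def coeff_sum mult.assoc[symmetric] coeff2_monomial
    by (intro sum.cong) auto
  also have "\<dots> = (if i + j \<le> N then c (i, j) else 0)"
    by (subst sum.delta[OF finite_exponents]) (simp add: exponents_def)
  finally show ?thesis .
qed

lemma deg_le_poly_of: "deg_le N (poly_of N c)"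
  by (simp add: deg_lt_def coeff2_poly_of)

lemma poly_of_coeff_at:
  assumes "deg_le N a"
  shows "poly_of N (coeff_at a) = a"
  using assms by (intro poly2_eqI) (auto simp: coeff2_poly_of deg_lt_def)

lemma ring_map_poly_of:
  assumes "ring_map f"
  shows "f (poly_of N c) = (\<Sum>u\<in>exponents N. f (const2 (c u)) * f (mono2 u))"
  by (simp add: poly_of_def ring_mapD[OF assms])

lemma eval2_poly_of: "eval2 (poly_of N c) z = (\<Sum>u\<in>exponents N. c u * eval2 (mono2 u) z)"
  by (simp add: poly_of_def)

definition poly_tendsto :: "(nat \<Rightarrow> poly2) \<Rightarrow> poly2 \<Rightarrow> bool" where
  "poly_tendsto P a \<longleftrightarrow> (\<forall>i j. (\<lambda>n. coeff2 (P n) i j) \<longlonglongrightarrow> coeff2 a i j)"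

lemma poly_tendsto_const: "poly_tendsto (\<lambda>_. a) a"
  by (simp add: poly_tendsto_def)

lemma poly_tendsto_add: "poly_tendsto P a \<Longrightarrow> poly_tendsto Q b \<Longrightarrow> poly_tendsto (\<lambda>n. P n + Q n) (a + b)"
  by (simp add: poly_tendsto_def tendsto_add)

lemma poly_tendsto_diff: "poly_tendsto P a \<Longrightarrow> poly_tendsto Q b \<Longrightarrow> poly_tendsto (\<lambda>n. P n - Q n) (a - b)"
  by (simp add: poly_tendsto_def tendsto_diff)

lemma poly_tendsto_mult: "poly_tendsto P a \<Longrightarrow> poly_tendsto Q b \<Longrightarrow> poly_tendsto (\<lambda>n. P n * Q n) (a * b)"
  unfolding poly_tendsto_def coeff2_mult by (intro allI tendsto_sum tendsto_mult) blast+

lemma poly_tendsto_sum: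
  "(\<And>x. x \<in> A \<Longrightarrow> poly_tendsto (P x) (a x)) \<Longrightarrow> poly_tendsto (\<lambda>n. \<Sum>x\<in>A. P x n) (\<Sum>x\<in>A. a x)"
  by (induction A rule: infinite_finite_induct) (simp_all add: poly_tendsto_const poly_tendsto_add)

lemma poly_tendsto_subseq: "poly_tendsto P a \<Longrightarrow> strict_mono \<sigma> \<Longrightarrow> poly_tendsto (\<lambda>n. P (\<sigma> n)) a"
  unfolding poly_tendsto_def using LIMSEQ_subseq_LIMSEQ by (fastforce simp: o_def)

lemma poly_tendsto_poly_of:
  assumes "\<And>u. u \<in> exponents N \<Longrightarrow> (\<lambda>n. c n u) \<longlonglongrightarrow> e u"
  shows "poly_tendsto (\<lambda>n. poly_of N (c n)) (poly_of N e)"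
  using assms by (simp add: poly_tendsto_def coeff2_poly_of exponents_def)

lemma poly_tendsto_deg_le:
  assumes "poly_tendsto P a" "\<And>n. deg_le N (P n)"
  shows "deg_le N a"
proof -
  have "coeff2 a i j = 0" if "Suc N \<le> i + j" for i j
  proof -
    have "(\<lambda>n. coeff2 (P n) i j) \<longlonglongrightarrow> coeff2 a i j"
      using assms(1) by (simp add: poly_tendsto_def)
    moreover have "coeff2 (P n) i j = 0" for n
      using assms(2)[of n] that by (simp add: deg_lt_def)
    ultimately show ?thesis
      by (simp add: LIMSEQ_const_iff)
  qed
  then show ?thesis by (simp add: deg_lt_def)
qed

lemma bounded_family_subsequence:
  fixes x :: "nat \<Rightarrow> 'i \<Rightarrow> real"
  assumes "finite I" "\<And>n i. i \<in> I \<Longrightarrow> \<bar>x n i\<bar> \<le> K"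
  obtains \<sigma> l where "strict_mono (\<sigma> :: nat \<Rightarrow> nat)" "\<And>i. i \<in> I \<Longrightarrow> (\<lambda>n. x (\<sigma> n) i) \<longlonglongrightarrow> l i"
proof -
  have "\<exists>\<sigma> l. strict_mono (\<sigma> :: nat \<Rightarrow> nat) \<and> (\<forall>i\<in>I. (\<lambda>n. x (\<sigma> n) i) \<longlonglongrightarrow> l i)"
    using assms
  proof (induction I rule: finite_induct)
    case empty
    then show ?case by (intro exI[of _ "\<lambda>n. n"]) (simp add: strict_mono_def)
  next
    case (insert i I)
    then obtain \<sigma> l where \<sigma>: "strict_mono (\<sigma> :: nat \<Rightarrow> nat)" "\<forall>i\<in>I. (\<lambda>n. x (\<sigma> n) i) \<longlonglongrightarrow> l i"
      by auto
    have "bounded (range (\<lambda>n. x (\<sigma> n) i))"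
      unfolding bounded_iff using insert.prems[of i] by auto
    then obtain m \<rho> where \<rho>: "strict_mono \<rho>" "((\<lambda>n. x (\<sigma> n) i) \<circ> \<rho>) \<longlonglongrightarrow> m"
      using bounded_imp_convergent_subsequence by blast
    have "(\<lambda>n. x (\<sigma> (\<rho> n)) k) \<longlonglongrightarrow> (l(i := m)) k" if "k \<in> insert i I" for k
    proof (cases "k = i")
      case True
      then show ?thesis using \<rho>(2) by (simp add: o_def)
    next
      case False
      then have "(\<lambda>n. x (\<sigma> n) k) \<longlonglongrightarrow> l k"
        using that \<sigma>(2) by blast
      from LIMSEQ_subseq_LIMSEQ[OF this \<rho>(1)] show ?thesis
        using False by (simp add: o_def)
    qed
    moreover have "strict_mono (\<lambda>n. \<sigma> (\<rho> n))"
      using strict_mono_o[OF \<sigma>(1) \<rho>(1)] by (simp add: o_def)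
    ultimately show ?case by blast
  qed
  then show ?thesis using that by blast
qed

text \<open>
  Caratheodory's theorem for cones: as long as there are more vectors than coordinates, the weights can
  be moved along a linear relation between the vectors until one of them vanishes.
\<close>

lemma conic_caratheodory:
  fixes v :: "'l \<Rightarrow> 'i \<Rightarrow> real"
  assumes "finite I" "finite F" "\<And>l. l \<in> F \<Longrightarrow> w l \<ge> 0"
  shows "\<exists>T w'. T \<subseteq> F \<and> card T \<le> card I \<and> (\<forall>l\<in>T. w' l \<ge> 0) \<and>
    (\<forall>i\<in>I. (\<Sum>l\<in>T. w' l * v l i) = (\<Sum>l\<in>F. w l * v l i))"
  using assms(2,3)
proof (induction "card F" arbitrary: F w rule: less_induct)
  case less
  show ?case
  proof (cases "card F \<le> card I")
    case True
    then show ?thesis using less.prems by (intro exI[of _ F] exI[of _ w]) simp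
  next
    case False
    then have "card I < card F" by simp
    from homogeneous_system_nontrivial[OF assms(1) less.prems(1) this, of "\<lambda>i l. v l i"]
    obtain c where c: "\<exists>l\<in>F. c l \<noteq> 0" "\<forall>i\<in>I. (\<Sum>l\<in>F. c l * v l i) = 0"
      by blast
    obtain e where e: "\<exists>l\<in>F. e l > 0" "\<forall>i\<in>I. (\<Sum>l\<in>F. e l * v l i) = 0"
    proof (cases "\<exists>l\<in>F. c l > 0")
      case True
      then show ?thesis using that[of c] c(2) by blast
    next
      case False
      then show ?thesis using that[of "\<lambda>l. - c l"] c by (force simp: sum_negf)
    qed
    define Q where "Q = {l \<in> F. e l > 0}"
    have Q: "finite Q" "Q \<noteq> {}"
      using e(1) less.prems(1) by (auto simp: Q_def)
    define m where "m = arg_min_on (\<lambda>l. w l / e l) Q"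
    have m: "m \<in> Q" "w m / e m \<le> w l / e l" if "l \<in> Q" for l
      using arg_min_if_finite[OF Q, of "\<lambda>l. w l / e l"] that unfolding m_def by (auto simp: not_less)
    define \<theta> where "\<theta> = w m / e m"
    define u where "u l = w l - \<theta> * e l" for l
    have mF: "m \<in> F" "e m > 0"
      using m(1) Q(2) by (auto simp: Q_def)
    then have um: "u m = 0" and \<theta>: "\<theta> \<ge> 0"
      using less.prems(2)[of m] by (simp_all add: u_def \<theta>_def)
    have "u l \<ge> 0" if "l \<in> F" for l
    proof (cases "e l > 0")
      case True
      then have "\<theta> \<le> w l / e l"
        unfolding \<theta>_def using that by (intro m(2)) (simp add: Q_def)
      then show ?thesis using True by (simp add: u_def pos_le_divide_eq)
    next
      case False
      then have "\<theta> * e l \<le> 0"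
        using \<theta> by (simp add: mult_nonneg_nonpos)
      then show ?thesis using less.prems(2)[OF that] by (simp add: u_def)
    qed
    moreover have "card (F - {m}) < card F"
      using mF less.prems(1) by (intro psubset_card_mono) auto
    ultimately obtain T w' where T: "T \<subseteq> F - {m}" "card T \<le> card I" "\<forall>l\<in>T. w' l \<ge> 0"
      "\<forall>i\<in>I. (\<Sum>l\<in>T. w' l * v l i) = (\<Sum>l\<in>F - {m}. u l * v l i)"
      using less.hyps[of "F - {m}" u] less.prems(1) by auto
    have "(\<Sum>l\<in>F - {m}. u l * v l i) = (\<Sum>l\<in>F. w l * v l i)" if "i \<in> I" for i
    proof -
      have "(\<Sum>l\<in>F - {m}. u l * v l i) = (\<Sum>l\<in>F. u l * v l i)"
        using mF um less.prems(1) by (subst sum.remove[of F m]) auto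
      also have "\<dots> = (\<Sum>l\<in>F. w l * v l i) - \<theta> * (\<Sum>l\<in>F. e l * v l i)"
        by (simp add: u_def left_diff_distrib sum_subtractf sum_distrib_left mult.assoc)
      finally show ?thesis using e(2) that by simp
    qed
    then have "\<forall>i\<in>I. (\<Sum>l\<in>T. w' l * v l i) = (\<Sum>l\<in>F. w l * v l i)"
      using T(4) by simp
    moreover have "T \<subseteq> F"
      using T(1) by blast
    ultimately show ?thesis
      using T(2,3) by (intro exI[of _ T] exI[of _ w'] conjI)
  qed
qed

text \<open>
  Choose a biorthogonal system of maximal length between the functionals and the vectors. By maximality,
  all functionals vanish on the common kernel of those in the system. So a vector may be replaced by the
  combination of the vectors in the system that has the same values, which has small coefficients.
\<close>

lemma functionals_control_coefficients:
  fixes L :: "'l \<Rightarrow> 'i \<Rightarrow> real"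
  assumes I: "finite I"
  defines "ap \<equiv> \<lambda>l a. \<Sum>i\<in>I. L l i * a i"
  obtains K where "\<And>a. (\<And>l. l \<in> \<Lambda> \<Longrightarrow> \<bar>ap l a\<bar> \<le> 1) \<Longrightarrow>
      \<exists>a'. (\<forall>l\<in>\<Lambda>. ap l a' = ap l a) \<and> (\<forall>i\<in>I. \<bar>a' i\<bar> \<le> K)"
proof -
  define bio where "bio m \<longleftrightarrow> (\<exists>ls e. \<forall>j<m. ls j \<in> \<Lambda> \<and>
      (\<forall>k<m. ap (ls j) (e k) = (if j = k then 1 else 0)))" for m :: nat
  have lin: "ap l (\<lambda>i. x i - t * y i) = ap l x - t * ap l y" for l x y t
    by (simp add: ap_def right_diff_distrib sum_subtractf sum_distrib_left mult_ac)
  have lin_sum: "ap l (\<lambda>i. \<Sum>k\<in>A. t k * e k i) = (\<Sum>k\<in>A. t k * ap l (e k))" for l t e and A :: "nat set"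
    unfolding ap_def sum_distrib_left by (subst sum.swap) (simp add: mult_ac)
  have bound: "m \<le> card I" if bio: "bio m" for m
  proof (rule ccontr)
    assume "\<not> m \<le> card I"
    then have "card I < card {..<m}" by simp
    obtain ls e where le: "\<And>j k. j < m \<Longrightarrow> k < m \<Longrightarrow> ap (ls j) (e k) = (if j = k then 1 else 0)"
      using bio unfolding bio_def by blast
    from homogeneous_system_nontrivial[OF I _ \<open>card I < card {..<m}\<close>, of "\<lambda>i k. e k i"]
    obtain c where c: "\<exists>k\<in>{..<m}. c k \<noteq> 0" "\<forall>i\<in>I. (\<Sum>k\<in>{..<m}. c k * e k i) = 0"
      by blast
    have "c j = 0" if "j < m" for j
    proof -
      have "(\<Sum>k\<in>{..<m}. c k * ap (ls j) (e k)) = (\<Sum>k\<in>{..<m}. if k = j then c j else 0)"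
        using le[OF that] by (intro sum.cong) auto
      then have "c j = ap (ls j) (\<lambda>i. \<Sum>k\<in>{..<m}. c k * e k i)"
        unfolding lin_sum using that by simp
      also have "\<dots> = 0"
        unfolding ap_def using c(2) by simp
      finally show ?thesis .
    qed
    then show False using c(1) by blast
  qed
  have "bio 0"
    by (simp add: bio_def)
  define m where "m = Greatest bio"
  have m: "bio m" "bio k \<Longrightarrow> k \<le> m" for k
    unfolding m_def
    using GreatestI_nat[where P = bio, OF \<open>bio 0\<close> bound] Greatest_le_nat[where P = bio, OF _ bound]
    by blast+
  obtain ls e where ls: "\<And>j. j < m \<Longrightarrow> ls j \<in> \<Lambda>"
    and le: "\<And>j k. j < m \<Longrightarrow> k < m \<Longrightarrow> ap (ls j) (e k) = (if j = k then 1 else 0)"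
    using m(1) unfolding bio_def by blast
  have kernel: "ap l a = 0" if l: "l \<in> \<Lambda>" and a: "\<And>j. j < m \<Longrightarrow> ap (ls j) a = 0" for l a
  proof (rule ccontr)
    assume nz: "ap l a \<noteq> 0"
    define x where "x i = a i / ap l a" for i
    have x: "ap l x = 1" "\<And>j. j < m \<Longrightarrow> ap (ls j) x = 0"
      using nz a by (simp_all add: ap_def x_def sum_divide_distrib[symmetric])
    define e' where "e' k = (if k = m then x else (\<lambda>i. e k i - ap l (e k) * x i))" for k
    define ls' where "ls' j = (if j = m then l else ls j)" for j
    have "ap (ls' j) (e' k) = (if j = k then 1 else 0)" if "j < Suc m" "k < Suc m" for j k
      using that le[of j k] x by (auto simp: ls'_def e'_def lin less_Suc_eq)
    moreover have "ls' j \<in> \<Lambda>" if "j < Suc m" for j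
      using that l ls by (auto simp: ls'_def less_Suc_eq)
    ultimately have "bio (Suc m)"
      unfolding bio_def by blast
    then show False using m(2) by force
  qed
  define K where "K = (\<Sum>i\<in>I. \<Sum>k<m. \<bar>e k i\<bar>)"
  have "\<exists>a'. (\<forall>l\<in>\<Lambda>. ap l a' = ap l a) \<and> (\<forall>i\<in>I. \<bar>a' i\<bar> \<le> K)"
    if a: "\<And>l. l \<in> \<Lambda> \<Longrightarrow> \<bar>ap l a\<bar> \<le> 1" for a
  proof -
    define a' where "a' i = (\<Sum>k<m. ap (ls k) a * e k i)" for i
    have "ap (ls j) a' = ap (ls j) a" if "j < m" for j
    proof -
      have "(\<Sum>k<m. ap (ls k) a * ap (ls j) (e k)) = (\<Sum>k<m. if k = j then ap (ls j) a else 0)"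
        using le[OF that] by (intro sum.cong) auto
      then show ?thesis
        unfolding a'_def lin_sum using that by simp
    qed
    then have zero: "ap (ls j) (\<lambda>i. a i - 1 * a' i) = 0" if "j < m" for j
      unfolding lin using that by simp
    have "ap l (\<lambda>i. a i - 1 * a' i) = 0" if "l \<in> \<Lambda>" for l
      using that zero by (rule kernel)
    then have "\<forall>l\<in>\<Lambda>. ap l a' = ap l a"
      unfolding lin by simp
    moreover have "\<bar>a' i\<bar> \<le> K" if "i \<in> I" for i
    proof -
      have "\<bar>a' i\<bar> \<le> (\<Sum>k<m. \<bar>ap (ls k) a * e k i\<bar>)"
        unfolding a'_def by (rule sum_abs)
      also have "\<dots> \<le> (\<Sum>k<m. 1 * \<bar>e k i\<bar>)"
        unfolding abs_mult using a ls by (intro sum_mono mult_right_mono) auto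
      also have "\<dots> \<le> K"
        unfolding K_def mult_1
        by (rule member_le_sum[OF that _ I]) (simp add: sum_nonneg)
      finally show ?thesis .
    qed
    ultimately show ?thesis by blast
  qed
  then show ?thesis using that by blast
qed

text \<open>
  By Caratheodory's theorem in the space of polynomials of degree \<open>2 D\<close> a weighted sum of few of the given
  squares is enough, and the nonnegative weights are squares themselves.
\<close>

lemma sum_of_squares_few:
  assumes F: "finite F" and deg: "\<And>l. l \<in> F \<Longrightarrow> deg_le D (a l)"
  obtains e where "\<And>k. deg_le D (e k)"
    "(\<Sum>l\<in>F. (a l)\<^sup>2) = (\<Sum>k<card (exponents (2 * D)). (e k)\<^sup>2)"
proof -
  let ?n = "card (exponents (2 * D))"
  have deg2: "deg_le (2 * D) ((a l)\<^sup>2)" if "l \<in> F" for l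
    using deg_le_power[OF deg[OF that], of 2] by simp
  obtain T w where T: "T \<subseteq> F" "card T \<le> ?n" "\<forall>l\<in>T. w l \<ge> 0"
    "\<forall>u\<in>exponents (2 * D). (\<Sum>l\<in>T. w l * coeff_at ((a l)\<^sup>2) u) = (\<Sum>l\<in>F. 1 * coeff_at ((a l)\<^sup>2) u)"
    using conic_caratheodory[OF finite_exponents F, of "\<lambda>_. 1" "2 * D" "\<lambda>l. coeff_at ((a l)\<^sup>2)"] by auto
  have eq: "(\<Sum>l\<in>F. (a l)\<^sup>2) = (\<Sum>l\<in>T. const2 (w l) * (a l)\<^sup>2)"
  proof (rule poly2_eqI)
    fix i j
    show "coeff2 (\<Sum>l\<in>F. (a l)\<^sup>2) i j = coeff2 (\<Sum>l\<in>T. const2 (w l) * (a l)\<^sup>2) i j"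
    proof (cases "i + j \<le> 2 * D")
      case True
      then show ?thesis
        using bspec[OF T(4), of "(i, j)"] by (simp add: coeff_sum exponents_def)
    next
      case False
      have "coeff2 ((a l)\<^sup>2) i j = 0" if "l \<in> F" for l
        using deg2[OF that] False by (simp add: deg_lt_def)
      then show ?thesis
        using T(1) by (auto simp: coeff_sum intro!: sum.neutral simp: subset_iff)
    qed
  qed
  have finT: "finite T"
    using T(1) F finite_subset by blast
  then obtain f where f: "bij_betw f {..<card T} T"
    using ex_bij_betw_nat_finite by (metis atLeast0LessThan)
  define e where "e k = (if k < card T then const2 (sqrt (w (f k))) * a (f k) else 0)" for k
  have fT: "f k \<in> T" if "k < card T" for k
    using f that by (auto simp: bij_betw_def)
  have "deg_le D (e k)" for k
    using fT T(1) deg by (auto simp: e_def intro!: deg_lt_const2_mult)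
  moreover have "(\<Sum>l\<in>F. (a l)\<^sup>2) = (\<Sum>k<?n. (e k)\<^sup>2)"
  proof -
    have "(\<Sum>l\<in>T. const2 (w l) * (a l)\<^sup>2) = (\<Sum>k<card T. const2 (w (f k)) * (a (f k))\<^sup>2)"
      using sum.reindex_bij_betw[OF f, of "\<lambda>l. const2 (w l) * (a l)\<^sup>2"] by simp
    also have "\<dots> = (\<Sum>k<card T. (e k)\<^sup>2)"
    proof (intro sum.cong refl)
      fix k
      assume "k \<in> {..<card T}"
      then have k: "k < card T" by simp
      then have "const2 (w (f k)) = (const2 (sqrt (w (f k))))\<^sup>2"
        using T(3) fT by (simp flip: const2_simps)
      then show "const2 (w (f k)) * (a (f k))\<^sup>2 = (e k)\<^sup>2"
        using k by (simp add: e_def power_mult_distrib)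
    qed
    also have "\<dots> = (\<Sum>k<?n. (e k)\<^sup>2)"
      using T(2) by (intro sum.mono_neutral_left) (auto simp: e_def)
    finally show ?thesis by (simp add: eq)
  qed
  ultimately show ?thesis using that by blast
qed

section \<open>Quadratic modules on a curve\<close>

lemma sums_of_squares_finite:
  fixes \<sigma> :: poly2
  assumes "\<sigma> \<in> sums_of_squares"
  obtains n a where "\<sigma> = (\<Sum>l<(n::nat). (a l)\<^sup>2)"
proof -
  obtain as where "\<sigma> = (\<Sum>a\<leftarrow>as. a\<^sup>2)"
    using assms by (auto simp: sums_of_squares_def)
  then have "\<sigma> = (\<Sum>l<length as. (as ! l)\<^sup>2)"
    by (simp add: sum_list_sum_nth atLeast0LessThan)
  then show ?thesis by (rule that)
qed

lemma sums_of_squares_sum: "(\<Sum>l<(n::nat). (a l)\<^sup>2) \<in> sums_of_squares"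
  unfolding sums_of_squares_def
  by (auto intro!: exI[of _ "map a [0..<n]"] simp: sum_list_sum_nth atLeast0LessThan)

lemma abs_eval2_le:
  assumes "deg_le N a" "\<And>u. u \<in> exponents N \<Longrightarrow> \<bar>coeff_at a u\<bar> \<le> K"
  shows "\<bar>eval2 a z\<bar> \<le> K * (\<Sum>u\<in>exponents N. \<bar>eval2 (mono2 u) z\<bar>)"
proof -
  have "\<bar>eval2 a z\<bar> = \<bar>\<Sum>u\<in>exponents N. coeff_at a u * eval2 (mono2 u) z\<bar>"
    by (subst poly_of_coeff_at[OF assms(1), symmetric]) (simp only: eval2_poly_of)
  also have "\<dots> \<le> (\<Sum>u\<in>exponents N. \<bar>coeff_at a u * eval2 (mono2 u) z\<bar>)"
    by (rule sum_abs)
  also have "\<dots> \<le> (\<Sum>u\<in>exponents N. K * \<bar>eval2 (mono2 u) z\<bar>)"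
    unfolding abs_mult by (intro sum_mono mult_right_mono assms(2)) simp_all
  finally show ?thesis by (simp add: sum_distrib_left)
qed

text \<open>
  In the application, \<open>Z\<close> is the set of those points of the nonnegativity set of \<open>M\<close> that lie on the curve,
  and the \<open>g j\<close> are the generators of \<open>M\<close>. For each point at infinity there is a sequence in \<open>Z\<close> tending to it.
\<close>

locale curve_module = branches +
  fixes Z :: "(real \<times> real) set" and q :: nat and g :: "nat \<Rightarrow> poly2" and m :: nat
  assumes Z: "\<And>z. z \<in> Z \<Longrightarrow> eval2 p z = 0"
    and approach: "\<And>i. i \<in> {1..d} \<Longrightarrow> \<exists>z \<tau>. (\<forall>n. z n \<in> Z) \<and> \<tau> \<longlonglongrightarrow> 0 \<and>
      (\<forall>n. \<tau> n \<noteq> 0 \<and> \<bar>\<tau> n\<bar> \<le> 1) \<and> (\<forall>a. laurent_approx \<tau> (\<phi> i a) (\<lambda>n. eval2 a (z n)))"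
    and deg_g: "\<And>j. j \<le> q \<Longrightarrow> deg_le m (g j)"
    and g_nonneg: "\<And>j z. j \<le> q \<Longrightarrow> z \<in> Z \<Longrightarrow> eval2 (g j) z \<ge> 0"
begin

definition cone :: "poly2 set" where
  "cone = {(\<Sum>j\<le>q. \<sigma> j * g j) + h * p | \<sigma> h. \<forall>j\<le>q. \<sigma> j \<in> sums_of_squares}"

lemma zero_on_Z_imp_zero_on_branches:
  assumes i: "i \<in> {1..d}" and zero: "\<And>z. z \<in> Z \<Longrightarrow> eval2 a z = 0"
  shows "\<phi> i a = 0"
proof (rule ccontr)
  assume nz: "\<phi> i a \<noteq> 0"
  obtain z \<tau> where z: "\<And>n. z n \<in> Z" "\<tau> \<longlonglongrightarrow> 0" "\<And>n. \<tau> n \<noteq> 0"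
    "laurent_approx \<tau> (\<phi> i a) (\<lambda>n. eval2 a (z n))"
    using approach[OF i] by blast
  obtain c where c: "c \<noteq> 0" "(\<lambda>n. eval2 a (z n) * \<tau> n powi (- fls_subdegree (\<phi> i a))) \<longlonglongrightarrow> c"
    using laurent_approx_tendsto[OF z(4) nz z(2,3)] by blast
  from c(2) have "(\<lambda>n. 0) \<longlonglongrightarrow> c"
    by (simp add: zero z(1))
  then show False
    using c(1) by (simp add: LIMSEQ_const_iff)
qed

text \<open>
  There is no cancellation between nonnegative terms: as \<open>a\<^sup>2 f\<close> grows at most like \<open>c\<close> along a sequence
  in \<open>Z\<close>, the pole order of \<open>a\<^sup>2 f\<close> on the branch is at most the degree of \<open>c\<close>. The order of the zero of \<open>f\<close>
  on the branch, by which the pole order of \<open>a\<close> may be larger, is bounded by \<open>separation_bound m\<close>.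
\<close>

lemma dominated_pole_le:
  assumes i: "i \<in> {1..d}" and f: "deg_le m f" "\<phi> i f \<noteq> 0" and c: "deg_le N c"
    and nonneg: "\<And>z. z \<in> Z \<Longrightarrow> eval2 f z \<ge> 0"
    and le: "\<And>z. z \<in> Z \<Longrightarrow> (eval2 a z)\<^sup>2 * eval2 f z \<le> eval2 c z"
  shows "pole_le (int (N + separation_bound m)) (\<phi> i a)"
proof (cases "\<phi> i a = 0")
  case False
  obtain z \<tau> where z: "\<And>n. z n \<in> Z" "\<tau> \<longlonglongrightarrow> 0" "\<And>n. \<tau> n \<noteq> 0" "\<And>n. \<bar>\<tau> n\<bar> \<le> 1"
    and approx: "\<And>a. laurent_approx \<tau> (\<phi> i a) (\<lambda>n. eval2 a (z n))"
    using approach[OF i] by blast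
  define e where "e = fls_subdegree (\<phi> i (a\<^sup>2 * f))"
  have nz: "\<phi> i (a\<^sup>2 * f) \<noteq> 0"
    using f(2) False by (simp add: phi_simps[OF i])
  have e: "e = 2 * fls_subdegree (\<phi> i a) + fls_subdegree (\<phi> i f)"
    using f(2) False by (simp add: e_def phi_simps[OF i] fls_subdegree_pow)
  have "fls_subdegree (\<phi> i f) \<le> int (separation_bound m)"
    using separating_polynomial[OF f(1)] i f(2) by metis
  moreover have "- int N \<le> e"
  proof (rule ccontr)
    assume "\<not> - int N \<le> e"
    define k where "k = nat (- e - int N - 1)"
    have k: "- e = int (N + Suc k)"
      using \<open>\<not> - int N \<le> e\<close> by (simp add: k_def)
    obtain C where C: "C \<noteq> 0" "(\<lambda>n. eval2 (a\<^sup>2 * f) (z n) * \<tau> n powi (- e)) \<longlonglongrightarrow> C"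
      using laurent_approx_tendsto[OF approx nz z(2,3)] unfolding e_def by blast
    obtain F where "fls_X ^ N * \<phi> i c = fps_to_fls F"
      using lead[OF i c] by blast
    then obtain K where K: "\<And>n. \<bar>eval2 c (z n)\<bar> * \<bar>\<tau> n\<bar> ^ N \<le> K"
      using laurent_approx_bounded[OF approx _ z(3,4)] by blast
    have "(\<lambda>n. eval2 (a\<^sup>2 * f) (z n) * \<tau> n powi (- e)) \<longlonglongrightarrow> 0"
    proof (rule Lim_null_comparison)
      show "\<forall>\<^sub>F n in sequentially. norm (eval2 (a\<^sup>2 * f) (z n) * \<tau> n powi (- e)) \<le> K * \<bar>\<tau> n\<bar>"
      proof (intro always_eventually allI)
        fix n
        have "\<bar>eval2 (a\<^sup>2 * f) (z n)\<bar> \<le> \<bar>eval2 c (z n)\<bar>"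
          using le[OF z(1)[of n]] nonneg[OF z(1)[of n]] by (simp add: abs_mult)
        then have "\<bar>eval2 (a\<^sup>2 * f) (z n)\<bar> * \<bar>\<tau> n\<bar> ^ N * \<bar>\<tau> n\<bar> ^ Suc k \<le> K * \<bar>\<tau> n\<bar> ^ Suc k"
          using K[of n] by (intro mult_right_mono order_trans[OF mult_right_mono K]) simp_all
        also have "\<dots> \<le> K * \<bar>\<tau> n\<bar>"
        proof (rule mult_left_mono)
          show "\<bar>\<tau> n\<bar> ^ Suc k \<le> \<bar>\<tau> n\<bar>"
            using power_decreasing[of 1 "Suc k" "\<bar>\<tau> n\<bar>"] z(4)[of n] by simp
          show "0 \<le> K"
            using K[of n] by (rule order_trans[rotated]) simp
        qed
        finally show "norm (eval2 (a\<^sup>2 * f) (z n) * \<tau> n powi (- e)) \<le> K * \<bar>\<tau> n\<bar>"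
          unfolding k power_int_of_nat by (simp only: real_norm_def abs_mult power_abs power_add mult.assoc)
      qed
      show "(\<lambda>n. K * \<bar>\<tau> n\<bar>) \<longlonglongrightarrow> 0"
        using tendsto_mult_right_zero[OF tendsto_rabs_zero[OF z(2)]] by simp
    qed
    then show False
      using C LIMSEQ_unique by blast
  qed
  ultimately show ?thesis
    using False e by (simp add: pole_le_subdegree)
qed simp

definition degree_bound :: "nat \<Rightarrow> nat" where
  "degree_bound N = N + separation_bound m + d"

definition num_squares :: "nat \<Rightarrow> nat" where
  "num_squares N = card (exponents (2 * degree_bound N))"

text \<open>
  On the branches on which \<open>g j\<close> does not vanish, the squares in \<open>\<sigma> j\<close> have bounded pole orders. There they
  agree with polynomials of bounded degree, and on the other branches a change of \<open>\<sigma> j\<close> does not affect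
  \<open>\<sigma> j * g j\<close>. The bound depends on \<open>d\<close>, \<open>m\<close> and \<open>N\<close> only.
\<close>

lemma stable_representation:
  assumes "c \<in> cone" "deg_le N c"
  obtains a h where "\<And>j l. j \<le> q \<Longrightarrow> deg_le (degree_bound N) (a j l)"
    "deg_le (2 * degree_bound N + m) h"
    "c = (\<Sum>j\<le>q. (\<Sum>l<num_squares N. (a j l)\<^sup>2) * g j) + h * p"
proof -
  let ?D = "degree_bound N"
  obtain \<sigma> h0 where c: "c = (\<Sum>j\<le>q. \<sigma> j * g j) + h0 * p" and \<sigma>: "\<And>j. j \<le> q \<Longrightarrow> \<sigma> j \<in> sums_of_squares"
    using assms(1) by (auto simp: cone_def)
  have "\<exists>e. (\<forall>l. deg_le ?D (e l)) \<and>
      (\<forall>i\<in>{1..d}. \<phi> i ((\<Sum>l<num_squares N. (e l)\<^sup>2) * g j) = \<phi> i (\<sigma> j * g j))" if j: "j \<le> q" for j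
  proof -
    obtain n :: nat and b where b: "\<sigma> j = (\<Sum>l<n. (b l)\<^sup>2)"
      by (rule sums_of_squares_finite[OF \<sigma>[OF j]])
    have eval_\<sigma>: "eval2 (\<sigma> k) z \<ge> 0" if "k \<le> q" for k z
      by (rule sums_of_squares_finite[OF \<sigma>[OF that]]) (simp add: sum_nonneg)
    have le: "(eval2 (b l) z)\<^sup>2 * eval2 (g j) z \<le> eval2 c z" if z: "z \<in> Z" and l: "l < n" for l z
    proof -
      have "(eval2 (b l) z)\<^sup>2 \<le> eval2 (\<sigma> j) z"
        unfolding b eval2_simps using l by (intro member_le_sum) auto
      then have "(eval2 (b l) z)\<^sup>2 * eval2 (g j) z \<le> eval2 (\<sigma> j) z * eval2 (g j) z"
        using g_nonneg[OF j z] by (rule mult_right_mono)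
      also have "\<dots> \<le> (\<Sum>k\<le>q. eval2 (\<sigma> k) z * eval2 (g k) z)"
        using j by (intro member_le_sum[where f = "\<lambda>k. eval2 (\<sigma> k) z * eval2 (g k) z"] mult_nonneg_nonneg eval_\<sigma> g_nonneg z) auto
      also have "\<dots> = eval2 c z"
        using Z[OF z] by (simp add: c)
      finally show ?thesis .
    qed
    have "\<exists>b'. deg_le ?D b' \<and> (\<forall>i\<in>{1..d}. \<phi> i (g j) \<noteq> 0 \<longrightarrow> \<phi> i b' = \<phi> i (b l))" if l: "l < n" for l
    proof (rule bounded_representative[OF deg_g[OF j] _ deg_le_tdegree])
      show "separation_bound m + d \<le> ?D"
        by (simp add: degree_bound_def)
      show "pole_le (int ?D) (\<phi> i (b l))" if "i \<in> {1..d}" "\<phi> i (g j) \<noteq> 0" for i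
      proof (rule pole_le_mono)
        show "pole_le (int (N + separation_bound m)) (\<phi> i (b l))"
          using that le l by (intro dominated_pole_le[OF _ deg_g[OF j] _ assms(2) g_nonneg[OF j]])
        show "int (N + separation_bound m) \<le> int ?D"
          by (simp add: degree_bound_def)
      qed
    qed
    then obtain b' where b': "\<And>l. l < n \<Longrightarrow> deg_le ?D (b' l)"
      "\<And>l i. l < n \<Longrightarrow> i \<in> {1..d} \<Longrightarrow> \<phi> i (g j) \<noteq> 0 \<Longrightarrow> \<phi> i (b' l) = \<phi> i (b l)"
      by metis
    obtain e where e: "\<And>k. deg_le ?D (e k)" "(\<Sum>l<n. (b' l)\<^sup>2) = (\<Sum>k<num_squares N. (e k)\<^sup>2)"
      using sum_of_squares_few[of "{..<n}" ?D b'] b'(1) unfolding num_squares_def by auto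
    have "\<phi> i ((\<Sum>l<num_squares N. (e l)\<^sup>2) * g j) = \<phi> i (\<sigma> j * g j)" if i: "i \<in> {1..d}" for i
    proof (cases "\<phi> i (g j) = 0")
      case True
      then show ?thesis by (simp add: phi_simps[OF i])
    next
      case False
      then show ?thesis
        unfolding e(2)[symmetric] b by (simp add: phi_simps[OF i] b'(2)[OF _ i])
    qed
    then show ?thesis using e(1) by blast
  qed
  then obtain a where a: "\<And>j l. j \<le> q \<Longrightarrow> deg_le ?D (a j l)"
    "\<And>j i. j \<le> q \<Longrightarrow> i \<in> {1..d} \<Longrightarrow> \<phi> i ((\<Sum>l<num_squares N. (a j l)\<^sup>2) * g j) = \<phi> i (\<sigma> j * g j)"
    by metis
  define r where "r = c - (\<Sum>j\<le>q. (\<Sum>l<num_squares N. (a j l)\<^sup>2) * g j)"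
  have "deg_le (2 * ?D + m) r"
  proof -
    have "deg_le (2 * ?D) ((a j l)\<^sup>2)" if "j \<le> q" for j l
      using deg_le_power[OF a(1)[OF that], of 2] by simp
    moreover have "N \<le> 2 * ?D + m"
      by (simp add: degree_bound_def)
    ultimately show ?thesis
      unfolding r_def using assms(2) by (intro deg_lt_diff deg_lt_sum deg_le_mult deg_g) (auto intro: deg_lt_mono)
  qed
  moreover have "\<phi> i r = 0" if i: "i \<in> {1..d}" for i
  proof -
    have "\<phi> i (\<Sum>j\<le>q. (\<Sum>l<num_squares N. (a j l)\<^sup>2) * g j) = (\<Sum>j\<le>q. \<phi> i (\<sigma> j * g j))"
      unfolding phi_simps(8)[OF i, where A = "{..q}"] using a(2)[OF _ i] by (intro sum.cong) auto
    then show ?thesis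
      unfolding r_def c by (simp add: phi_simps[OF i] phi_p[OF i])
  qed
  ultimately obtain h where h: "deg_le (2 * ?D + m) h" "r = h * p"
    using multiple_if_zero_on_branches by blast
  show ?thesis
    using that[OF a(1) h(1)] h(2) by (simp add: r_def algebra_simps)
qed

lemma phi_tendsto:
  assumes i: "i \<in> {1..d}" and P: "poly_tendsto P a" "\<And>n. deg_le N (P n)"
  shows "(\<lambda>n. \<phi> i (P n) $$ k) \<longlonglongrightarrow> \<phi> i a $$ k"
proof -
  have phi: "\<phi> i b $$ k = (\<Sum>u\<in>exponents N. coeff_at b u * \<phi> i (mono2 u) $$ k)" if "deg_le N b" for b
    by (subst poly_of_coeff_at[OF that, symmetric])
      (simp only: ring_map_poly_of[OF hom[OF i]] phi_const[OF i] fls_nth_sum fls_mult_const_nth)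
  show ?thesis
    unfolding phi[OF P(2)] phi[OF poly_tendsto_deg_le[OF P]]
    using P(1) by (intro tendsto_intros) (simp add: poly_tendsto_def)
qed

text \<open>
  The squares in a representation of bounded degree can be replaced by polynomials with bounded
  coefficients, because on \<open>Z\<close> they are dominated by the represented polynomial. So a limit of
  represented polynomials is represented by limits.
\<close>

lemma cone_closed:
  assumes P: "\<And>n. P n \<in> cone" "\<And>n. deg_le N (P n)" "poly_tendsto P c"
  shows "c \<in> cone"
proof -
  let ?D = "degree_bound N" and ?n = "num_squares N"
  define rep_by where "rep_by n a h \<longleftrightarrow> (\<forall>j l. j \<le> q \<longrightarrow> deg_le ?D (a j l)) \<and>
      P n = (\<Sum>j\<le>q. (\<Sum>l<?n. (a j l)\<^sup>2) * g j) + h * p" for n a h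
  have "\<exists>a h. rep_by n a h" for n
    unfolding rep_by_def by (rule stable_representation[OF P(1)[of n] P(2)[of n]]) blast
  then obtain a where "\<forall>n. \<exists>h. rep_by n (a n) h"
    using choice[of "\<lambda>n a. \<exists>h. rep_by n a h"] by blast
  then obtain h where "\<forall>n. rep_by n (a n) (h n)"
    using choice[of "\<lambda>n. rep_by n (a n)"] by blast
  then have a: "\<And>n j l. j \<le> q \<Longrightarrow> deg_le ?D (a n j l)"
    and rep: "\<And>n. P n = (\<Sum>j\<le>q. (\<Sum>l<?n. (a n j l)\<^sup>2) * g j) + h n * p"
    by (simp_all add: rep_by_def)
  have "\<exists>K. \<forall>u\<in>exponents N. \<forall>n. \<bar>coeff_at (P n) u\<bar> \<le> K"
  proof -
    have "\<exists>K. \<forall>n. \<bar>coeff_at (P n) u\<bar> \<le> K" for u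
    proof -
      have "Bseq (\<lambda>n. coeff_at (P n) u)"
        using P(3) by (auto simp: poly_tendsto_def intro!: convergent_imp_Bseq convergentI)
      then show ?thesis
        unfolding Bseq_def real_norm_def by blast
    qed
    then obtain B where B: "\<bar>coeff_at (P n) u\<bar> \<le> B u" for u n
      using choice[of "\<lambda>u K. \<forall>n. \<bar>coeff_at (P n) u\<bar> \<le> K"] by blast
    have "\<bar>coeff_at (P n) u\<bar> \<le> (\<Sum>u\<in>exponents N. \<bar>B u\<bar>)" if "u \<in> exponents N" for u n
    proof -
      have "\<bar>coeff_at (P n) u\<bar> \<le> \<bar>B u\<bar>"
        using B[where n = n and u = u] by linarith
      also have "\<dots> \<le> (\<Sum>u\<in>exponents N. \<bar>B u\<bar>)"
        using that by (intro member_le_sum) auto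
      finally show ?thesis .
    qed
    then show ?thesis by blast
  qed
  then obtain K where K: "\<And>u n. u \<in> exponents N \<Longrightarrow> \<bar>coeff_at (P n) u\<bar> \<le> K" by blast
  \<comment> \<open>A bound for all \<open>P n\<close>; adding \<open>1\<close> makes it positive, as it is used as a denominator.\<close>
  define T where "T z = \<bar>K\<bar> * (\<Sum>u\<in>exponents N. \<bar>eval2 (mono2 u) z\<bar>) + 1" for z
  have T: "T z > 0" "eval2 (P n) z \<le> T z" for z n
  proof -
    have "0 \<le> (\<Sum>u\<in>exponents N. \<bar>eval2 (mono2 u) z\<bar>)"
      by (simp add: sum_nonneg)
    then show "T z > 0"
      unfolding T_def by (intro add_nonneg_pos mult_nonneg_nonneg) auto
    have "\<bar>coeff_at (P n) u\<bar> \<le> \<bar>K\<bar>" if "u \<in> exponents N" for u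
      using K[OF that, of n] by linarith
    from abs_eval2_le[OF P(2)[of n] this, of z] show "eval2 (P n) z \<le> T z"
      unfolding T_def by linarith
  qed
  have dom: "(eval2 (a n j l) z)\<^sup>2 * eval2 (g j) z \<le> T z" if "j \<le> q" "l < ?n" "z \<in> Z" for n j l z
  proof -
    have "(eval2 (a n j l) z)\<^sup>2 * eval2 (g j) z \<le> (\<Sum>l<?n. (eval2 (a n j l) z)\<^sup>2) * eval2 (g j) z"
      using that(2) by (intro mult_right_mono g_nonneg that member_le_sum) auto
    also have "\<dots> \<le> (\<Sum>j\<le>q. (\<Sum>l<?n. (eval2 (a n j l) z)\<^sup>2) * eval2 (g j) z)"
      using that(1) by (intro member_le_sum[where f = "\<lambda>j. (\<Sum>l<?n. (eval2 (a n j l) z)\<^sup>2) * eval2 (g j) z"]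
          mult_nonneg_nonneg sum_nonneg g_nonneg that) auto
    also have "\<dots> = eval2 (P n) z"
      using Z[OF that(3)] by (simp add: rep)
    finally show ?thesis using T(2) by (rule order_trans)
  qed
  define ok where "ok j B n l e \<longleftrightarrow> (\<forall>u\<in>exponents ?D. \<bar>e u\<bar> \<le> B) \<and>
      (\<forall>i\<in>{1..d}. \<phi> i (g j) \<noteq> 0 \<longrightarrow> \<phi> i (poly_of ?D e) = \<phi> i (a n j l))" for j B n l e
  have ok_ex: "\<exists>B. \<forall>n. \<forall>l<?n. \<exists>e. ok j B n l e" if j: "j \<le> q" for j
  proof -
    let ?L = "\<lambda>z u. eval2 (mono2 u) z * sqrt (eval2 (g j) z / T z)"
    have L: "(\<Sum>u\<in>exponents ?D. ?L z u * e u) = eval2 (poly_of ?D e) z * sqrt (eval2 (g j) z / T z)" for z e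
      unfolding eval2_poly_of sum_distrib_right by (simp only: mult_ac)
    obtain B where B: "\<And>x. (\<And>z. z \<in> Z \<Longrightarrow> \<bar>\<Sum>u\<in>exponents ?D. ?L z u * x u\<bar> \<le> 1) \<Longrightarrow>
      \<exists>x'. (\<forall>z\<in>Z. (\<Sum>u\<in>exponents ?D. ?L z u * x' u) = (\<Sum>u\<in>exponents ?D. ?L z u * x u)) \<and>
        (\<forall>u\<in>exponents ?D. \<bar>x' u\<bar> \<le> B)"
      by (rule functionals_control_coefficients[where \<Lambda> = Z and L = ?L and I = "exponents ?D", OF finite_exponents]) blast
    have "\<exists>e. ok j B n l e" if l: "l < ?n" for n l
    proof -
      have "\<bar>\<Sum>u\<in>exponents ?D. ?L z u * coeff_at (a n j l) u\<bar> \<le> 1" if z: "z \<in> Z" for z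
      proof -
        have "(eval2 (a n j l) z * sqrt (eval2 (g j) z / T z))\<^sup>2 = (eval2 (a n j l) z)\<^sup>2 * eval2 (g j) z / T z"
          using g_nonneg[OF j z] T(1)[of z] by (simp add: power_mult_distrib)
        also have "\<dots> \<le> 1"
          using dom[OF j l z] T(1)[of z] by simp
        finally show ?thesis
          unfolding L poly_of_coeff_at[OF a[OF j]] by (simp add: abs_square_le_1)
      qed
      from B[OF this] obtain e where e: "\<forall>u\<in>exponents ?D. \<bar>e u\<bar> \<le> B"
        "\<And>z. z \<in> Z \<Longrightarrow> eval2 (poly_of ?D e) z * sqrt (eval2 (g j) z / T z) =
           eval2 (a n j l) z * sqrt (eval2 (g j) z / T z)"
        unfolding L poly_of_coeff_at[OF a[OF j]] by blast
      have "\<phi> i (poly_of ?D e) = \<phi> i (a n j l)" if i: "i \<in> {1..d}" "\<phi> i (g j) \<noteq> 0" for i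
      proof -
        have "eval2 ((poly_of ?D e - a n j l) * g j) z = 0" if z: "z \<in> Z" for z
        proof (cases "eval2 (g j) z = 0")
          case False
          then have "sqrt (eval2 (g j) z / T z) \<noteq> 0"
            using T(1)[of z] by simp
          then show ?thesis using e(2)[OF z] by simp
        qed simp
        then have "\<phi> i ((poly_of ?D e - a n j l) * g j) = 0"
          by (rule zero_on_Z_imp_zero_on_branches[OF i(1)])
        then show ?thesis
          using i by (simp add: phi_simps[OF i(1)])
      qed
      then show ?thesis using e(1) unfolding ok_def by blast
    qed
    then show ?thesis by blast
  qed
  then obtain B where B: "\<forall>j. j \<le> q \<longrightarrow> (\<forall>n. \<forall>l<?n. \<exists>e. ok j (B j) n l e)"
    using choice[of "\<lambda>j B. j \<le> q \<longrightarrow> (\<forall>n. \<forall>l<?n. \<exists>e. ok j B n l e)"] by blast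
  define e where "e n j l = (SOME e. ok j (B j) n l e)" for n j l
  have "ok j (B j) n l (e n j l)" if "j \<le> q" "l < ?n" for j n l
  proof -
    have "\<exists>e. ok j (B j) n l e"
      using B that by blast
    then show ?thesis
      unfolding e_def by (rule someI_ex)
  qed
  then have e: "\<And>j n l u. j \<le> q \<Longrightarrow> l < ?n \<Longrightarrow> u \<in> exponents ?D \<Longrightarrow> \<bar>e n j l u\<bar> \<le> B j"
    and phi_e: "\<And>j n l i. j \<le> q \<Longrightarrow> l < ?n \<Longrightarrow> i \<in> {1..d} \<Longrightarrow> \<phi> i (g j) \<noteq> 0 \<Longrightarrow>
      \<phi> i (poly_of ?D (e n j l)) = \<phi> i (a n j l)"
    unfolding ok_def by blast+
  define I where "I = {..q} \<times> {..<?n} \<times> exponents ?D"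
  define x where "x n = (\<lambda>(j, l, u). e n j l u)" for n
  have "finite I" by (simp add: I_def)
  have x_le: "\<bar>x n i\<bar> \<le> (\<Sum>j\<le>q. \<bar>B j\<bar>)" if "i \<in> I" for n i
  proof -
    obtain j l u where i: "i = (j, l, u)" "j \<le> q" "l < ?n" "u \<in> exponents ?D"
      using \<open>i \<in> I\<close> by (auto simp: I_def)
    have "\<bar>x n i\<bar> \<le> \<bar>B j\<bar>"
      using e[OF i(2-4), of n] by (simp add: x_def i(1))
    also have "\<dots> \<le> (\<Sum>j\<le>q. \<bar>B j\<bar>)"
      using i(2) by (intro member_le_sum) auto
    finally show ?thesis .
  qed
  obtain \<rho> y where \<rho>: "strict_mono (\<rho> :: nat \<Rightarrow> nat)"
    and y: "\<And>i. i \<in> I \<Longrightarrow> (\<lambda>n. x (\<rho> n) i) \<longlonglongrightarrow> y i"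
    by (rule bounded_family_subsequence[where x = x, OF \<open>finite I\<close> x_le]) blast+
  define b where "b j l = poly_of ?D (\<lambda>u. y (j, l, u))" for j l
  have b: "poly_tendsto (\<lambda>n. poly_of ?D (e (\<rho> n) j l)) (b j l)" if "j \<le> q" "l < ?n" for j l
    unfolding b_def
  proof (rule poly_tendsto_poly_of)
    fix u
    assume "u \<in> exponents ?D"
    then show "(\<lambda>n. e (\<rho> n) j l u) \<longlonglongrightarrow> y (j, l, u)"
      using y[of "(j, l, u)"] that by (simp add: I_def x_def)
  qed
  define R where "R n = P (\<rho> n) - (\<Sum>j\<le>q. (\<Sum>l<?n. (poly_of ?D (e (\<rho> n) j l))\<^sup>2) * g j)" for n
  define r where "r = c - (\<Sum>j\<le>q. (\<Sum>l<?n. (b j l)\<^sup>2) * g j)"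
  have R: "poly_tendsto R r"
    unfolding R_def[abs_def] r_def power2_eq_square
    by (intro poly_tendsto_diff poly_tendsto_sum poly_tendsto_mult poly_tendsto_const b
        poly_tendsto_subseq[OF P(3) \<rho>]) auto
  have deg_R: "deg_le (2 * ?D + m) (R n)" for n
  proof -
    have "N \<le> 2 * ?D + m"
      by (simp add: degree_bound_def)
    moreover have "deg_le (2 * ?D) ((poly_of ?D f)\<^sup>2)" for f
      using deg_le_power[OF deg_le_poly_of, of 2] by simp
    ultimately show ?thesis
      unfolding R_def using P(2)
      by (intro deg_lt_diff deg_lt_sum deg_le_mult deg_g) (auto intro: deg_lt_mono)
  qed
  have "\<phi> i (R n) = 0" if i: "i \<in> {1..d}" for i n
  proof -
    have "\<phi> i ((\<Sum>l<?n. (poly_of ?D (e (\<rho> n) j l))\<^sup>2) * g j) = \<phi> i ((\<Sum>l<?n. (a (\<rho> n) j l)\<^sup>2) * g j)" if j: "j \<le> q" for j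
    proof (cases "\<phi> i (g j) = 0")
      case True
      then show ?thesis by (simp add: phi_simps[OF i])
    next
      case False
      then show ?thesis by (simp add: phi_simps[OF i] phi_e[OF j _ i])
    qed
    then have "\<phi> i (\<Sum>j\<le>q. (\<Sum>l<?n. (poly_of ?D (e (\<rho> n) j l))\<^sup>2) * g j) =
        \<phi> i (\<Sum>j\<le>q. (\<Sum>l<?n. (a (\<rho> n) j l)\<^sup>2) * g j)"
      unfolding phi_simps(8)[OF i, where A = "{..q}"] by (intro sum.cong) auto
    then show ?thesis
      unfolding R_def rep by (simp add: phi_simps(3,4,6)[OF i] phi_p[OF i])
  qed
  then have "\<phi> i r $$ k = 0" if i: "i \<in> {1..d}" for i k
    using phi_tendsto[OF i R deg_R, of k] that by (simp add: LIMSEQ_const_iff)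
  then have "\<phi> i r = 0" if "i \<in> {1..d}" for i
    using that by (intro fls_eqI) simp
  then obtain h where "r = h * p"
    using multiple_if_zero_on_branches[OF poly_tendsto_deg_le[OF R deg_R]] by blast
  then have "c = (\<Sum>j\<le>q. (\<Sum>l<?n. (b j l)\<^sup>2) * g j) + h * p"
    by (simp add: r_def algebra_simps)
  then show ?thesis
    unfolding cone_def mem_Collect_eq
    by (intro exI[of _ "\<lambda>j. \<Sum>l<?n. (b j l)\<^sup>2"] exI[of _ h]) (simp add: sums_of_squares_sum)
qed

end

section \<open>Closed cones equal their double duals\<close>

text \<open>
  Sublinear functionals on the real vector space \<open>\<real>[X,Y]\<close>. One inequality for positive scalars
  suffices, as it can be applied to the inverse scalar.
\<close>

definition sublinear :: "(poly2 \<Rightarrow> real) \<Rightarrow> bool" where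
  "sublinear q \<longleftrightarrow> (\<forall>x y. q (x + y) \<le> q x + q y) \<and> (\<forall>t>0. \<forall>x. q (const2 t * x) \<le> t * q x)"

lemma const2_one_mult [simp]: "const2 1 * x = x"
  by (simp add: const2_simps)

lemma const2_const2_mult: "const2 s * (const2 t * x) = const2 (s * t) * x"
  by (simp only: const2_simps mult.assoc)

lemma sublinearD:
  assumes "sublinear q"
  shows "q (x + y) \<le> q x + q y" "t \<ge> 0 \<Longrightarrow> q (const2 t * x) = t * q x" "q 0 = 0" "- q (- x) \<le> q x"
proof -
  have add: "q (x + y) \<le> q x + q y" for x y
    using assms by (simp add: sublinear_def)
  have le: "q (const2 t * x) \<le> t * q x" if "t > 0" for t x
    using assms that by (simp add: sublinear_def)
  show zero: "q 0 = 0"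
    using le[of 2 0] le[of "1/2" 0] by simp
  have "q (const2 t * x) = t * q x" if t: "t > 0" for t x
  proof (rule antisym)
    have inv: "const2 (1 / t) * (const2 t * x) = x"
      unfolding const2_const2_mult using t by simp
    have "q x \<le> 1 / t * q (const2 t * x)"
      using le[of "1 / t" "const2 t * x"] t unfolding inv by simp
    then show "t * q x \<le> q (const2 t * x)"
      using t by (simp add: field_simps)
  qed (use le t in blast)
  then show "q (const2 t * x) = t * q x" if "t \<ge> 0"
    using that zero by (cases "t = 0") (auto simp: const2_simps)
  show "q (x + y) \<le> q x + q y"
    by (rule add)
  show "- q (- x) \<le> q x"
    using add[of x "- x"] zero by simp
qed

text \<open>
  The infimal convolution lowers \<open>r\<close> as far as necessary to enforce \<open>q (- k) \<le> - v\<close> for all pairs \<open>(k, v)\<close>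
  in a convex cone.
\<close>

lemma sublinear_lower:
  assumes r: "sublinear r" and zero: "(0, 0) \<in> K"
    and add: "\<And>k v l w. (k, v) \<in> K \<Longrightarrow> (l, w) \<in> K \<Longrightarrow> (k + l, v + w) \<in> K"
    and scale: "\<And>k v t. (k, v) \<in> K \<Longrightarrow> t > 0 \<Longrightarrow> (const2 t * k, t * v) \<in> K"
    and le: "\<And>k v. (k, v) \<in> K \<Longrightarrow> v \<le> r k"
  obtains q where "sublinear q" "\<And>x. q x \<le> r x" "\<And>k v x. (k, v) \<in> K \<Longrightarrow> q x \<le> r (x + k) - v"
proof -
  define q where "q x = (INF (k, v)\<in>K. r (x + k) - v)" for x
  note rD = sublinearD[OF r]
  have bdd: "bdd_below ((\<lambda>(k, v). r (x + k) - v) ` K)" for x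
  proof (rule bdd_belowI2[where m = "- r (- x)"], clarify)
    fix k v
    assume "(k, v) \<in> K"
    then show "- r (- x) \<le> r (x + k) - v"
      using rD(1)[of "x + k" "- x"] le[of k v] by simp
  qed
  have lower: "q x \<le> r (x + k) - v" if "(k, v) \<in> K" for x k v
    unfolding q_def using cINF_lower[OF bdd that] by simp
  have great: "a \<le> q x" if "\<And>k v. (k, v) \<in> K \<Longrightarrow> a \<le> r (x + k) - v" for a x
    unfolding q_def using zero that by (intro cINF_greatest) auto
  have "sublinear q"
    unfolding sublinear_def
  proof (intro conjI allI impI)
    fix x y
    have "q (x + y) - q y \<le> q x"
    proof (rule great)
      fix k v
      assume k: "(k, v) \<in> K"
      have "q (x + y) - (r (x + k) - v) \<le> q y"
      proof (rule great)
        fix l w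
        assume l: "(l, w) \<in> K"
        have "q (x + y) \<le> r ((x + y) + (k + l)) - (v + w)"
          using lower[OF add[OF k l]] .
        also have "(x + y) + (k + l) = (x + k) + (y + l)"
          by simp
        finally show "q (x + y) - (r (x + k) - v) \<le> r (y + l) - w"
          using rD(1)[of "x + k" "y + l"] by linarith
      qed
      then show "q (x + y) - q y \<le> r (x + k) - v" by linarith
    qed
    then show "q (x + y) \<le> q x + q y" by linarith
  next
    fix t :: real and x
    assume t: "t > 0"
    have "q (const2 t * x) / t \<le> q x"
    proof (rule great)
      fix k v
      assume k: "(k, v) \<in> K"
      have "q (const2 t * x) \<le> r (const2 t * x + const2 t * k) - t * v"
        using lower[OF scale[OF k t]] .
      also have "const2 t * x + const2 t * k = const2 t * (x + k)"
        by (simp add: algebra_simps)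
      also have "r (const2 t * (x + k)) = t * r (x + k)"
        using rD(2) t by simp
      also have "t * r (x + k) - t * v = (r (x + k) - v) * t"
        by (simp add: algebra_simps)
      finally show "q (const2 t * x) / t \<le> r (x + k) - v"
        using t by (simp only: pos_divide_le_eq)
    qed
    then show "q (const2 t * x) \<le> t * q x"
      using t by (simp add: pos_divide_le_eq mult.commute)
  qed
  moreover have "q x \<le> r x" for x
    using lower[OF zero, of x] by simp
  ultimately show ?thesis
    using that lower by blast
qed

text \<open>
  The Hahn-Banach theorem: a minimal sublinear functional is odd, because otherwise it could be
  lowered, and so it is linear.
\<close>

lemma linear_below_sublinear:
  assumes p: "sublinear p"
  obtains L where "linear_functional L" "\<And>x. L x \<le> p x"
proof -
  define A where "A = {q. sublinear q \<and> (\<forall>x. q x \<le> p x)}"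
  define below where "below q q' \<longleftrightarrow> (\<forall>x. q' x \<le> q x)" for q q' :: "poly2 \<Rightarrow> real"
  have "\<exists>m\<in>A. \<forall>a\<in>A. below m a \<longrightarrow> a = m"
  proof (rule predicate_Zorn)
    show "partial_order_on A (relation_of below A)"
      by (rule partial_order_on_relation_ofI) (auto simp: below_def fun_eq_iff intro: order_trans antisym)
    fix C
    assume C: "C \<in> Chains (relation_of below A)"
    have CA: "C \<subseteq> A" and total: "\<And>q q'. q \<in> C \<Longrightarrow> q' \<in> C \<Longrightarrow> below q q' \<or> below q' q"
      using C by (auto simp: Chains_def relation_of_def)
    show "\<exists>u\<in>A. \<forall>a\<in>C. below a u"
    proof (cases "C = {}")
      case True
      then show ?thesis using p by (intro bexI[of _ p]) (auto simp: A_def)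
    next
      case False
      define u where "u x = (INF q\<in>C. q x)" for x
      have sub: "sublinear q" "q x \<le> p x" if "q \<in> C" for q x
        using that CA by (auto simp: A_def)
      have bdd: "bdd_below ((\<lambda>q. q x) ` C)" for x
      proof (rule bdd_belowI2[where m = "- p (- x)"])
        fix q
        assume "q \<in> C"
        then show "- p (- x) \<le> q x"
          using sub(2)[of q "- x"] sublinearD(4)[OF sub(1), of q x] by simp
      qed
      have lower: "u x \<le> q x" if "q \<in> C" for q x
        unfolding u_def using that bdd by (intro cINF_lower)
      have great: "a \<le> u x" if "\<And>q. q \<in> C \<Longrightarrow> a \<le> q x" for a x
        unfolding u_def using that False by (intro cINF_greatest)
      have "sublinear u"
        unfolding sublinear_def
      proof (intro conjI allI impI)
        fix x y
        have "u (x + y) - u y \<le> u x"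
        proof (rule great)
          fix q
          assume q: "q \<in> C"
          have "u (x + y) - q x \<le> u y"
          proof (rule great)
            fix q'
            assume q': "q' \<in> C"
            have "\<exists>q0\<in>C. q0 x \<le> q x \<and> q0 y \<le> q' y"
              using total[OF q q'] q q' unfolding below_def by blast
            then obtain q0 where q0: "q0 \<in> C" "q0 x \<le> q x" "q0 y \<le> q' y"
              by blast
            show "u (x + y) - q x \<le> q' y"
              using lower[OF q0(1), of "x + y"] sublinearD(1)[OF sub(1)[OF q0(1)], of x y] q0(2,3) by linarith
          qed
          then show "u (x + y) - u y \<le> q x" by linarith
        qed
        then show "u (x + y) \<le> u x + u y" by linarith
      next
        fix t :: real and x
        assume t: "t > 0"
        have "u (const2 t * x) / t \<le> u x"
        proof (rule great)
          fix q
          assume q: "q \<in> C"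
          have "u (const2 t * x) \<le> t * q x"
            using lower[OF q, of "const2 t * x"] sublinearD(2)[OF sub(1)[OF q], of t x] t by simp
          then show "u (const2 t * x) / t \<le> q x"
            using t by (simp add: pos_divide_le_eq mult.commute)
        qed
        then show "u (const2 t * x) \<le> t * u x"
          using t by (simp add: pos_divide_le_eq mult.commute)
      qed
      moreover have "u x \<le> p x" for x
      proof -
        obtain q where "q \<in> C" using False by blast
        then show ?thesis using lower sub(2) order_trans by blast
      qed
      ultimately have "u \<in> A"
        by (simp add: A_def)
      then show ?thesis
        using lower by (auto simp: below_def)
    qed
  qed
  then obtain L where LA: "L \<in> A" and minA: "\<forall>a\<in>A. below L a \<longrightarrow> a = L"
    by blast
  from LA have L: "sublinear L" "\<And>x. L x \<le> p x"
    by (simp_all add: A_def)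
  have min: "q = L" if q: "sublinear q" "\<And>x. q x \<le> L x" for q
  proof -
    have "q x \<le> p x" for x
      using q(2) L(2) by (rule order_trans)
    then have "q \<in> A"
      using q(1) by (simp add: A_def)
    then show ?thesis
      using minA q(2) by (simp add: below_def)
  qed
  note LD = sublinearD[OF L(1)]
  have odd: "L (- y) = - L y" for y
  proof (rule antisym)
    obtain q where q: "sublinear q" "\<And>x. q x \<le> L x"
      "\<And>k v x. (k, v) \<in> {(const2 t * y, t * L y) | t. t \<ge> 0} \<Longrightarrow> q x \<le> L (x + k) - v"
    proof (rule sublinear_lower[OF L(1), of "{(const2 t * y, t * L y) | t. t \<ge> 0}"])
      show "(0, 0) \<in> {(const2 t * y, t * L y) | t. t \<ge> 0}"
        by (auto intro!: exI[of _ 0] simp: const2_simps)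
      fix k v l w
      assume "(k, v) \<in> {(const2 t * y, t * L y) | t. t \<ge> 0}" "(l, w) \<in> {(const2 t * y, t * L y) | t. t \<ge> 0}"
      then obtain t s where "k = const2 t * y" "v = t * L y" "l = const2 s * y" "w = s * L y" "t \<ge> 0" "s \<ge> 0"
        by blast
      then show "(k + l, v + w) \<in> {(const2 t * y, t * L y) | t. t \<ge> 0}"
        by (auto intro!: exI[of _ "t + s"] simp: const2_simps algebra_simps)
    next
      fix k v t
      assume "(k, v) \<in> {(const2 t * y, t * L y) | t. t \<ge> 0}" "(t :: real) > 0"
      then obtain s where "k = const2 s * y" "v = s * L y" "s \<ge> 0"
        by blast
      then show "(const2 t * k, t * v) \<in> {(const2 t * y, t * L y) | t. t \<ge> 0}"
        using \<open>t > 0\<close> by (auto intro!: exI[of _ "t * s"] simp: const2_simps algebra_simps)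
    next
      fix k v
      assume "(k, v) \<in> {(const2 t * y, t * L y) | t. t \<ge> 0}"
      then show "v \<le> L k" using LD(2) by auto
    qed blast
    have "q = L"
      using min q(1,2) by blast
    moreover have "q (- y) \<le> L (- y + const2 1 * y) - 1 * L y"
      by (intro q(3) CollectI exI[of _ 1]) simp
    ultimately show "L (- y) \<le> - L y"
      using LD(3) by (simp add: const2_simps)
    show "- L y \<le> L (- y)"
      using LD(4)[of "- y"] by simp
  qed
  have add: "L (x + y) = L x + L y" for x y
    using LD(1)[of x y] LD(1)[of "x + y" "- y"] odd[of y] by simp
  have "L (const2 c * x) = c * L x" for c x
  proof (cases "c \<ge> 0")
    case False
    then have "L (const2 (- c) * x) = - c * L x"
      by (intro LD(2)) simp
    then show ?thesis
      using odd[of "const2 c * x"] by (simp add: const2_simps)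
  qed (rule LD(2))
  with add have "linear_functional L"
    by (simp add: linear_functional_iff)
  with L(2) show ?thesis using that by blast
qed

definition weighted_norm :: "(nat \<Rightarrow> real) \<Rightarrow> nat \<Rightarrow> poly2 \<Rightarrow> real" where
  "weighted_norm w N a = (\<Sum>u\<in>exponents N. w (fst u + snd u) * \<bar>coeff_at a u\<bar>)"

lemma exponents_mono: "M \<le> N \<Longrightarrow> exponents M \<subseteq> exponents N"
  by (auto simp: exponents_def)

lemma weighted_norm_eq:
  assumes "deg_le M a" "M \<le> N"
  shows "weighted_norm w N a = weighted_norm w M a"
  unfolding weighted_norm_def using assms(1)
  by (intro sum.mono_neutral_right finite_exponents exponents_mono assms(2))
    (auto simp: exponents_def deg_lt_def)

lemma weighted_norm_tdegree:
  assumes "deg_le N a"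
  shows "weighted_norm w (tdegree a) a = weighted_norm w N a"
  using weighted_norm_eq[OF deg_le_tdegree tdegree_le[OF assms]] by simp

lemma weighted_norm_tendsto:
  assumes "poly_tendsto P a"
  shows "(\<lambda>n. weighted_norm w N (P n)) \<longlonglongrightarrow> weighted_norm w N a"
  unfolding weighted_norm_def using assms by (intro tendsto_intros) (simp add: poly_tendsto_def)

lemma abs_coeff_le_weighted_norm:
  assumes "\<And>k. w k \<ge> 1" "u \<in> exponents N"
  shows "\<bar>coeff_at a u\<bar> \<le> weighted_norm w N a"
proof -
  have "\<bar>coeff_at a u\<bar> \<le> w (fst u + snd u) * \<bar>coeff_at a u\<bar>"
    using assms(1)[of "fst u + snd u"] mult_right_mono[of 1 "w (fst u + snd u)" "\<bar>coeff_at a u\<bar>"] by simp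
  also have "\<dots> \<le> weighted_norm w N a"
    unfolding weighted_norm_def using assms(2)
    by (intro member_le_sum[where f = "\<lambda>u. w (fst u + snd u) * \<bar>coeff_at a u\<bar>"])
      (auto intro!: mult_nonneg_nonneg order_trans[OF zero_le_one assms(1)])
  finally show ?thesis .
qed

definition degreewise_closed :: "poly2 set \<Rightarrow> bool" where
  "degreewise_closed C \<longleftrightarrow>
     (\<forall>N P c. (\<forall>n. P n \<in> C \<and> deg_le N (P n)) \<longrightarrow> poly_tendsto P c \<longrightarrow> c \<in> C)"

lemma tendsto_zero_if_le_inverse:
  fixes x :: "nat \<Rightarrow> real"
  assumes "\<And>n. \<bar>x n\<bar> \<le> 1 / (real n + 1)"
  shows "x \<longlonglongrightarrow> 0"
proof (rule Lim_null_comparison)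
  have "norm (x n) \<le> inverse (real (Suc n))" for n
    using assms[of n] by (simp add: inverse_eq_divide add.commute)
  then show "\<forall>\<^sub>F n in sequentially. norm (x n) \<le> inverse (real (Suc n))"
    by (rule always_eventually[OF allI])
qed (rule LIMSEQ_inverse_real_of_nat)

lemma degreewise_closedD:
  assumes "degreewise_closed C" "\<And>n. P n \<in> C" "\<And>n. deg_le N (P n)" "poly_tendsto P c"
  shows "c \<in> C"
  using assms(1)[unfolded degreewise_closed_def, THEN spec[of _ N], THEN spec[of _ P], THEN spec[of _ c]]
    assms(2-) by simp

text \<open>
  The weights are chosen one degree after the other: given weights up to degree \<open>N\<close>, a sequence of
  elements of \<open>C\<close> of degree \<open>N + 1\<close> that violates the separation for larger and larger weights has a limit of
  degree \<open>N\<close>.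
\<close>

lemma separating_weights:
  assumes closed: "degreewise_closed C"
    and f: "f \<notin> C"
  obtains w where "\<And>k. w k \<ge> 1" "\<And>N c. c \<in> C \<Longrightarrow> deg_le N (c - f) \<Longrightarrow> weighted_norm w N (c - f) > 1"
proof -
  define N0 where "N0 = tdegree f"
  have deg_f: "deg_le N f" if "N0 \<le> N" for N
    using deg_le_tdegree[of f] that by (auto simp: N0_def intro: deg_lt_mono)
  define sep where "sep N w \<longleftrightarrow> (\<forall>k. w k \<ge> 1) \<and> (\<forall>c\<in>C. deg_le N c \<longrightarrow> weighted_norm w N (c - f) > 1)" for N w
  \<comment> \<open>Weights that are at least \<open>1\<close> bound the coefficients, so a subsequence converges.\<close>
  have limit: "\<exists>\<rho> c. strict_mono \<rho> \<and> c \<in> C \<and> deg_le N c \<and> poly_tendsto (\<lambda>n. P (\<rho> n) - f) (c - f)"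
    if P: "\<And>n. P n \<in> C" "\<And>n. deg_le N (P n)" "\<And>n. weighted_norm (w n) N (P n - f) \<le> 1"
      and w: "\<And>n k. w n k \<ge> 1" for P :: "nat \<Rightarrow> poly2" and w :: "nat \<Rightarrow> nat \<Rightarrow> real" and N
  proof -
    have bound: "\<bar>coeff_at (P n) u\<bar> \<le> 1 + (\<Sum>u\<in>exponents N. \<bar>coeff_at f u\<bar>)" if u: "u \<in> exponents N" for n u
    proof -
      have "\<bar>coeff_at (P n - f) u\<bar> \<le> 1"
        using abs_coeff_le_weighted_norm[OF w u] P(3) by (rule order_trans)
      moreover have "\<bar>coeff_at f u\<bar> \<le> (\<Sum>u\<in>exponents N. \<bar>coeff_at f u\<bar>)"
        using u by (intro member_le_sum[where f = "\<lambda>u. \<bar>coeff_at f u\<bar>"]) auto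
      ultimately show ?thesis by simp
    qed
    obtain \<rho> l where \<rho>: "strict_mono (\<rho> :: nat \<Rightarrow> nat)"
      and l: "\<And>u. u \<in> exponents N \<Longrightarrow> (\<lambda>n. coeff_at (P (\<rho> n)) u) \<longlonglongrightarrow> l u"
      by (rule bounded_family_subsequence[where x = "\<lambda>n. coeff_at (P n)", OF finite_exponents bound]) blast+
    have "poly_tendsto (\<lambda>n. poly_of N (coeff_at (P (\<rho> n)))) (poly_of N l)"
      by (intro poly_tendsto_poly_of l)
    then have lim: "poly_tendsto (\<lambda>n. P (\<rho> n)) (poly_of N l)"
      by (simp add: poly_of_coeff_at P(2))
    then have "poly_of N l \<in> C"
      by (rule degreewise_closedD[OF closed, rotated 2]) (rule P)+
    moreover note poly_tendsto_diff[OF lim poly_tendsto_const, of f] deg_le_poly_of[of N l]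
    ultimately show ?thesis using \<rho> by blast
  qed
  have "\<exists>w. sep N0 w"
  proof (rule ccontr)
    assume "\<not> ?thesis"
    then have "\<not> sep N0 (\<lambda>_. real n + 1)" for n by blast
    then have "\<exists>c\<in>C. deg_le N0 c \<and> weighted_norm (\<lambda>_. real n + 1) N0 (c - f) \<le> 1" for n
      unfolding sep_def by (auto simp: not_less)
    then obtain P where P: "\<And>n. P n \<in> C" "\<And>n. deg_le N0 (P n)"
      "\<And>n. weighted_norm (\<lambda>_. real n + 1) N0 (P n - f) \<le> 1"
      using choice[of "\<lambda>n c. c \<in> C \<and> deg_le N0 c \<and> weighted_norm (\<lambda>_. real n + 1) N0 (c - f) \<le> 1"] by blast
    obtain \<rho> c where c: "strict_mono \<rho>" "c \<in> C" "deg_le N0 c" "poly_tendsto (\<lambda>n. P (\<rho> n) - f) (c - f)"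
      using limit[of P N0 "\<lambda>n _. real n + 1", OF P] by auto
    have "coeff_at (c - f) u = 0" if u: "u \<in> exponents N0" for u
    proof -
      have "\<bar>coeff_at (P n - f) u\<bar> \<le> 1 / (real n + 1)" for n
      proof -
        have "(real n + 1) * \<bar>coeff_at (P n - f) u\<bar> \<le> weighted_norm (\<lambda>_. real n + 1) N0 (P n - f)"
          unfolding weighted_norm_def using u
          by (intro member_le_sum[where f = "\<lambda>u. (real n + 1) * \<bar>coeff_at (P n - f) u\<bar>"]) auto
        with P(3)[of n] show ?thesis by (simp add: pos_le_divide_eq mult.commute)
      qed
      then have "(\<lambda>n. coeff_at (P n - f) u) \<longlonglongrightarrow> 0"
        by (rule tendsto_zero_if_le_inverse)
      then have "(\<lambda>n. coeff_at (P (\<rho> n) - f) u) \<longlonglongrightarrow> 0"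
        by (rule LIMSEQ_subseq_LIMSEQ[OF _ c(1), unfolded o_def])
      moreover have "(\<lambda>n. coeff_at (P (\<rho> n) - f) u) \<longlonglongrightarrow> coeff_at (c - f) u"
        using c(4) by (simp only: poly_tendsto_def)
      ultimately show ?thesis
        using LIMSEQ_unique by blast
    qed
    then have "coeff2 (c - f) i j = 0" for i j
      using deg_lt_diff[OF c(3) deg_f[of N0]] by (cases "i + j \<le> N0") (force simp: exponents_def deg_lt_def)+
    then have "c - f = 0"
      by (intro poly2_eqI) simp
    with c(2) f show False by simp
  qed
  then obtain w0 where w0: "sep N0 w0" by blast
  have step: "\<exists>w'. sep (Suc N) w' \<and> (\<forall>k\<le>N. w' k = w k)" if N: "N0 \<le> N" and w: "sep N w" for N w
  proof (rule ccontr)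
    assume neg: "\<not> ?thesis"
    let ?w = "\<lambda>n. w(Suc N := real n + 1)"
    have w1: "w k \<ge> 1" for k using w by (simp add: sep_def)
    have w1': "?w n k \<ge> 1" for n k using w1 by simp
    have "\<not> sep (Suc N) (?w n)" for n
    proof
      assume "sep (Suc N) (?w n)"
      moreover have "\<forall>k\<le>N. ?w n k = w k"
        by simp
      ultimately show False using neg by blast
    qed
    then have "\<exists>c\<in>C. deg_le (Suc N) c \<and> weighted_norm (?w n) (Suc N) (c - f) \<le> 1" for n
      using w1' unfolding sep_def by (auto simp: not_less simp del: fun_upd_apply)
    then obtain P where P: "\<And>n. P n \<in> C" "\<And>n. deg_le (Suc N) (P n)"
      "\<And>n. weighted_norm (?w n) (Suc N) (P n - f) \<le> 1"
      using choice[of "\<lambda>n c. c \<in> C \<and> deg_le (Suc N) c \<and> weighted_norm (?w n) (Suc N) (c - f) \<le> 1"] by blast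
    obtain \<rho> c where c: "strict_mono \<rho>" "c \<in> C" "deg_le (Suc N) c" "poly_tendsto (\<lambda>n. P (\<rho> n) - f) (c - f)"
      using limit[of P "Suc N" ?w, OF P w1'] by blast
    have top: "coeff2 (c - f) i j = 0" if ij: "i + j = Suc N" for i j
    proof -
      have "\<bar>coeff2 (P n - f) i j\<bar> \<le> 1 / (real n + 1)" for n
      proof -
        have "?w n (fst (i, j) + snd (i, j)) * \<bar>coeff_at (P n - f) (i, j)\<bar> \<le> weighted_norm (?w n) (Suc N) (P n - f)"
          unfolding weighted_norm_def
        proof (rule member_le_sum)
          show "(i, j) \<in> exponents (Suc N)"
            using ij by (simp add: exponents_def)
        qed (use order_trans[OF zero_le_one w1] in auto)
        with P(3)[of n] ij show ?thesis by (simp add: pos_le_divide_eq mult.commute)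
      qed
      then have "(\<lambda>n. coeff2 (P n - f) i j) \<longlonglongrightarrow> 0"
        by (rule tendsto_zero_if_le_inverse)
      then have "(\<lambda>n. coeff2 (P (\<rho> n) - f) i j) \<longlonglongrightarrow> 0"
        by (rule LIMSEQ_subseq_LIMSEQ[OF _ c(1), unfolded o_def])
      moreover have "(\<lambda>n. coeff2 (P (\<rho> n) - f) i j) \<longlonglongrightarrow> coeff2 (c - f) i j"
        using c(4) by (simp only: poly_tendsto_def)
      ultimately show ?thesis
        using LIMSEQ_unique by blast
    qed
    have "deg_le N c"
      unfolding deg_lt_def
    proof (intro allI impI)
      fix i j
      assume "Suc N \<le> i + j"
      then show "coeff2 c i j = 0"
        using top[of i j] c(3) deg_f[OF N] by (cases "i + j = Suc N") (auto simp: deg_lt_def)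
    qed
    then have "weighted_norm w N (c - f) > 1"
      using w c(2) by (simp add: sep_def)
    moreover have "weighted_norm w N (c - f) \<le> 1"
    proof (rule LIMSEQ_le_const2)
      show "(\<lambda>n. weighted_norm w N (P (\<rho> n) - f)) \<longlonglongrightarrow> weighted_norm w N (c - f)"
        by (rule weighted_norm_tendsto[OF c(4)])
      have "weighted_norm w N (P n - f) \<le> 1" for n
      proof -
        have "weighted_norm w N (P n - f) = (\<Sum>u\<in>exponents N. ?w n (fst u + snd u) * \<bar>coeff_at (P n - f) u\<bar>)"
          unfolding weighted_norm_def by (intro sum.cong) (auto simp: exponents_def)
        also have "\<dots> \<le> weighted_norm (?w n) (Suc N) (P n - f)"
          unfolding weighted_norm_def using order_trans[OF zero_le_one w1']
          by (intro sum_mono2 exponents_mono mult_nonneg_nonneg) auto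
        finally show ?thesis using P(3)[of n] by linarith
      qed
      then show "\<exists>N'. \<forall>n\<ge>N'. weighted_norm w N (P (\<rho> n) - f) \<le> 1" by blast
    qed
    ultimately show False by simp
  qed
  obtain W where W: "\<And>n. sep (N0 + n) (W n)" "\<And>n. \<forall>k\<le>N0 + n. W (Suc n) k = W n k"
  proof -
    have "\<exists>w. sep (N0 + 0) w"
      using w0 by auto
    moreover have "\<exists>w'. sep (N0 + Suc n) w' \<and> (\<forall>k\<le>N0 + n. w' k = w k)" if "sep (N0 + n) w" for n w
      using step[OF _ that] by simp
    ultimately show ?thesis
      using dependent_nat_choice[of "\<lambda>n. sep (N0 + n)" "\<lambda>n w w'. \<forall>k\<le>N0 + n. w' k = w k"] that by blast
  qed
  have stable: "W m k = W n k" if "n \<le> m" "k \<le> N0 + n" for n m k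
    using that by (induction m rule: dec_induct) (auto simp: W(2))
  define w where "w k = W k k" for k
  have w_eq: "w k = W n k" if "k \<le> N0 + n" for n k
    using stable[of k n k] stable[of n k k] that by (cases "n \<le> k") (auto simp: w_def)
  show ?thesis
  proof (rule that)
    show "w k \<ge> 1" for k
      using W(1)[of k] by (simp add: w_def sep_def)
    show "weighted_norm w N (c - f) > 1" if c: "c \<in> C" "deg_le N (c - f)" for N c
    proof -
      have "deg_le (N0 + N) (c - f + f)"
        using deg_lt_mono[OF c(2)] deg_f by (intro deg_lt_add) auto
      then have "weighted_norm (W N) (N0 + N) (c - f) > 1"
        using W(1)[of N] c(1) by (simp add: sep_def)
      also have "weighted_norm (W N) (N0 + N) (c - f) = weighted_norm w (N0 + N) (c - f)"
        unfolding weighted_norm_def by (intro sum.cong) (auto simp: exponents_def w_eq)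
      also have "\<dots> = weighted_norm w N (c - f)"
        using c(2) by (intro weighted_norm_eq) simp_all
      finally show ?thesis .
    qed
  qed
qed

text \<open>
  The weighted norm that separates \<open>f\<close> from \<open>C\<close> is lowered to a sublinear functional that is nonpositive
  on \<open>- C\<close> and at most \<open>-1\<close> at \<open>f\<close>. A linear functional below it is nonnegative on \<open>C\<close> and negative at \<open>f\<close>.
\<close>

lemma double_dual_subset_closed_cone:
  assumes closed: "degreewise_closed C"
    and add: "\<And>a b. a \<in> C \<Longrightarrow> b \<in> C \<Longrightarrow> a + b \<in> C"
    and scale: "\<And>t a. t \<ge> 0 \<Longrightarrow> a \<in> C \<Longrightarrow> const2 t * a \<in> C"
    and zero: "0 \<in> C"
  shows "double_dual C \<subseteq> C"
proof (rule subsetI, rule ccontr)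
  fix f
  assume f: "f \<in> double_dual C" "f \<notin> C"
  obtain w where w: "\<And>k. w k \<ge> 1" "\<And>N c. c \<in> C \<Longrightarrow> deg_le N (c - f) \<Longrightarrow> weighted_norm w N (c - f) > 1"
    using separating_weights[OF closed f(2)] by blast
  have w0: "w k \<ge> 0" for k
    using w(1)[of k] by simp
  define nrm where "nrm a = weighted_norm w (tdegree a) a" for a
  have nrm: "nrm a = weighted_norm w N a" if "deg_le N a" for N a
    unfolding nrm_def by (rule weighted_norm_tdegree[OF that])
  have nrm_scale: "nrm (const2 t * a) = \<bar>t\<bar> * nrm a" for t a
  proof -
    have "nrm (const2 t * a) = weighted_norm w (tdegree a) (const2 t * a)"
      by (intro nrm deg_lt_const2_mult deg_le_tdegree)
    also have "\<dots> = \<bar>t\<bar> * weighted_norm w (tdegree a) a"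
      unfolding weighted_norm_def coeff2_const2_mult abs_mult sum_distrib_left by (simp only: mult_ac)
    finally show ?thesis by (simp only: nrm_def)
  qed
  have "sublinear nrm"
    unfolding sublinear_def
  proof (intro conjI allI impI)
    fix x y
    define N where "N = max (tdegree x) (tdegree y)"
    have "deg_le N x" "deg_le N y"
      using deg_le_tdegree[of x] deg_le_tdegree[of y] by (auto simp: N_def intro: deg_lt_mono)
    then have "nrm x = weighted_norm w N x" "nrm y = weighted_norm w N y" "nrm (x + y) = weighted_norm w N (x + y)"
      by (simp_all add: nrm deg_lt_add)
    moreover have "weighted_norm w N (x + y) \<le> weighted_norm w N x + weighted_norm w N y"
      unfolding weighted_norm_def sum.distrib[symmetric] distrib_left[symmetric]
      by (intro sum_mono mult_left_mono w0) simp
    ultimately show "nrm (x + y) \<le> nrm x + nrm y" by simp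
  qed (simp add: nrm_scale)
  define K where "K = {(k, v). k + const2 v * f \<in> C \<and> v \<ge> 0}"
  obtain q where q: "sublinear q" "\<And>k v x. (k, v) \<in> K \<Longrightarrow> q x \<le> nrm (x + k) - v"
  proof (rule sublinear_lower[OF \<open>sublinear nrm\<close>, of K])
    show "(0, 0) \<in> K"
      using zero by (simp add: K_def const2_simps)
    show "(k + l, v + v') \<in> K" if "(k, v) \<in> K" "(l, v') \<in> K" for k v l v'
      using that add[of "k + const2 v * f" "l + const2 v' * f"] by (simp add: K_def const2_simps algebra_simps)
    show "(const2 t * k, t * v) \<in> K" if "(k, v) \<in> K" "t > 0" for k v t
      using that scale[of t "k + const2 v * f"] by (simp add: K_def const2_simps algebra_simps)
    show "v \<le> nrm k" if kv: "(k, v) \<in> K" for k v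
    proof (cases "v = 0")
      case True
      then show ?thesis
        by (simp add: nrm_def weighted_norm_def sum_nonneg w0)
    next
      case False
      define c where "c = k + const2 v * f"
      have c: "k = c - const2 v * f" "c \<in> C" "v > 0"
        using kv False by (simp_all add: K_def c_def)
      have "const2 v * (const2 (1 / v) * c - f) = const2 (v * (1 / v)) * c - const2 v * f"
        by (simp only: const2_simps right_diff_distrib mult.assoc)
      then have "k = const2 v * (const2 (1 / v) * c - f)"
        using c by (simp add: const2_simps)
      then have "nrm k = v * nrm (const2 (1 / v) * c - f)"
        using c(3) by (simp add: nrm_scale)
      moreover have "nrm (const2 (1 / v) * c - f) > 1"
        unfolding nrm_def using c scale by (intro w(2) deg_le_tdegree) simp
      ultimately show ?thesis
        using c(3) by (simp add: less_imp_le)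
    qed
  qed blast
  obtain L where L: "linear_functional L" "\<And>x. L x \<le> q x"
    using linear_below_sublinear[OF q(1)] by blast
  have nrm0: "nrm 0 = 0"
    by (simp add: nrm_def weighted_norm_def)
  have neg: "L (- x) = - L x" for x
  proof -
    have "L (const2 (- 1) * x) = - 1 * L x"
      using L(1) unfolding linear_functional_iff by blast
    then show ?thesis by (simp add: const2_simps)
  qed
  have "L c \<ge> 0" if "c \<in> C" for c
  proof -
    have "(c, 0) \<in> K"
      using that by (simp add: K_def const2_simps)
    then have "q (- c) \<le> nrm (- c + c) - 0" by (rule q(2))
    then show ?thesis
      using L(2)[of "- c"] neg[of c] nrm0 by simp
  qed
  then have "L f \<ge> 0"
    using f(1) L(1) by (simp add: double_dual_def)
  moreover have "(- f, 1) \<in> K"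
    using zero by (simp add: K_def const2_simps)
  then have "q f \<le> nrm (f + - f) - 1" by (rule q(2))
  then have "L f \<le> - 1"
    using L(2)[of f] nrm0 by simp
  ultimately show False by simp
qed

section \<open>Gluing representations over the values of a bounded polynomial\<close>

lemma eval2_zero_imp_zero:
  assumes "\<And>z. eval2 p z = 0"
  shows "p = 0"
proof -
  have "poly p [:y:] = 0" for y
  proof -
    have "poly (poly p [:y:]) x = poly 0 x" for x
      using assms[of "(x, y)"] by (simp add: eval2_def)
    then show ?thesis
      using poly_eq_poly_eq_iff[of "poly p [:y:]" 0] by blast
  qed
  then have "range (\<lambda>y :: real. [:y:]) \<subseteq> {x. poly p x = 0}"
    by auto
  moreover have "infinite (range (\<lambda>y :: real. [:y:]))"
    using finite_imageD[of "\<lambda>y :: real. [:y:]" UNIV] infinite_UNIV_char_0 by (auto simp: inj_on_def)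
  ultimately have "infinite {x. poly p x = 0}"
    using infinite_super by blast
  then show ?thesis
    using poly_roots_finite by blast
qed

text \<open>Identities in \<open>\<real>[X,Y]\<close> may be verified pointwise, where division by real numbers is available.\<close>

lemma eval2_eqI: "(\<And>z. eval2 p z = eval2 q z) \<Longrightarrow> p = q"
  using eval2_zero_imp_zero[of "p - q"] by simp

lemma eval2_numeral [simp]: "eval2 (numeral n) z = numeral n"
  by (simp add: eval2_def)

locale bounded_qm =
  fixes M :: "poly2 set" and b :: poly2 and lam Lam :: real
  assumes M: "quadratic_module M" and le: "lam \<le> Lam"
    and upper: "const2 Lam - b \<in> M" and lower: "b - const2 lam \<in> M"
begin

lemma M_add: "m \<in> M \<Longrightarrow> n \<in> M \<Longrightarrow> m + n \<in> M"
  using M by (simp add: quadratic_module_def)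

lemma M_square_mult: "m \<in> M \<Longrightarrow> a\<^sup>2 * m \<in> M"
  using M by (simp add: quadratic_module_def)

lemma M_square: "a\<^sup>2 \<in> M"
  using M_square_mult[of 1 a] M by (simp add: quadratic_module_def)

lemma M_const_mult: "c \<ge> 0 \<Longrightarrow> m \<in> M \<Longrightarrow> const2 c * m \<in> M"
  using M_square_mult[of m "const2 (sqrt c)"] by (simp flip: const2_simps)

lemma M_const: "c \<ge> 0 \<Longrightarrow> const2 c \<in> M"
  using M_square[of "const2 (sqrt c)"] by (simp flip: const2_simps)

lemma M_zero: "0 \<in> M"
  using M_const[of 0] by (simp add: const2_simps)

lemma M_sum: "(\<And>a. a \<in> A \<Longrightarrow> f a \<in> M) \<Longrightarrow> sum f A \<in> M"
  by (induction A rule: infinite_finite_induct) (simp_all add: M_zero M_add)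

definition mid :: real where "mid = (lam + Lam) / 2"

text \<open>The summand \<open>1\<close> keeps \<open>R\<close> positive if \<open>lam = Lam\<close>.\<close>

definition R :: real where "R = Lam - lam + 1"

text \<open>
  The affine image \<open>w\<close> of \<open>b\<close> has values in \<open>[-1/2, 1/2]\<close> where \<open>lam \<le> b \<le> Lam\<close>, and \<open>\<beta>\<close> has values in \<open>[1/4, 3/4]\<close>.
  Staying away from \<open>0\<close> and \<open>1\<close>, the even and the odd Bernstein polynomials have almost the same weight.
\<close>

definition w :: poly2 where "w = const2 (1 / R) * (b - const2 mid)"

definition \<beta> :: poly2 where "\<beta> = const2 (1 / 2) * (1 + w)"

definition bern :: "nat \<Rightarrow> nat \<Rightarrow> poly2" where
  "bern n k = const2 (real (n choose k)) * \<beta> ^ k * (1 - \<beta>) ^ (n - k)"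

text \<open>The value of \<open>b\<close> that corresponds to the node \<open>k / (2 n)\<close> of the Bernstein polynomials.\<close>

definition node :: "nat \<Rightarrow> nat \<Rightarrow> real" where
  "node n k = mid + R * (real k / real n - 1)"

definition clamp_value :: "real \<Rightarrow> real" where
  "clamp_value t = max lam (min Lam t)"

lemma R_pos: "R > 0"
  using le by (simp add: R_def)

lemma mid_eq: "mid = Lam + 1 / 2 - R / 2" "mid = lam - 1 / 2 + R / 2"
  by (simp_all add: mid_def R_def field_simps)

lemma half_w: "const2 (1 / 2) - w \<in> M" "const2 (1 / 2) + w \<in> M"
proof -
  have "const2 (1 / 2) - w = const2 (1 / R) * (const2 (1 / 2) + (const2 Lam - b))"
    using R_pos by (intro eval2_eqI) (simp add: w_def mid_eq(1) field_simps)
  also have "\<dots> \<in> M"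
    using R_pos by (intro M_const_mult M_add M_const upper) simp_all
  finally show "const2 (1 / 2) - w \<in> M" .
  have "const2 (1 / 2) + w = const2 (1 / R) * (const2 (1 / 2) + (b - const2 lam))"
    using R_pos by (intro eval2_eqI) (simp add: w_def mid_eq(2) field_simps)
  also have "\<dots> \<in> M"
    using R_pos by (intro M_const_mult M_add M_const lower) simp_all
  finally show "const2 (1 / 2) + w \<in> M" .
qed

text \<open>
  In a quadratic module products of members need not be members, but \<open>(u - w) (u + w)\<close> arises from
  multiplications with squares.
\<close>

lemma quarter_w: "const2 (1 / 4) - w\<^sup>2 \<in> M"
proof -
  have "const2 (1 / 4) - w\<^sup>2 =
      (const2 (1 / 2) - w)\<^sup>2 * (const2 (1 / 2) + w) + (const2 (1 / 2) + w)\<^sup>2 * (const2 (1 / 2) - w)"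
    by (intro eval2_eqI) (simp add: power2_eq_square field_simps)
  also have "\<dots> \<in> M"
    by (intro M_add M_square_mult half_w)
  finally show ?thesis .
qed

lemma power_w: "const2 ((1 / 4) ^ n) - w ^ (2 * n) \<in> M"
proof (induction n)
  case 0
  then show ?case using M_zero by (simp add: const2_simps)
next
  case (Suc n)
  have "(w ^ n)\<^sup>2 = w ^ (2 * n)"
    by (simp add: power_mult[symmetric] mult.commute)
  then have "const2 ((1 / 4) ^ Suc n) - w ^ (2 * Suc n) =
      const2 (1 / 4) * (const2 ((1 / 4) ^ n) - w ^ (2 * n)) + (w ^ n)\<^sup>2 * (const2 (1 / 4) - w\<^sup>2)"
    by (simp add: const2_simps(4)[symmetric] power2_eq_square algebra_simps)
  also have "\<dots> \<in> M"
    by (intro M_add M_const_mult M_square_mult Suc quarter_w) simp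
  finally show ?case .
qed

lemma const_minus_power_w:
  assumes "(1 / 4) ^ n \<le> c"
  shows "const2 c - w ^ (2 * n) \<in> M"
proof -
  have "const2 c - w ^ (2 * n) = const2 (c - (1 / 4) ^ n) + (const2 ((1 / 4) ^ n) - w ^ (2 * n))"
    by (simp add: const2_simps)
  also have "\<dots> \<in> M"
    using assms by (intro M_add M_const power_w) simp
  finally show ?thesis .
qed

lemma one_minus_w_square: "1 - w\<^sup>2 \<in> M"
  using const_minus_power_w[of 1 1] by (simp add: const2_simps)

lemma eval_w: "eval2 w z = 2 * eval2 \<beta> z - 1"
  by (simp add: \<beta>_def field_simps)

lemma eval_b: "eval2 b z = mid + R * (2 * eval2 \<beta> z - 1)"
  using R_pos by (simp add: \<beta>_def w_def field_simps)

lemma eval_bern: "eval2 (bern n k) z = Bernstein n k (eval2 \<beta> z)"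
  by (simp add: bern_def Bernstein_def)

lemma bern_even_square:
  assumes "even k" "k \<le> 2 * n"
  shows "\<exists>a. bern (2 * n) k = a\<^sup>2"
proof -
  obtain i where i: "k = 2 * i"
    using assms(1) by (elim evenE)
  have "bern (2 * n) k = (const2 (sqrt (real (2 * n choose k))) * \<beta> ^ i * (1 - \<beta>) ^ (n - i))\<^sup>2"
  proof (rule eval2_eqI)
    fix z
    have "2 * n - k = 2 * (n - i)" using i by simp
    then show "eval2 (bern (2 * n) k) z =
        eval2 ((const2 (sqrt (real (2 * n choose k))) * \<beta> ^ i * (1 - \<beta>) ^ (n - i))\<^sup>2) z"
      by (simp add: bern_def i power_mult_distrib power_mult[symmetric] mult.commute)
  qed
  then show ?thesis by blast
qed

lemma bern_even_mult:
  assumes "even k" "k \<le> 2 * n" "m \<in> M"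
  shows "bern (2 * n) k * m \<in> M"
  using bern_even_square[OF assms(1,2)] M_square_mult[OF assms(3)] by metis

lemma bern_odd_square_mult:
  assumes "odd k" "k \<le> 2 * n"
  shows "bern (2 * n) k * a\<^sup>2 \<in> M"
proof -
  obtain i where i: "k = 2 * i + 1"
    using assms(1) by (elim oddE)
  define j where "j = n - i - 1"
  have j: "2 * n - k = 2 * j + 1"
    using assms(2) i by (simp add: j_def)
  have "bern (2 * n) k * a\<^sup>2 =
      const2 (real (2 * n choose k) / 4) * ((\<beta> ^ i * (1 - \<beta>) ^ j * a)\<^sup>2 * (1 - w\<^sup>2))"
  proof (rule eval2_eqI)
    fix z
    have "eval2 (\<beta> * (1 - \<beta>)) z = eval2 (1 - w\<^sup>2) z / 4"
      by (simp add: eval_w power2_eq_square field_simps)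
    then have "eval2 (1 - w\<^sup>2) z = 4 * (eval2 \<beta> z * (1 - eval2 \<beta> z))"
      by simp
    moreover have "x ^ (2 * i + 1) = x * (x ^ i)\<^sup>2" "x ^ (2 * j + 1) = x * (x ^ j)\<^sup>2" for x :: real
      by (simp_all add: power_mult[symmetric] mult.commute)
    ultimately show "eval2 (bern (2 * n) k * a\<^sup>2) z =
        eval2 (const2 (real (2 * n choose k) / 4) * ((\<beta> ^ i * (1 - \<beta>) ^ j * a)\<^sup>2 * (1 - w\<^sup>2))) z"
      unfolding bern_def j by (simp add: i power_mult_distrib del: power_Suc)
  qed
  also have "\<dots> \<in> M"
    by (intro M_const_mult M_square_mult one_minus_w_square) simp
  finally show ?thesis .
qed

abbreviation evens :: "nat \<Rightarrow> nat set" where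
  "evens n \<equiv> {k. k \<le> 2 * n \<and> even k}"

abbreviation odds :: "nat \<Rightarrow> nat set" where
  "odds n \<equiv> {k. k \<le> 2 * n \<and> odd k}"

lemma sum_even_odd: "(\<Sum>k\<le>2 * n. f k) = (\<Sum>k\<in>evens n. f k) + (\<Sum>k\<in>odds n. f k)"
  for f :: "nat \<Rightarrow> 'a::comm_monoid_add"
  by (subst sum.union_disjoint[symmetric]) (auto intro!: sum.cong)

text \<open>
  The alternating sum of the Bernstein polynomials is \<open>(1 - 2 \<beta>)\<^bsup>2n\<^esup>\<close>. As \<open>w\<close> takes its values in
  \<open>[-1/2, 1/2]\<close>, twice the Bernstein polynomials with even index, which are squares, are a partition of unity
  up to an exponentially small error.
\<close>

lemma sum_bern_even: "(\<Sum>k\<in>evens n. const2 2 * bern (2 * n) k) = 1 + w ^ (2 * n)"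
proof (rule eval2_eqI)
  fix z
  define x where "x = eval2 \<beta> z"
  have all: "(\<Sum>k\<le>2 * n. Bernstein (2 * n) k x) = 1"
    by (rule sum_Bernstein)
  have "(\<Sum>k\<le>2 * n. (-1) ^ k * Bernstein (2 * n) k x) = (- x + (1 - x)) ^ (2 * n)"
    unfolding binomial_ring Bernstein_def power_minus[of x] by (simp add: mult_ac)
  also have "(- x + (1 - x)) ^ (2 * n) = eval2 w z ^ (2 * n)"
    unfolding eval_w x_def[symmetric] power_mult by (simp add: power2_eq_square algebra_simps)
  finally have alt: "(\<Sum>k\<le>2 * n. (-1) ^ k * Bernstein (2 * n) k x) = eval2 w z ^ (2 * n)" .
  have "(\<Sum>k\<in>evens n. Bernstein (2 * n) k x) + (\<Sum>k\<in>odds n. Bernstein (2 * n) k x) = 1"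
    using all unfolding sum_even_odd .
  moreover have "(\<Sum>k\<in>evens n. Bernstein (2 * n) k x) - (\<Sum>k\<in>odds n. Bernstein (2 * n) k x) = eval2 w z ^ (2 * n)"
    using alt unfolding sum_even_odd by (simp add: sum_negf)
  ultimately have "2 * (\<Sum>k\<in>evens n. Bernstein (2 * n) k x) = 1 + eval2 w z ^ (2 * n)"
    by simp
  then show "eval2 (\<Sum>k\<in>evens n. const2 2 * bern (2 * n) k) z = eval2 (1 + w ^ (2 * n)) z"
    by (simp add: eval_bern sum_distrib_left x_def)
qed

lemma Bernstein_variance:
  assumes "m \<ge> 1"
  shows "(\<Sum>k\<le>m. Bernstein m k x * (x - real k / real m)\<^sup>2) = x * (1 - x) / real m"
proof -
  have m: "real m \<noteq> 0" using assms by simp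
  have "Bernstein m k x * (x - real k / real m)\<^sup>2 =
      x\<^sup>2 * Bernstein m k x - (2 * x / real m - 1 / (real m)\<^sup>2) * (real k * Bernstein m k x) +
      (1 / (real m)\<^sup>2) * (real k * (real k - 1) * Bernstein m k x)" for k
    using m by (simp add: power2_eq_square field_simps)
  then have "(\<Sum>k\<le>m. Bernstein m k x * (x - real k / real m)\<^sup>2) =
      x\<^sup>2 * (\<Sum>k\<le>m. Bernstein m k x) - (2 * x / real m - 1 / (real m)\<^sup>2) * (\<Sum>k\<le>m. real k * Bernstein m k x) +
      (1 / (real m)\<^sup>2) * (\<Sum>k\<le>m. real k * (real k - 1) * Bernstein m k x)"
    by (simp only: sum.distrib sum_subtractf sum_distrib_left)
  also have "\<dots> = x * (1 - x) / real m"
    unfolding sum_Bernstein sum_k_Bernstein sum_kk_Bernstein using m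
    by (simp add: power2_eq_square field_simps)
  finally show ?thesis .
qed

lemma bern_variance:
  assumes n: "n \<ge> 1"
  shows "(\<Sum>k\<le>2 * n. const2 2 * bern (2 * n) k * (b - const2 (node n k))\<^sup>2) = const2 (R\<^sup>2 / real n) * (1 - w\<^sup>2)"
proof (rule eval2_eqI)
  fix z
  define x where "x = eval2 \<beta> z"
  have dist: "(eval2 b z - node n k)\<^sup>2 = 4 * R\<^sup>2 * (x - real k / real (2 * n))\<^sup>2" for k
    using n by (simp add: eval_b node_def x_def power2_eq_square field_simps)
  have "eval2 (\<Sum>k\<le>2 * n. const2 2 * bern (2 * n) k * (b - const2 (node n k))\<^sup>2) z =
      8 * R\<^sup>2 * (\<Sum>k\<le>2 * n. Bernstein (2 * n) k x * (x - real k / real (2 * n))\<^sup>2)"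
    by (simp add: eval_bern dist x_def[symmetric] sum_distrib_left mult_ac)
  also have "\<dots> = 8 * R\<^sup>2 * (x * (1 - x) / real (2 * n))"
    using Bernstein_variance[of "2 * n" x] n by simp
  also have "\<dots> = eval2 (const2 (R\<^sup>2 / real n) * (1 - w\<^sup>2)) z"
    using n by (simp add: eval_w x_def[symmetric] power2_eq_square field_simps)
  finally show "eval2 (\<Sum>k\<le>2 * n. const2 2 * bern (2 * n) k * (b - const2 (node n k))\<^sup>2) z =
      eval2 (const2 (R\<^sup>2 / real n) * (1 - w\<^sup>2)) z" .
qed

text \<open>
  On the fibre over \<open>t\<close> the term \<open>c (b - \<rho>)\<close> is of size \<open>c (t - \<rho>)\<close>. Algebraically, completing a square
  bounds \<open>c (b - t)\<close>. If \<open>t\<close> lies outside of \<open>[lam, Lam]\<close>, then the bounds for \<open>b\<close> in \<open>M\<close> take care of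
  the distance to the interval.
\<close>

lemma linear_term_bound:
  assumes \<epsilon>: "\<epsilon> > 0" and C: "C > 0" "\<bar>c\<bar> \<le> C" and near: "\<bar>c\<bar> * \<bar>clamp_value t - \<rho>\<bar> \<le> \<epsilon>"
  shows "const2 c * (b - const2 \<rho>) + const2 (2 * \<epsilon>) + const2 (C\<^sup>2 / (4 * \<epsilon>)) * (b - const2 t)\<^sup>2 \<in> M"
proof -
  let ?K = "C\<^sup>2 / (4 * \<epsilon>)" and ?v = "clamp_value t"
  have K: "?K > 0" using \<epsilon> C(1) by simp
  have sq: "const2 c * (b - const2 t) + const2 \<epsilon> + const2 ?K * (b - const2 t)\<^sup>2 \<in> M"
  proof -
    have c2: "c\<^sup>2 / (4 * ?K) \<le> \<epsilon>"
    proof -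
      have "c\<^sup>2 \<le> C\<^sup>2"
        using C by (simp add: abs_le_square_iff[symmetric])
      then show ?thesis using \<epsilon> C(1) by (simp add: field_simps)
    qed
    have "const2 c * (b - const2 t) + const2 \<epsilon> + const2 ?K * (b - const2 t)\<^sup>2 =
        const2 ?K * ((b - const2 t) + const2 (c / (2 * ?K)))\<^sup>2 + const2 (\<epsilon> - c\<^sup>2 / (4 * ?K))"
    proof (rule eval2_eqI)
      fix z
      have "c * x + \<epsilon> + k * x\<^sup>2 = k * (x + c / (2 * k))\<^sup>2 + (\<epsilon> - c\<^sup>2 / (4 * k))" if "k > 0" for k x :: real
        using that by (simp add: power2_eq_square field_simps)
      from this[OF K] show "eval2 (const2 c * (b - const2 t) + const2 \<epsilon> + const2 ?K * (b - const2 t)\<^sup>2) z =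
          eval2 (const2 ?K * ((b - const2 t) + const2 (c / (2 * ?K)))\<^sup>2 + const2 (\<epsilon> - c\<^sup>2 / (4 * ?K))) z"
        by simp
    qed
    also have "\<dots> \<in> M"
      using K c2 by (intro M_add M_const_mult M_square M_const) simp_all
    finally show ?thesis .
  qed
  have "const2 c * (b - const2 ?v) + const2 \<epsilon> + const2 ?K * (b - const2 t)\<^sup>2 \<in> M"
  proof (cases "c * (t - ?v) \<ge> 0")
    case True
    have "const2 c * (b - const2 ?v) + const2 \<epsilon> + const2 ?K * (b - const2 t)\<^sup>2 =
        (const2 c * (b - const2 t) + const2 \<epsilon> + const2 ?K * (b - const2 t)\<^sup>2) + const2 (c * (t - ?v))"
      by (simp add: const2_simps algebra_simps)
    also have "\<dots> \<in> M"
      using True by (intro M_add sq M_const)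
    finally show ?thesis .
  next
    case False
    have "const2 c * (b - const2 ?v) \<in> M"
    proof (cases "t > Lam")
      case True
      then have v: "?v = Lam" using le by (simp add: clamp_value_def)
      then have "c < 0" using False True by (auto simp: not_le mult_less_0_iff)
      then have "const2 (- c) * (const2 Lam - b) \<in> M"
        by (intro M_const_mult upper) simp
      then show ?thesis by (simp add: v const2_simps algebra_simps)
    next
      case not_above: False
      show ?thesis
      proof (cases "t < lam")
        case True
        then have v: "?v = lam" using le by (simp add: clamp_value_def)
        then have "c > 0" using False True by (auto simp: not_le mult_less_0_iff)
        then show ?thesis
          unfolding v by (intro M_const_mult lower) simp
      next
        case False': False
        then have "?v = t" using not_above by (simp add: clamp_value_def)
        then show ?thesis using False by simp
      qed
    qed
    then show ?thesis
      using \<epsilon> K by (intro M_add[OF M_add[OF _ M_const] M_const_mult[OF _ M_square]]) simp_all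
  qed
  moreover have "const2 (c * (?v - \<rho>) + \<epsilon>) \<in> M"
  proof (rule M_const)
    have "- (c * (?v - \<rho>)) \<le> \<bar>c\<bar> * \<bar>?v - \<rho>\<bar>"
      by (metis abs_ge_minus_self abs_mult)
    then show "0 \<le> c * (?v - \<rho>) + \<epsilon>"
      using near by linarith
  qed
  ultimately have "(const2 c * (b - const2 ?v) + const2 \<epsilon> + const2 ?K * (b - const2 t)\<^sup>2) + const2 (c * (?v - \<rho>) + \<epsilon>) \<in> M"
    by (rule M_add)
  also have "(const2 c * (b - const2 ?v) + const2 \<epsilon> + const2 ?K * (b - const2 t)\<^sup>2) + const2 (c * (?v - \<rho>) + \<epsilon>) =
      const2 c * (b - const2 \<rho>) + const2 (2 * \<epsilon>) + const2 ?K * (b - const2 t)\<^sup>2"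
    by (intro eval2_eqI) (simp add: algebra_simps)
  finally show ?thesis .
qed

text \<open>
  Summing up the squares that bound the linear terms, with the Bernstein polynomials as weights, one gets
  at most the variance of the Bernstein polynomials, which is of order \<open>1 / n\<close>.
\<close>

lemma glued_linear_terms:
  assumes \<epsilon>: "\<epsilon> > 0" and C: "C > 0" and n: "n \<ge> 1" "C\<^sup>2 / (4 * \<epsilon>) * (R\<^sup>2 / real n) \<le> \<epsilon>"
    and c: "\<And>k. \<bar>c k\<bar> \<le> C" "\<And>k. \<bar>c k\<bar> * \<bar>clamp_value (node n k) - \<rho> k\<bar> \<le> \<epsilon>"
  shows "const2 (5 * \<epsilon>) + (\<Sum>k\<in>evens n. const2 2 * bern (2 * n) k * (const2 (c k) * (b - const2 (\<rho> k)))) \<in> M"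
proof -
  let ?K = "C\<^sup>2 / (4 * \<epsilon>)"
  let ?B = "\<lambda>k. const2 2 * bern (2 * n) k"
  let ?V = "\<lambda>k. ?B k * (b - const2 (node n k))\<^sup>2"
  let ?T = "\<lambda>k. const2 (c k) * (b - const2 (\<rho> k)) + const2 (2 * \<epsilon>) + const2 ?K * (b - const2 (node n k))\<^sup>2"
  have K: "?K \<ge> 0" using \<epsilon> by simp
  have 1: "(\<Sum>k\<in>evens n. const2 2 * (bern (2 * n) k * ?T k)) \<in> M"
    by (intro M_sum M_const_mult bern_even_mult linear_term_bound \<epsilon> C c) auto
  have 2: "const2 (2 * \<epsilon>) * (const2 1 - w ^ (2 * n)) \<in> M"
    using \<epsilon> by (intro M_const_mult const_minus_power_w) (simp_all add: power_le_one)
  have 3: "const2 (\<epsilon> - ?K * (R\<^sup>2 / real n)) + const2 (?K * (R\<^sup>2 / real n)) * w\<^sup>2 \<in> M"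
    using n(2) K by (intro M_add M_const M_const_mult[OF _ M_square] mult_nonneg_nonneg) simp_all
  have 4: "const2 ?K * (\<Sum>k\<in>odds n. const2 2 * (bern (2 * n) k * (b - const2 (node n k))\<^sup>2)) \<in> M"
    by (intro M_const_mult M_sum bern_odd_square_mult K) auto
  have "(\<Sum>k\<in>evens n. const2 2 * (bern (2 * n) k * ?T k)) + const2 (2 * \<epsilon>) * (const2 1 - w ^ (2 * n)) +
      (const2 (\<epsilon> - ?K * (R\<^sup>2 / real n)) + const2 (?K * (R\<^sup>2 / real n)) * w\<^sup>2) +
      const2 ?K * (\<Sum>k\<in>odds n. const2 2 * (bern (2 * n) k * (b - const2 (node n k))\<^sup>2)) \<in> M" (is "?lhs \<in> M")
    by (rule M_add[OF M_add[OF M_add[OF 1 2] 3] 4])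
  also have "?lhs = const2 (5 * \<epsilon>) + (\<Sum>k\<in>evens n. ?B k * (const2 (c k) * (b - const2 (\<rho> k))))"
  proof -
    have var: "(\<Sum>k\<in>evens n. ?V k) + (\<Sum>k\<in>odds n. ?V k) = const2 (R\<^sup>2 / real n) * (1 - w\<^sup>2)"
      using bern_variance[OF n(1)] unfolding sum_even_odd .
    have "(\<Sum>k\<in>evens n. const2 2 * (bern (2 * n) k * ?T k)) =
        (\<Sum>k\<in>evens n. ?B k * (const2 (c k) * (b - const2 (\<rho> k)))) +
        const2 (2 * \<epsilon>) * (\<Sum>k\<in>evens n. ?B k) + const2 ?K * (\<Sum>k\<in>evens n. ?V k)"
      by (simp add: sum.distrib[symmetric] sum_distrib_left algebra_simps)
    also have "\<dots> = (\<Sum>k\<in>evens n. ?B k * (const2 (c k) * (b - const2 (\<rho> k)))) +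
        const2 (2 * \<epsilon>) * (1 + w ^ (2 * n)) + const2 ?K * (\<Sum>k\<in>evens n. ?V k)"
      by (simp only: sum_bern_even)
    finally have "?lhs = (\<Sum>k\<in>evens n. ?B k * (const2 (c k) * (b - const2 (\<rho> k)))) +
        const2 (2 * \<epsilon>) * (1 + w ^ (2 * n)) + const2 (2 * \<epsilon>) * (const2 1 - w ^ (2 * n)) +
        (const2 (\<epsilon> - ?K * (R\<^sup>2 / real n)) + const2 (?K * (R\<^sup>2 / real n)) * w\<^sup>2) +
        const2 ?K * ((\<Sum>k\<in>evens n. ?V k) + (\<Sum>k\<in>odds n. ?V k))"
      by (simp only: mult.assoc distrib_left add_ac)
    also have "\<dots> = const2 (5 * \<epsilon>) + (\<Sum>k\<in>evens n. ?B k * (const2 (c k) * (b - const2 (\<rho> k))))"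
      unfolding var by (intro eval2_eqI) (simp add: algebra_simps)
    finally show ?thesis .
  qed
  finally show ?thesis .
qed

lemma square_difference: "(const2 (1 / 2) * (a + 1))\<^sup>2 - (const2 (1 / 2) * (a - 1))\<^sup>2 = a"
  by (intro eval2_eqI) (simp add: power2_eq_square field_simps)

text \<open>
  If \<open>f\<close> is represented on each fibre with a bounded degree of the multiplier \<open>h\<close>, then by compactness
  of \<open>[lam, Lam]\<close> finitely many of these representations suffice for a given precision. They are
  combined by the squares \<open>bern (2 * n) k\<close>. The multipliers \<open>h\<close> contribute small polynomials in \<open>b\<close> times
  the finitely many monomials of bounded degree; this is why \<open>q\<close> can be chosen independently of \<open>\<epsilon>\<close>.
\<close>

lemma glue_fibre_representations:
  assumes fib: "\<And>t. t \<in> {lam..Lam} \<Longrightarrow> \<exists>m h. m \<in> M \<and> deg_le D h \<and> f = m + h * (b - const2 t)"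
  shows "f \<in> seq_closure M"
proof -
  obtain m where "\<forall>t\<in>{lam..Lam}. \<exists>h. m t \<in> M \<and> deg_le D h \<and> f = m t + h * (b - const2 t)"
    using bchoice[of "{lam..Lam}" "\<lambda>t m. \<exists>h. m \<in> M \<and> deg_le D h \<and> f = m + h * (b - const2 t)"] fib by blast
  then obtain h where mh: "\<forall>t\<in>{lam..Lam}. m t \<in> M \<and> deg_le D (h t) \<and> f = m t + h t * (b - const2 t)"
    using bchoice[of "{lam..Lam}" "\<lambda>t h. m t \<in> M \<and> deg_le D h \<and> f = m t + h * (b - const2 t)"] by blast
  define plus where "plus a = const2 (1 / 2) * (a + 1)" for a :: poly2
  define minus where "minus a = const2 (1 / 2) * (a - 1)" for a :: poly2
  have pm: "(plus a)\<^sup>2 - (minus a)\<^sup>2 = a" for a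
    unfolding plus_def minus_def by (rule square_difference)
  define q where "q = (plus f)\<^sup>2 + (\<Sum>u\<in>exponents D. (plus (mono2 u))\<^sup>2 + (minus (mono2 u))\<^sup>2)"
  have "f + const2 \<epsilon> * q \<in> M" if \<epsilon>: "\<epsilon> > 0" for \<epsilon>
  proof -
    \<comment> \<open>The factor \<open>5\<close> is the one in the lemma \<open>glued_linear_terms\<close>.\<close>
    define \<eta> where "\<eta> = \<epsilon> / 5"
    have \<eta>: "\<eta> > 0" using \<epsilon> by (simp add: \<eta>_def)
    define B where "B t = (\<Sum>u\<in>exponents D. \<bar>coeff_at (h t) u\<bar>) + 1" for t
    have B: "B t > 0" "\<And>u. u \<in> exponents D \<Longrightarrow> \<bar>coeff_at (h t) u\<bar> \<le> B t" for t
    proof -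
      have "0 \<le> (\<Sum>u\<in>exponents D. \<bar>coeff_at (h t) u\<bar>)"
        by (simp add: sum_nonneg)
      then show "B t > 0" unfolding B_def by linarith
      show "\<bar>coeff_at (h t) u\<bar> \<le> B t" if "u \<in> exponents D" for u
        using member_le_sum[OF that, of "\<lambda>u. \<bar>coeff_at (h t) u\<bar>"] unfolding B_def by simp
    qed
    obtain F where F: "F \<subseteq> {lam..Lam}" "finite F" "{lam..Lam} \<subseteq> (\<Union>t\<in>F. ball t (\<eta> / B t))"
    proof (rule compactE_image[of "{lam..Lam}" "{lam..Lam}" "\<lambda>t. ball t (\<eta> / B t)"])
      show "{lam..Lam} \<subseteq> (\<Union>t\<in>{lam..Lam}. ball t (\<eta> / B t))"
      proof
        fix t
        assume "t \<in> {lam..Lam}"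
        moreover have "t \<in> ball t (\<eta> / B t)"
          using \<eta> B(1)[of t] by simp
        ultimately show "t \<in> (\<Union>t\<in>{lam..Lam}. ball t (\<eta> / B t))"
          by blast
      qed
    qed auto
    define C where "C = (\<Sum>t\<in>F. B t) + 1"
    have C: "C > 0" "\<And>t. t \<in> F \<Longrightarrow> B t \<le> C"
    proof -
      have "0 \<le> (\<Sum>t\<in>F. B t)"
        using B(1) by (simp add: sum_nonneg less_imp_le)
      then show "C > 0" unfolding C_def by linarith
      show "B t \<le> C" if "t \<in> F" for t
      proof -
        have "B t \<le> (\<Sum>t\<in>F. B t)"
          by (rule member_le_sum[OF that _ F(2)]) (rule less_imp_le[OF B(1)])
        then show ?thesis unfolding C_def by linarith
      qed
    qed
    define K where "K = C\<^sup>2 / (4 * \<eta>)"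
    obtain n1 :: nat where n1: "K * R\<^sup>2 / \<eta> < real n1"
      using reals_Archimedean2 by blast
    obtain n2 where n2: "(1 / 4 :: real) ^ n2 < \<epsilon>"
      using real_arch_pow_inv[OF \<epsilon>, of "1 / 4"] by auto
    define n where "n = n1 + n2 + 1"
    have n: "n \<ge> 1" "K * (R\<^sup>2 / real n) \<le> \<eta>" "(1 / 4 :: real) ^ n \<le> \<epsilon>"
    proof -
      show "n \<ge> 1" by (simp add: n_def)
      have "K * R\<^sup>2 / \<eta> \<le> real n"
        using n1 by (simp add: n_def)
      then show "K * (R\<^sup>2 / real n) \<le> \<eta>"
        using \<eta> by (simp add: field_simps n_def)
      have "(1 / 4 :: real) ^ n \<le> (1 / 4) ^ n2"
        by (intro power_decreasing) (simp_all add: n_def)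
      then show "(1 / 4 :: real) ^ n \<le> \<epsilon>" using n2 by linarith
    qed
    have "\<exists>t. t \<in> F \<and> clamp_value (node n k) \<in> ball t (\<eta> / B t)" for k
    proof -
      have "clamp_value (node n k) \<in> {lam..Lam}"
        using le by (simp add: clamp_value_def)
      then show ?thesis using F(3) by blast
    qed
    then obtain \<rho> where \<rho>: "\<rho> k \<in> F" "clamp_value (node n k) \<in> ball (\<rho> k) (\<eta> / B (\<rho> k))" for k
      using choice[of "\<lambda>k t. t \<in> F \<and> clamp_value (node n k) \<in> ball t (\<eta> / B t)"] by blast
    have \<rho>I: "\<rho> k \<in> {lam..Lam}" for k
      using \<rho>(1) F(1) by blast
    let ?B = "\<lambda>k. const2 2 * bern (2 * n) k"
    define \<delta> where "\<delta> u = (\<Sum>k\<in>evens n. ?B k * (const2 (coeff_at (h (\<rho> k)) u) * (b - const2 (\<rho> k))))" for u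
    have coeff_le: "\<bar>coeff_at (h (\<rho> k)) u\<bar> \<le> C" if "u \<in> exponents D" for k u
      using B(2)[OF that] C(2)[OF \<rho>(1)] by (rule order_trans)
    have near: "\<bar>coeff_at (h (\<rho> k)) u\<bar> * \<bar>clamp_value (node n k) - \<rho> k\<bar> \<le> \<eta>" if "u \<in> exponents D" for k u
    proof -
      have "\<bar>clamp_value (node n k) - \<rho> k\<bar> \<le> \<eta> / B (\<rho> k)"
        using \<rho>(2)[of k] by (simp add: dist_real_def abs_minus_commute)
      then have "\<bar>coeff_at (h (\<rho> k)) u\<bar> * \<bar>clamp_value (node n k) - \<rho> k\<bar> \<le> B (\<rho> k) * (\<eta> / B (\<rho> k))"
        using B(2)[OF that] B(1)[of "\<rho> k"] by (intro mult_mono) auto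
      then show ?thesis using B(1)[of "\<rho> k"] by simp
    qed
    have \<delta>: "const2 \<epsilon> + \<delta> u \<in> M" "const2 \<epsilon> - \<delta> u \<in> M" if u: "u \<in> exponents D" for u
    proof -
      have eq: "5 * \<eta> = \<epsilon>" by (simp add: \<eta>_def)
      show "const2 \<epsilon> + \<delta> u \<in> M"
        using glued_linear_terms[OF \<eta> C(1) n(1) n(2)[unfolded K_def], of "\<lambda>k. coeff_at (h (\<rho> k)) u" \<rho>]
          coeff_le[OF u] near[OF u] unfolding \<delta>_def eq by blast
      have "const2 \<epsilon> + (\<Sum>k\<in>evens n. ?B k * (const2 (- coeff_at (h (\<rho> k)) u) * (b - const2 (\<rho> k)))) \<in> M"
        using glued_linear_terms[OF \<eta> C(1) n(1) n(2)[unfolded K_def], of "\<lambda>k. - coeff_at (h (\<rho> k)) u" \<rho>]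
          coeff_le[OF u] near[OF u] unfolding eq abs_minus_cancel by blast
      also have "(\<Sum>k\<in>evens n. ?B k * (const2 (- coeff_at (h (\<rho> k)) u) * (b - const2 (\<rho> k)))) = - \<delta> u"
        unfolding \<delta>_def const2_simps(5) by (simp add: sum_negf)
      finally show "const2 \<epsilon> - \<delta> u \<in> M" by simp
    qed
    have fk: "f = m (\<rho> k) + h (\<rho> k) * (b - const2 (\<rho> k))" and mk: "m (\<rho> k) \<in> M" for k
      using mh \<rho>I by blast+
    have hk: "h (\<rho> k) = (\<Sum>u\<in>exponents D. const2 (coeff_at (h (\<rho> k)) u) * mono2 u)" for k
      using poly_of_coeff_at[of D "h (\<rho> k)"] mh \<rho>I unfolding poly_of_def by metis
    have "(1 + w ^ (2 * n)) * f = (\<Sum>k\<in>evens n. ?B k * (m (\<rho> k) + h (\<rho> k) * (b - const2 (\<rho> k))))"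
      unfolding sum_bern_even[symmetric] sum_distrib_right by (intro sum.cong refl arg_cong[where f = "(*) _"] fk)
    also have "\<dots> = (\<Sum>k\<in>evens n. ?B k * m (\<rho> k)) + (\<Sum>k\<in>evens n. ?B k * (h (\<rho> k) * (b - const2 (\<rho> k))))"
      by (simp add: distrib_left sum.distrib)
    also have "(\<Sum>k\<in>evens n. ?B k * (h (\<rho> k) * (b - const2 (\<rho> k)))) =
        (\<Sum>k\<in>evens n. \<Sum>u\<in>exponents D. mono2 u * (?B k * (const2 (coeff_at (h (\<rho> k)) u) * (b - const2 (\<rho> k)))))"
      by (subst hk) (simp only: sum_distrib_left sum_distrib_right mult_ac)
    also have "\<dots> = (\<Sum>u\<in>exponents D. mono2 u * \<delta> u)"
      unfolding \<delta>_def sum_distrib_left by (rule sum.swap)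
    finally have Wf: "(1 + w ^ (2 * n)) * f = (\<Sum>k\<in>evens n. ?B k * m (\<rho> k)) + (\<Sum>u\<in>exponents D. mono2 u * \<delta> u)" .
    have "f + const2 \<epsilon> * q = (\<Sum>k\<in>evens n. const2 2 * (bern (2 * n) k * m (\<rho> k))) +
        (\<Sum>u\<in>exponents D. (plus (mono2 u))\<^sup>2 * (const2 \<epsilon> + \<delta> u) + (minus (mono2 u))\<^sup>2 * (const2 \<epsilon> - \<delta> u)) +
        ((plus f)\<^sup>2 * (const2 \<epsilon> - w ^ (2 * n)) + (w ^ n * minus f)\<^sup>2)"
    proof -
      have "(plus (mono2 u))\<^sup>2 * (const2 \<epsilon> + \<delta> u) + (minus (mono2 u))\<^sup>2 * (const2 \<epsilon> - \<delta> u) =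
          mono2 u * \<delta> u + const2 \<epsilon> * ((plus (mono2 u))\<^sup>2 + (minus (mono2 u))\<^sup>2)" for u
      proof -
        have "mono2 u * \<delta> u = ((plus (mono2 u))\<^sup>2 - (minus (mono2 u))\<^sup>2) * \<delta> u"
          by (simp only: pm)
        then show ?thesis by (simp add: algebra_simps)
      qed
      then have 1: "(\<Sum>u\<in>exponents D. (plus (mono2 u))\<^sup>2 * (const2 \<epsilon> + \<delta> u) + (minus (mono2 u))\<^sup>2 * (const2 \<epsilon> - \<delta> u)) =
          (\<Sum>u\<in>exponents D. mono2 u * \<delta> u) +
          const2 \<epsilon> * (\<Sum>u\<in>exponents D. (plus (mono2 u))\<^sup>2 + (minus (mono2 u))\<^sup>2)"
        unfolding sum_distrib_left sum.distrib[symmetric] by (intro sum.cong refl)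
      have expand: "(w ^ n * minus f)\<^sup>2 = w ^ (2 * n) * (minus f)\<^sup>2"
        by (simp add: power_mult_distrib power_mult[symmetric] mult.commute)
      have split: "w ^ (2 * n) * f = w ^ (2 * n) * (plus f)\<^sup>2 - w ^ (2 * n) * (minus f)\<^sup>2"
        by (simp add: pm flip: right_diff_distrib)
      have 2: "(plus f)\<^sup>2 * (const2 \<epsilon> - w ^ (2 * n)) + (w ^ n * minus f)\<^sup>2 =
          const2 \<epsilon> * (plus f)\<^sup>2 - w ^ (2 * n) * f"
        unfolding expand split by (simp add: algebra_simps)
      show ?thesis
      proof -
        have "f + const2 \<epsilon> * q = (1 + w ^ (2 * n)) * f - w ^ (2 * n) * f + const2 \<epsilon> * q"
          by (simp add: algebra_simps)
        then show ?thesis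
          unfolding Wf 1 2 q_def by (simp add: algebra_simps)
      qed
    qed
    also have "\<dots> \<in> M"
      by (intro M_add M_sum M_const_mult M_square_mult M_square bern_even_mult mk \<delta> const_minus_power_w n) auto
    finally show ?thesis .
  qed
  then show ?thesis
    unfolding seq_closure_def by blast
qed

end

section \<open>Approaching a point at infinity\<close>

text \<open>
  The conditions that define \<open>tends_to_infinity_along\<close> up to \<open>\<epsilon>\<close> describe an open neighbourhood of the
  point at infinity in the projective plane.
\<close>

lemma closure_of_affine_sequence:
  assumes nz: "(r, s) \<noteq> (0, 0)"
    and cl: "proj2 (- s) r 0 \<in> proj_topology closure_of (affine_embedding ` S)"
  obtains z where "\<And>n. z n \<in> S" "tends_to_infinity_along r s z"
proof -
  \<comment> \<open>The set \<open>U\<close> of lines is given by a condition \<open>P\<close> on their nonzero vectors that is invariant under scaling.\<close>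
  have near: "\<exists>z\<in>S. \<bar>across r s z\<bar> < \<epsilon> * \<bar>along r s z\<bar> \<and> 1 < \<epsilon> * \<bar>along r s z\<bar>" if \<epsilon>: "\<epsilon> > 0" for \<epsilon>
  proof -
    define P where "P v \<longleftrightarrow> \<bar>across r s (fst v, fst (snd v))\<bar> < \<epsilon> * \<bar>along r s (fst v, fst (snd v))\<bar> \<and>
        \<bar>snd (snd v)\<bar> < \<epsilon> * \<bar>along r s (fst v, fst (snd v))\<bar>" for v :: "real \<times> real \<times> real"
    define U where "U = {span {v} | v. P v}"
    have P_nz: "v \<noteq> 0" if "P v" for v
      using that by (auto simp: P_def along_def across_def)
    have P_scale: "P (k *\<^sub>R v)" if "P v" "k \<noteq> 0" for k v
    proof -
      have "along r s (k * x, k * y) = k * along r s (x, y)" "across r s (k * x, k * y) = k * across r s (x, y)" for x y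
        by (simp_all add: along_def across_def algebra_simps)
      then show ?thesis
        using that by (simp add: P_def abs_mult)
    qed
    have mem_U: "span {v} \<in> U \<longleftrightarrow> P v" if "v \<noteq> 0" for v
    proof
      assume "span {v} \<in> U"
      then obtain v' where v': "span {v} = span {v'}" "P v'"
        by (auto simp: U_def)
      have "v \<in> span {v'}"
        using v'(1) by (metis insertI1 span_base)
      then obtain k where k: "v = k *\<^sub>R v'"
        by (auto simp: span_singleton)
      then have "k \<noteq> 0" using that by auto
      then show "P v" using P_scale[OF v'(2)] k by simp
    next
      assume "P v"
      then show "span {v} \<in> U"
        unfolding U_def by blast
    qed
    have "openin proj_topology U"
      unfolding openin_proj_topology
    proof
      show "U \<subseteq> proj_points"
        using P_nz unfolding U_def proj_points_def by blast
      have "{v. v \<noteq> 0 \<and> span {v} \<in> U} = {v. P v}"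
        using mem_U P_nz by blast
      also have "open \<dots>"
        unfolding P_def along_def across_def fst_conv snd_conv
        by (intro open_Collect_conj open_Collect_less continuous_intros) (use nz in \<open>auto simp: sum_power2_eq_zero_iff\<close>)
      finally show "open {v. v \<noteq> 0 \<and> span {v} \<in> U}" .
    qed
    moreover have "proj2 (- s) r 0 \<in> U"
    proof -
      have "r\<^sup>2 + s\<^sup>2 \<noteq> 0"
        using nz by (simp add: sum_power2_eq_zero_iff)
      then have "along r s (- s, r) = 1" "across r s (- s, r) = 0"
        by (simp_all add: along_def across_def power2_eq_square add.commute)
      then have "P (- s, r, 0)"
        using \<epsilon> by (simp add: P_def)
      then show ?thesis unfolding U_def proj2_def by blast
    qed
    ultimately obtain z where z: "z \<in> S" "affine_embedding z \<in> U"
      using cl unfolding in_closure_of by blast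
    have "(fst z, snd z, 1) \<noteq> (0 :: real \<times> real \<times> real)"
      by (simp add: zero_prod_def)
    then have "P (fst z, snd z, 1)"
      using z(2) mem_U by (simp add: affine_embedding_def proj2_def)
    then show ?thesis
      using z(1) by (intro bexI[of _ z]) (auto simp: P_def)
  qed
  have "\<exists>z\<in>S. \<bar>across r s z\<bar> < 1 / (real n + 1) * \<bar>along r s z\<bar> \<and> 1 < 1 / (real n + 1) * \<bar>along r s z\<bar>" for n
    by (rule near) simp
  then obtain z where z: "\<And>n. z n \<in> S" "\<And>n. \<bar>across r s (z n)\<bar> < 1 / (real n + 1) * \<bar>along r s (z n)\<bar>"
      "\<And>n. 1 < 1 / (real n + 1) * \<bar>along r s (z n)\<bar>"
    using choice[of "\<lambda>n z. z \<in> S \<and> \<bar>across r s z\<bar> < 1 / (real n + 1) * \<bar>along r s z\<bar> \<and>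
      1 < 1 / (real n + 1) * \<bar>along r s z\<bar>"] by blast
  have big: "\<bar>along r s (z n)\<bar> > real n + 1" for n
    using z(3)[of n] by (simp add: field_simps)
  have pos: "\<bar>along r s (z n)\<bar> > 0" for n
    using big[of n] by linarith
  have "tends_to_infinity_along r s z"
    unfolding tends_to_infinity_along_def
  proof (intro conjI allI)
    show "1 \<le> \<bar>along r s (z n)\<bar>" for n
      using big[of n] by linarith
    show "(\<lambda>n. 1 / along r s (z n)) \<longlonglongrightarrow> 0"
    proof (rule tendsto_zero_if_le_inverse)
      show "\<bar>1 / along r s (z n)\<bar> \<le> 1 / (real n + 1)" for n
        using big[of n] by (simp add: abs_divide frac_le)
    qed
    show "(\<lambda>n. across r s (z n) / along r s (z n)) \<longlonglongrightarrow> 0"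
    proof (rule tendsto_zero_if_le_inverse)
      show "\<bar>across r s (z n) / along r s (z n)\<bar> \<le> 1 / (real n + 1)" for n
        using z(2)[of n] pos[of n] by (simp add: abs_divide pos_divide_le_eq)
    qed
  qed
  with z(1) show ?thesis using that by blast
qed

lemma tdegree_eqI:
  assumes "deg_le d p" "hom_part d p \<noteq> 0"
  shows "tdegree p = d"
proof (rule antisym)
  show "tdegree p \<le> d"
    using assms(1) by (rule tdegree_le)
  show "d \<le> tdegree p"
  proof (rule ccontr)
    assume "\<not> d \<le> tdegree p"
    then have "deg_lt d p"
      using deg_lt_mono[OF deg_le_tdegree[of p]] by simp
    then show False
      using assms(2) hom_part_deg_lt by blast
  qed
qed

lemma point_at_infinity:
  assumes "(x, y) \<noteq> (0, 0)" "eval2 (hom_part (tdegree p) p) (x, y) = 0"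
  shows "proj2 x y 0 \<in> points_at_infinity p"
proof -
  have "homogenization p x y 0 = (\<Sum>k\<le>tdegree p. if k = tdegree p then eval2 (hom_part (tdegree p) p) (x, y) else 0)"
    unfolding homogenization_def by (intro sum.cong) (auto simp: power_0_left)
  then have "homogenization p x y 0 = 0"
    using assms(2) by simp
  then show ?thesis
    using assms(1) unfolding points_at_infinity_def projective_curve_def by fastforce
qed

section \<open>The sequential closure\<close>

lemma seq_closure_subset_double_dual: "seq_closure M \<subseteq> double_dual M"
proof
  fix f
  assume "f \<in> seq_closure M"
  then obtain q where q: "\<And>\<epsilon>. \<epsilon> > 0 \<Longrightarrow> f + const2 \<epsilon> * q \<in> M"
    by (auto simp: seq_closure_def)
  have "L f \<ge> 0" if L: "linear_functional L" "\<forall>m\<in>M. L m \<ge> 0" for L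
  proof -
    have pos: "L f + \<epsilon> * L q \<ge> 0" if "\<epsilon> > 0" for \<epsilon>
    proof -
      have "L (f + const2 \<epsilon> * q) \<ge> 0"
        using L(2) q[OF that] by blast
      then show ?thesis
        using L(1) by (simp add: linear_functional_iff)
    qed
    show ?thesis
    proof (rule tendsto_lowerbound[where F = "at_right 0" and f = "\<lambda>\<epsilon>. L f + \<epsilon> * L q"])
      show "((\<lambda>\<epsilon>. L f + \<epsilon> * L q) \<longlongrightarrow> L f) (at_right 0)"
        by (auto intro!: tendsto_eq_intros)
      show "\<forall>\<^sub>F \<epsilon> in at_right 0. 0 \<le> L f + \<epsilon> * L q"
        using pos by (auto simp: eventually_at_right_field intro!: exI[of _ 1])
    qed simp
  qed
  then show "f \<in> double_dual M"
    by (simp add: double_dual_def)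
qed

lemma double_dual_mono: "M \<subseteq> N \<Longrightarrow> double_dual M \<subseteq> double_dual N"
  unfolding double_dual_def by blast

lemma double_dual_subset_Pos: "double_dual M \<subseteq> Pos (nonneg_set M)"
proof
  fix f
  assume f: "f \<in> double_dual M"
  have "eval2 f z \<ge> 0" if "z \<in> nonneg_set M" for z
  proof -
    have "linear_functional (\<lambda>p. eval2 p z)"
      by (simp add: linear_functional_iff)
    moreover have "\<forall>m\<in>M. eval2 m z \<ge> 0"
      using that by (simp add: nonneg_set_def)
    ultimately show ?thesis
      using f unfolding double_dual_def by blast
  qed
  then show "f \<in> Pos (nonneg_set M)"
    by (simp add: Pos_def)
qed

lemma subset_fibre_module: "M \<subseteq> fibre_module M p"
proof
  fix m
  assume "m \<in> M"
  then show "m \<in> fibre_module M p"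
    unfolding fibre_module_def by (intro CollectI exI[of _ m] exI[of _ 0]) simp
qed

lemma finitely_generated_qmE:
  fixes M :: "poly2 set"
  assumes "finitely_generated_qm M"
  obtains q :: nat and g where "M = {\<Sum>j\<le>q. \<sigma> j * g j | \<sigma>. \<forall>j\<le>q. \<sigma> j \<in> sums_of_squares}"
    "\<And>j. j \<le> q \<Longrightarrow> g j \<in> M"
proof -
  obtain q :: nat and f where M: "M = {\<sigma> 0 + (\<Sum>i=1..q. \<sigma> i * f i) | \<sigma>. \<forall>i\<le>q. \<sigma> i \<in> sums_of_squares}"
    using assms unfolding finitely_generated_qm_def by blast
  define g where "g j = (if j = 0 then 1 else f j)" for j
  have "(\<Sum>j\<le>q. \<sigma> j * g j) = \<sigma> 0 + (\<Sum>i=1..q. \<sigma> i * f i)" for \<sigma>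
  proof -
    have "{..q} = insert 0 {1..q}" by auto
    then have "(\<Sum>j\<le>q. \<sigma> j * g j) = \<sigma> 0 * g 0 + (\<Sum>j=1..q. \<sigma> j * g j)"
      by simp
    also have "(\<Sum>j=1..q. \<sigma> j * g j) = (\<Sum>j=1..q. \<sigma> j * f j)"
      by (intro sum.cong) (auto simp: g_def)
    finally show ?thesis by (simp add: g_def)
  qed
  then have M': "M = {\<Sum>j\<le>q. \<sigma> j * g j | \<sigma>. \<forall>j\<le>q. \<sigma> j \<in> sums_of_squares}"
    using M by simp
  moreover have "g j \<in> M" if "j \<le> q" for j
  proof -
    have "(0 :: poly2) \<in> sums_of_squares" "(1 :: poly2) \<in> sums_of_squares"
      using sums_of_squares_sum[of "\<lambda>_. 0" 0] sums_of_squares_sum[of "\<lambda>_. 1" 1] by simp_all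
    then have "\<forall>i\<le>q. (if i = j then 1 else 0 :: poly2) \<in> sums_of_squares"
      by simp
    moreover have "g j = (\<Sum>i\<le>q. (if i = j then 1 else 0) * g i)"
      using that by (simp add: if_distrib[of "\<lambda>x. x * _"] cong: if_cong)
    ultimately show ?thesis
      unfolding M' mem_Collect_eq by (intro exI[of _ "\<lambda>i. if i = j then 1 else 0"] conjI)
  qed
  ultimately show ?thesis by (rule that)
qed

theorem theorem5p5:
  fixes M :: "poly2 set" and b :: poly2 and d :: nat
    and lam Lam :: real and r s :: "nat \<Rightarrow> real"
  assumes "quadratic_module M" and "finitely_generated_qm M"
    and "tdegree b = d" and "d > 0"
    and "lam \<le> Lam" and "const2 Lam - b \<in> M" and "b - const2 lam \<in> M"
    and "hom_part d b = (\<Prod>i=1..d. const2 (r i) * varX + const2 (s i) * varY)"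
    and "\<forall>i\<in>{1..d}. (r i, s i) \<noteq> (0, 0)"
    and "inj_on (\<lambda>i. span {(r i, s i)}) {1..d}"
    and "\<forall>t\<in>{lam..Lam}. points_at_infinity (b - const2 t) \<subseteq>
           proj_topology closure_of
             (affine_embedding ` (nonneg_set M \<inter> real_curve (b - const2 t)))"
  shows "seq_closure M = double_dual M \<and>
    ((\<forall>t\<in>{lam..Lam}. SMP (fibre_module M (b - const2 t))) \<longrightarrow> ddagger_property M)"
proof -
  interpret bounded_qm M b lam Lam
    by (rule bounded_qm.intro[OF assms(1,5-7)])
  obtain q :: nat and g where M_gen: "M = {\<Sum>j\<le>q. \<sigma> j * g j | \<sigma>. \<forall>j\<le>q. \<sigma> j \<in> sums_of_squares}"
    and g: "\<And>j. j \<le> q \<Longrightarrow> g j \<in> M"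
    using that by (rule finitely_generated_qmE[OF assms(2)])
  define m where "m = (\<Sum>j\<le>q. tdegree (g j))"
  have deg_g: "deg_le m (g j)" if "j \<le> q" for j
  proof -
    have "tdegree (g j) \<le> m"
      unfolding m_def using that by (intro member_le_sum) auto
    then show ?thesis
      by (intro deg_lt_mono[OF deg_le_tdegree]) simp
  qed
  have nz: "\<And>i. i \<in> {1..d} \<Longrightarrow> (r i, s i) \<noteq> (0, 0)"
    using assms(9) by blast
  have deg_b: "deg_le d b"
    using deg_le_tdegree[of b] assms(3) by simp

  \<comment> \<open>The degrees \<open>d\<close> and \<open>m\<close> are the same for all fibres, and so are the bounds derived from them.\<close>
  have fibre: "\<exists>\<phi>. curve_module d (b - const2 t) r s \<phi> (nonneg_set M \<inter> real_curve (b - const2 t)) q g m"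
    if t: "t \<in> {lam..Lam}" for t
  proof -
    let ?p = "b - const2 t" and ?Z = "nonneg_set M \<inter> real_curve (b - const2 t)"
    have const_t: "deg_lt d (const2 t)"
      using assms(4) by (intro deg_lt_mono[OF deg_le_const2]) simp
    have deg_p: "deg_le d ?p"
      by (intro deg_lt_diff deg_b deg_lt_mono[OF const_t]) simp
    have "hom_part d ?p + hom_part d (const2 t) = hom_part d b"
      by (simp flip: hom_part_add)
    then have top: "hom_part d ?p = (\<Prod>i=1..d. const2 (r i) * varX + const2 (s i) * varY)"
      using assms(8) hom_part_deg_lt[OF const_t] by simp
    have "const2 a * varX + const2 c * varY \<noteq> 0" if "(a, c) \<noteq> (0, 0)" for a c
    proof
      assume "const2 a * varX + const2 c * varY = 0"
      then have "eval2 (const2 a * varX + const2 c * varY) (a, c) = 0"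
        by (simp only: eval2_simps)
      then show False
        using that by (simp add: sum_squares_eq_zero_iff)
    qed
    then have "hom_part d ?p \<noteq> 0"
      unfolding top using nz by (simp add: prod_zero_iff)
    then have tdeg: "tdegree ?p = d"
      using deg_p by (intro tdegree_eqI)
    define branch where "branch i \<phi> \<longleftrightarrow> ring_map \<phi> \<and> (\<forall>a. \<phi> (const2 a) = fls_const a) \<and> \<phi> b = fls_const t \<and>
      (\<forall>n a. deg_le n a \<longrightarrow> (\<exists>F. fls_X ^ n * \<phi> a = fps_to_fls F \<and> fps_nth F 0 = eval2 (hom_part n a) (- s i, r i))) \<and>
      (\<forall>z a. tends_to_infinity_along (r i) (s i) z \<longrightarrow> (\<forall>n. eval2 b (z n) = t) \<longrightarrow>
        laurent_approx (\<lambda>n. 1 / along (r i) (s i) (z n)) (\<phi> a) (\<lambda>n. eval2 a (z n)))" for i \<phi>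
    have "\<exists>\<phi>. branch i \<phi>" if i: "i \<in> {1..d}" for i
      unfolding branch_def
      by (rule branch_exists[OF assms(4) deg_b assms(8) finite_atLeastAtMost i nz assms(10), where c = t]) blast+
    then obtain \<phi> where \<phi>: "\<forall>i\<in>{1..d}. branch i (\<phi> i)"
      using bchoice[of "{1..d}" branch] by blast
    have "curve_module d ?p r s \<phi> ?Z q g m"
    proof unfold_locales
      show "0 < d" "deg_le d ?p"
        "hom_part d ?p = (\<Prod>j = 1..d. const2 (r j) * varX + const2 (s j) * varY)"
        "inj_on (\<lambda>j. span {(r j, s j)}) {1..d}"
        by (fact assms(4) deg_p top assms(10))+
      fix i
      assume i: "i \<in> {1..d}"
      then have br: "branch i (\<phi> i)" using \<phi> by blast
      show "(r i, s i) \<noteq> (0, 0)" by (rule nz[OF i])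
      show "ring_map (\<phi> i)" "\<phi> i (const2 a) = fls_const a" for a
        using br unfolding branch_def by blast+
      show "\<phi> i ?p = 0"
        using br unfolding branch_def by (simp add: ring_mapD)
      show "\<exists>F. fls_X ^ n * \<phi> i a = fps_to_fls F \<and> fps_nth F 0 = eval2 (hom_part n a) (- s i, r i)"
        if "deg_le n a" for n a
        using br that unfolding branch_def by blast
      have "eval2 (hom_part d ?p) (- s i, r i) = 0"
        unfolding top using i by (simp add: prod_zero_iff) (auto intro!: bexI[of _ i])
      then have "proj2 (- s i) (r i) 0 \<in> points_at_infinity ?p"
        using nz[OF i] tdeg by (intro point_at_infinity) auto
      then have "proj2 (- s i) (r i) 0 \<in> proj_topology closure_of (affine_embedding ` ?Z)"
        using assms(11) t by blast
      then obtain z where z: "\<And>n. z n \<in> ?Z" "tends_to_infinity_along (r i) (s i) z"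
        by (rule closure_of_affine_sequence[OF nz[OF i]]) blast
      define \<tau> where "\<tau> = (\<lambda>n. 1 / along (r i) (s i) (z n))"
      have one: "\<bar>along (r i) (s i) (z n)\<bar> \<ge> 1" for n
        using z(2) by (simp add: tends_to_infinity_along_def)
      have "along (r i) (s i) (z n) \<noteq> 0" for n
        using one[of n] by auto
      then have "\<tau> n \<noteq> 0 \<and> \<bar>\<tau> n\<bar> \<le> 1" for n
        using one[of n] by (simp add: \<tau>_def)
      moreover have "\<tau> \<longlonglongrightarrow> 0"
        using z(2) by (simp add: tends_to_infinity_along_def \<tau>_def)
      moreover have "eval2 b (z n) = t" for n
        using z(1)[of n] by (simp add: real_curve_def)
      then have "laurent_approx \<tau> (\<phi> i a) (\<lambda>n. eval2 a (z n))" for a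
        using br z(2) unfolding branch_def \<tau>_def by blast
      ultimately show "\<exists>z \<tau>. (\<forall>n. z n \<in> ?Z) \<and> \<tau> \<longlonglongrightarrow> 0 \<and> (\<forall>n. \<tau> n \<noteq> 0 \<and> \<bar>\<tau> n\<bar> \<le> 1) \<and>
          (\<forall>a. laurent_approx \<tau> (\<phi> i a) (\<lambda>n. eval2 a (z n)))"
        using z(1) by blast
    next
      show "eval2 ?p z = 0" if "z \<in> ?Z" for z
        using that by (simp add: real_curve_def)
      show "deg_le m (g j)" if "j \<le> q" for j
        by (rule deg_g[OF that])
      show "0 \<le> eval2 (g j) z" if "j \<le> q" "z \<in> ?Z" for j z
        using that g by (simp add: nonneg_set_def)
    qed
    then show ?thesis by blast
  qed

  have key: "f \<in> seq_closure M"
    if f: "\<And>t. t \<in> {lam..Lam} \<Longrightarrow> f \<in> double_dual (fibre_module M (b - const2 t))" for f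
  proof -
    define D where "D = 2 * curve_module.degree_bound d m (tdegree f) + m"
    show ?thesis
    proof (rule glue_fibre_representations)
      fix t
      assume t: "t \<in> {lam..Lam}"
      let ?p = "b - const2 t"
      obtain \<phi> where "curve_module d ?p r s \<phi> (nonneg_set M \<inter> real_curve ?p) q g m"
        using fibre[OF t] by blast
      then interpret curve_module d ?p r s \<phi> "nonneg_set M \<inter> real_curve ?p" q g m .
      have cone_eq: "fibre_module M ?p = cone"
        unfolding fibre_module_def cone_def by (subst M_gen) blast
      have "double_dual cone \<subseteq> cone"
      proof (rule double_dual_subset_closed_cone)
        show "degreewise_closed cone"
          unfolding degreewise_closed_def using cone_closed by blast
        have fibreI: "x \<in> cone" if "x = a + h * ?p" "a \<in> M" for x a h
          using that unfolding cone_eq[symmetric] fibre_module_def by blast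
        show "0 \<in> cone"
          using M_zero by (intro fibreI[of _ 0 0]) simp_all
        show "x + y \<in> cone" if xy: "x \<in> cone" "y \<in> cone" for x y
        proof -
          obtain a h a' h' where "x = a + h * ?p" "a \<in> M" "y = a' + h' * ?p" "a' \<in> M"
            using xy unfolding cone_eq[symmetric] fibre_module_def by blast
          then show ?thesis
            by (intro fibreI[of _ "a + a'" "h + h'"] M_add) (simp_all add: algebra_simps)
        qed
        show "const2 c * x \<in> cone" if c: "c \<ge> 0" and x: "x \<in> cone" for c x
        proof -
          obtain a h where ah: "x = a + h * ?p" "a \<in> M"
            using x unfolding cone_eq[symmetric] fibre_module_def by blast
          have "const2 c * x = const2 c * a + (const2 c * h) * ?p"
            unfolding ah(1) by (simp only: distrib_left mult.assoc)
          then show ?thesis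
            using M_const_mult[OF c ah(2)] by (rule fibreI)
        qed
      qed
      moreover have "f \<in> double_dual cone"
        using f[OF t] unfolding cone_eq .
      ultimately have "f \<in> cone"
        by (rule subsetD)
      then obtain a h where a: "deg_le (2 * degree_bound (tdegree f) + m) h"
        "f = (\<Sum>j\<le>q. (\<Sum>l<num_squares (tdegree f). (a j l)\<^sup>2) * g j) + h * ?p"
        by (rule stable_representation[OF _ deg_le_tdegree]) (rule that; assumption)
      have "(\<Sum>j\<le>q. (\<Sum>l<num_squares (tdegree f). (a j l)\<^sup>2) * g j) \<in> M"
        unfolding M_gen mem_Collect_eq
        by (intro exI[of _ "\<lambda>j. \<Sum>l<num_squares (tdegree f). (a j l)\<^sup>2"]) (simp add: sums_of_squares_sum)
      with a[folded D_def] show "\<exists>m h. m \<in> M \<and> deg_le D h \<and> f = m + h * ?p"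
        by (intro exI conjI)
    qed
  qed

  have eq: "seq_closure M = double_dual M"
  proof
    show "double_dual M \<subseteq> seq_closure M"
      using key double_dual_mono[OF subset_fibre_module] by blast
  qed (rule seq_closure_subset_double_dual)
  moreover have "ddagger_property M" if SMP: "\<forall>t\<in>{lam..Lam}. SMP (fibre_module M (b - const2 t))"
    unfolding ddagger_property_def
  proof
    show "seq_closure M \<subseteq> Pos (nonneg_set M)"
      using eq double_dual_subset_Pos by blast
    show "Pos (nonneg_set M) \<subseteq> seq_closure M"
    proof
      fix f
      assume f: "f \<in> Pos (nonneg_set M)"
      show "f \<in> seq_closure M"
      proof (rule key)
        fix t
        assume t: "t \<in> {lam..Lam}"
        have "nonneg_set (fibre_module M (b - const2 t)) \<subseteq> nonneg_set M"
          using subset_fibre_module unfolding nonneg_set_def by blast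
        then have "f \<in> Pos (nonneg_set (fibre_module M (b - const2 t)))"
          using f unfolding Pos_def by blast
        then show "f \<in> double_dual (fibre_module M (b - const2 t))"
          using SMP t unfolding SMP_def by blast
      qed
    qed
  qed
  ultimately show ?thesis by blast
qed

end
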